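(* Let $\xi \in \mathcal{D}_1$ and let $N$, $M$ be arbitrary non-negative integers. Let $\mu$ and $\nu$ be complex numbers satisfying $|\Re\mu | <\min \left( N + \frac{1}{2},M + \frac{1}{2} \right)$ and $\Re\nu > \max \left( N - \frac{1}{2},M - \frac{1}{2} \right)$. Then there exist remainder terms $R_N^{(P1)} (\xi ,\mu ,\nu )$ and $R_M^{(P2)} (\xi ,\mu ,\nu )$ such that $$\begin{aligned} P_\nu ^\mu (\cosh \xi ) =\; & \frac{e^{ \left(\nu+\frac{1}{2} \right)\xi}}{\Gamma (\nu - \mu + 1)\sqrt{2\pi \sinh \xi}} \left( \sum_{n = 0}^{N - 1} a_n (\mu ) \Gamma \left( \nu - n + \tfrac{1}{2} \right) \left( \frac{-e^{ - \xi } }{\sinh \xi } \right)^n + R_N^{(P1)} (\xi ,\mu ,\nu ) \right)\\ & + \frac{C(\xi ,\mu ) e^{- \left(\nu+\frac{1}{2} \right)\xi}}{\Gamma (\nu - \mu + 1)\sqrt{2\pi \sinh \xi}} \left( \sum_{m = 0}^{M - 1} a_m (\mu ) \Gamma \left( \nu - m + \tfrac{1}{2} \right)\left( \frac{e^\xi }{\sinh \xi} \right)^m + R_M^{(P2)} (\xi ,\mu ,\nu ) \right),\end{aligned}$$ and the remainder terms satisfy the estimates $$\begin{aligned}\left| R_N^{(P1)} (\xi ,\mu ,\nu ) \right| \le \; & \left|\frac{ \cos (\pi \mu ) }{ \cos (\pi \Re\mu ) }\right|\left| a_N (\Re\mu ) \right| \Gamma \left( \Re\nu - N + \tfrac{1}{2}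 \right) \left| \frac{e^{ - \xi } }{\sinh \xi } \right|^N \\ & \times \begin{cases} 1 & \text{if } \Re (e^{2\xi } ) \le 1, \\ \min\left(\left| 1 - e^{ - 2\xi } \right|\left| \csc (2\Im\xi ) \right|,\,1 + \chi\left(N+\tfrac{1}{2}\right)\right) & \text{if } \Re (e^{2\xi } ) > 1, \end{cases}\end{aligned}$$ and $$\left| R_M^{(P2)} (\xi ,\mu ,\nu ) \right| \le \left|\frac{\cos (\pi \mu )}{\cos (\pi \Re\mu )}\right|\left|a_M (\Re\mu )\right|\Gamma \left( \Re\nu - M + \tfrac{1}{2} \right)\left| \frac{e^\xi}{\sinh \xi } \right|^M .$$ If $2\Re\mu $ is an odd integer, then the limiting values have to be taken in these bounds. The square roots are positive for positive real $\xi$ and are defined by continuity elsewhere. In addition, $R_M^{(P2)} (\xi ,\mu ,\nu )$ does not exceed the corresponding first neglected term $a_M(\mu)\Gamma(\nu-M+\frac12)\left(\frac{e^\xi}{\sinh\xi}\right)^M$ in absolute value and has the same sign, provided that $\xi$ is positive, $\mu$ and $\nu$ are real, $|\mu| <M + \frac{1}{2}$ and $\nu > M - \frac{1}{2}$.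
   Context: $\mathcal{D}_1=\{\xi\in\mathbb{C} : \Re \xi>0,\ |\Im \xi |<\pi\}$; $\cosh$ maps $\mathcal{D}_1$ biholomorphically onto $\mathbb{C}\setminus(-\infty,1]$. The associated Legendre function of the first kind is $P_\nu ^\mu (z) = \left(\frac{z + 1}{z - 1}\right)^{\mu /2}\mathbf{F}\left(\nu+1,-\nu;1-\mu;\frac{1-z}{2}\right)$ for $z\in\mathbb{C}\setminus(-\infty,1]$, where the power has its principal branch (positive base for $z>1$) and $\mathbf{F}(a,b;c;w)$ is the regularised hypergeometric function, $\mathbf{F}(a,b;c;w)=\sum_{n\ge 0}\frac{(a)_n(b)_n}{\Gamma(c+n)\,n!}w^n$ for $|w|<1$, continued analytically to $w\in\mathbb{C}\setminus[1,+\infty)$. $a_n (\mu ) = \frac{(4\mu ^2 - 1^2 )(4\mu ^2 - 3^2 ) \cdots (4\mu ^2 - (2n - 1)^2 )}{8^n n!}=\frac{(\frac12-\mu)_n(\frac12+\mu)_n}{(-2)^n n!}$, with $(\cdot)_n$ the Pochhammer symbol. $C(\xi ,\mu ) = \sin (\pi \mu )$ if $\xi > 0$, and $C(\xi,\mu)=\pm i\, e^{ \mp \pi i\mu }$ if $0<\pm \Im\xi < \pi$. $\chi(p)= \frac{\sqrt\pi\,\Gamma\left(\frac{p}{2}+1\right)}{\Gamma\left(\frac{p}{2}+\frac{1}{2}\right)}$ for $p>0$. "Limiting value" means that $|a_N(\Re\mu)|/|\cos(\pi\Re\mu)|$ is replaced by $\lim_{x\to\Re\mu}|a_N(x)|/|\cos(\pi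 x)|$. When $\sin(2\Im\xi)=0$, $|\csc(2\Im\xi)|$ is read as $+\infty$. *)

theory Defs
  imports "HOL-Complex_Analysis.Complex_Analysis"
begin

definition D1 :: "complex set" where
  "D1 = {\<xi>. Re \<xi> > 0 \<and> \<bar>Im \<xi>\<bar> < pi}"

definition slit_plane :: "complex set" where
  "slit_plane = - (complex_of_real ` {1..})"

text \<open>
  \<open>hyp2F1_reg\<close> is the analytic continuation of the regularised hypergeometric series
  from the unit disc to the plane cut along \<open>[1, \<infinity>)\<close>. By the lemma
  \<open>slit_plane_continuation_unique\<close> below, the choice operator only affects
  values on the cut.
\<close>

definition hyp2F1_reg_series :: "complex \<Rightarrow> complex \<Rightarrow> complex \<Rightarrow> complex \<Rightarrow> complex" where
  "hyp2F1_reg_series a b c w =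
     (\<Sum>n. pochhammer a n * pochhammer b n / fact n * rGamma (c + of_nat n) * w ^ n)"

definition hyp2F1_reg :: "complex \<Rightarrow> complex \<Rightarrow> complex \<Rightarrow> complex \<Rightarrow> complex" where
  "hyp2F1_reg a b c =
     (SOME F. F holomorphic_on slit_plane \<and> (\<forall>w. norm w < 1 \<longrightarrow> F w = hyp2F1_reg_series a b c w))"

text \<open>For \<open>z\<close> off the cut \<open>(-\<infinity>, 1]\<close> the base of the power is off \<open>(-\<infinity>, 0]\<close>.\<close>

definition legendre_P :: "complex \<Rightarrow> complex \<Rightarrow> complex \<Rightarrow> complex" where
  "legendre_P \<nu> \<mu> z =
     ((z + 1) / (z - 1)) powr (\<mu> / 2) * hyp2F1_reg (\<nu> + 1) (- \<nu>) (1 - \<mu>) ((1 - z) / 2)"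

definition a_coeff :: "nat \<Rightarrow> 'a :: field_char_0 \<Rightarrow> 'a" where
  "a_coeff n \<mu> = (\<Prod>k=1..n. 4 * \<mu>\<^sup>2 - (2 * of_nat k - 1)\<^sup>2) / (8 ^ n * fact n)"

text \<open>On \<open>D1\<close>, \<open>Im \<xi> = 0\<close> means that \<open>\<xi>\<close> is a positive real.\<close>

definition C_coeff :: "complex \<Rightarrow> complex \<Rightarrow> complex" where
  "C_coeff \<xi> \<mu> =
     (if Im \<xi> = 0 then sin (of_real pi * \<mu>)
      else if Im \<xi> > 0 then \<i> * exp (- (of_real pi * \<i> * \<mu>))
      else - \<i> * exp (of_real pi * \<i> * \<mu>))"

definition chi :: "real \<Rightarrow> real" where
  "chi p = sqrt pi * Gamma (p / 2 + 1) / Gamma (p / 2 + 1 / 2)"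

text \<open>\<open>|a\<^sub>N(x)| / |cos(\<pi> x)|\<close>, with its limiting value where the cosine vanishes.\<close>

definition a_cos_ratio :: "nat \<Rightarrow> real \<Rightarrow> real" where
  "a_cos_ratio N x =
     (if \<exists>k::int. odd k \<and> 2 * x = of_int k
      then Lim (at x) (\<lambda>t. \<bar>a_coeff N t\<bar> / \<bar>cos (pi * t)\<bar>)
      else \<bar>a_coeff N x\<bar> / \<bar>cos (pi * x)\<bar>)"

text \<open>The innermost case is the minimum with \<open>|csc (2 Im \<xi>)| = +\<infinity>\<close>.\<close>

definition P1_factor :: "nat \<Rightarrow> complex \<Rightarrow> real" where
  "P1_factor N \<xi> =
     (if Re (exp (2 * \<xi>)) \<le> 1 then 1
      else if sin (2 * Im \<xi>) = 0 then 1 + chi (real N + 1 / 2)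
      else min (norm (1 - exp (- 2 * \<xi>)) * \<bar>1 / sin (2 * Im \<xi>)\<bar>) (1 + chi (real N + 1 / 2)))"

definition P1_term :: "nat \<Rightarrow> complex \<Rightarrow> complex \<Rightarrow> complex \<Rightarrow> complex" where
  "P1_term n \<xi> \<mu> \<nu> = a_coeff n \<mu> * Gamma (\<nu> - of_nat n + 1 / 2) * (- exp (- \<xi>) / sinh \<xi>) ^ n"

definition P2_term :: "nat \<Rightarrow> complex \<Rightarrow> complex \<Rightarrow> complex \<Rightarrow> complex" where
  "P2_term n \<xi> \<mu> \<nu> = a_coeff n \<mu> * Gamma (\<nu> - of_nat n + 1 / 2) * (exp \<xi> / sinh \<xi>) ^ n"

lemma open_slit_plane: "open slit_plane"
proof -
  have "closed (complex_of_real ` {1..})"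
  proof -
    have "complex_of_real ` {1..} = {z. Re z \<ge> 1} \<inter> \<real>"
    proof (intro equalityI subsetI)
      fix z assume "z \<in> {z. Re z \<ge> 1} \<inter> \<real>"
      then show "z \<in> complex_of_real ` {1..}"
        by (intro image_eqI[of _ _ "Re z"]) (simp_all add: of_real_Re)
    qed auto
    then show ?thesis
      by (simp add: closed_Int closed_halfspace_Re_ge closed_complex_Reals)
  qed
  then show ?thesis
    by (simp add: slit_plane_def open_Compl)
qed

lemma connected_slit_plane: "connected slit_plane"
proof (rule starlike_imp_connected)
  have "closed_segment 0 z \<subseteq> slit_plane" if z: "z \<in> slit_plane" for z
  proof
    fix w assume "w \<in> closed_segment 0 z"
    then obtain u where u: "0 \<le> u" "u \<le> 1" "w = of_real u * z"
      by (auto simp: in_segment scaleR_conv_of_real)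
    show "w \<in> slit_plane"
    proof (rule ccontr)
      assume "w \<notin> slit_plane"
      then obtain t where t: "t \<ge> 1" "of_real u * z = of_real t"
        using u by (auto simp: slit_plane_def)
      then have "u > 0" using u by (cases "u = 0") auto
      then have "z = of_real (t / u)" "t / u \<ge> 1"
        using t u by (auto simp: field_simps)
      then have "z \<in> complex_of_real ` {1..}"
        by (intro image_eqI[of _ _ "t / u"]) simp_all
      then show False using z by (simp add: slit_plane_def)
    qed
  qed
  moreover have "0 \<in> slit_plane"
    by (auto simp: slit_plane_def)
  ultimately show "starlike slit_plane"
    unfolding starlike_def by blast
qed

lemma ball_subset_slit_plane: "ball 0 1 \<subseteq> slit_plane"
  by (auto simp: slit_plane_def)

lemma slit_plane_continuation_unique:
  assumes "F holomorphic_on slit_plane" "G holomorphic_on slit_plane"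
    and "\<And>w. norm w < 1 \<Longrightarrow> F w = G w" and "w \<in> slit_plane"
  shows "F w = G w"
proof (rule analytic_continuation_open[OF open_ball open_slit_plane _ connected_slit_plane
        ball_subset_slit_plane assms(1,2) _ assms(4)])
  show "F z = G z" if "z \<in> ball 0 1" for z
    using that assms(3) by simp
qed simp

text \<open>
  The principal square root is the branch of \<open>sqrt (2 \<pi> sinh \<xi>)\<close> on \<open>D1\<close> that is
  continuous and positive for positive \<open>\<xi>\<close>.
\<close>

lemma sinh_D1_notin_nonpos_Reals:
  assumes "\<xi> \<in> D1"
  shows "2 * of_real pi * sinh \<xi> \<notin> \<real>\<^sub>\<le>\<^sub>0"
proof
  assume *: "2 * of_real pi * sinh \<xi> \<in> \<real>\<^sub>\<le>\<^sub>0"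
  have \<xi>: "Re \<xi> > 0" "\<bar>Im \<xi>\<bar> < pi" using assms by (auto simp: D1_def)
  have Re: "Re (sinh \<xi>) = sinh (Re \<xi>) * cos (Im \<xi>)"
    and Im: "Im (sinh \<xi>) = cosh (Re \<xi>) * sin (Im \<xi>)"
    by (simp_all add: sinh_def cosh_def Re_exp Im_exp algebra_simps)
  have "2 * pi * Re (sinh \<xi>) \<le> 0" "2 * pi * Im (sinh \<xi>) = 0"
    using * by (simp_all add: complex_nonpos_Reals_iff)
  then have "sinh (Re \<xi>) * cos (Im \<xi>) \<le> 0" "cosh (Re \<xi>) * sin (Im \<xi>) = 0"
    unfolding Re Im using pi_gt_zero by (simp_all add: mult_le_0_iff)
  moreover have "sinh (Re \<xi>) > 0" "cosh (Re \<xi>) > 0"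
    using \<xi> by simp_all
  ultimately have "cos (Im \<xi>) \<le> 0" "sin (Im \<xi>) = 0"
    by (simp_all add: mult_le_0_iff)
  moreover have "Im \<xi> = 0"
    by (rule sin_eq_0_pi) (use \<xi> \<open>sin (Im \<xi>) = 0\<close> in linarith)+
  ultimately show False by simp
qed

lemma continuous_on_sqrt_sinh: "continuous_on D1 (\<lambda>\<xi>. csqrt (2 * of_real pi * sinh \<xi>))"
proof (rule holomorphic_on_imp_continuous_on, rule holomorphic_on_csqrt')
  show "(\<lambda>\<xi>. 2 * of_real pi * sinh \<xi>) holomorphic_on D1"
    unfolding sinh_field_def by (intro holomorphic_intros) simp
qed (rule sinh_D1_notin_nonpos_Reals)

lemma csqrt_sinh_of_real:
  assumes "x > 0"
  shows "csqrt (2 * of_real pi * sinh (of_real x)) = of_real (sqrt (2 * pi * sinh x))"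
proof -
  have "2 * of_real pi * sinh (complex_of_real x) = of_real (2 * pi * sinh x)"
    by (simp add: sinh_def exp_of_real scaleR_conv_of_real flip: of_real_minus)
  moreover have "2 * pi * sinh x \<ge> 0"
    using assms by simp
  ultimately show ?thesis
    by (metis Im_complex_of_real Re_complex_of_real csqrt_of_real_nonneg)
qed

end

theory Submission
  imports Defs "HOL-Real_Asymp.Real_Asymp"
begin

text \<open>
  The remainders are iterated Gamma and Beta integrals of the terminant, the integral of
  \<open>u powr (p - 1) * exp (- u) / (1 + u * q)\<close> over \<open>u > 0\<close> with \<open>p = N + 1/2\<close>. Expanding the geometric
  kernel produces the finite sums; lower bounds for \<open>|1 + u q|\<close>, or near the cut a Laplace
  representation of the kernel, give the error bounds. For \<open>N = 0\<close> and small real \<open>\<mu>\<close>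
  the remainder collapses to an Euler integral along a ray, and Cauchy's theorem in the half-strip
  \<open>Re t < 0\<close>, \<open>|Im t| < b\<close> expresses the Mehler--Dirichlet integral at \<open>\<xi> = \<plusminus>ib\<close> as the
  difference of two such rays. Analytic continuation in \<open>\<mu>\<close> and then in \<open>\<xi>\<close> yields the expansion
  off the real axis. On the positive axis the argument \<open>- exp (- \<xi>) / sinh \<xi>\<close> lies on the cut, and
  averaging the two boundary values turns the two connection coefficients into the sine.
\<close>

section \<open>Set integrals and parameter integrals\<close>

lemma set_integral_cong:
  assumes "\<And>x. x \<in> A \<Longrightarrow> f x = g x"
  shows "(LINT x:A|M. f x) = (LINT x:A|M. g x)"
  unfolding set_lebesgue_integral_def
  by (rule Bochner_Integration.integral_cong) (auto simp: assms indicator_def)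

lemma set_integrable_eq_on:
  assumes "set_integrable M A f" and "\<And>x. x \<in> A \<Longrightarrow> f x = g x"
  shows "set_integrable M A g"
  using assms by (simp cong: set_integrable_cong)

lemma set_integrable_of_real_iff:
  "set_integrable M A (\<lambda>x. complex_of_real (f x)) \<longleftrightarrow> set_integrable M A f"
  unfolding set_integrable_def
  by (subst complex_of_real_integrable_eq[symmetric]) (simp add: scaleR_conv_of_real)

lemma set_borel_measurable_continuous:
  fixes f :: "real \<Rightarrow> 'b::euclidean_space"
  assumes "A \<in> sets borel" "continuous_on A f"
  shows "set_borel_measurable lborel A f"
  using borel_measurable_continuous_on_indicator[OF assms] by (simp add: set_borel_measurable_def)

lemma set_integrable_imp_set_borel_measurable:
  "set_integrable M A f \<Longrightarrow> set_borel_measurable M A f"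
  by (simp add: set_integrable_def set_borel_measurable_def)

lemma set_integrable_bound_continuous:
  fixes f :: "real \<Rightarrow> 'b::euclidean_space"
  assumes "A \<in> sets borel" "continuous_on A f" "set_integrable lborel A g"
    and "\<And>x. x \<in> A \<Longrightarrow> norm (f x) \<le> (g x :: real)"
  shows "set_integrable lborel A f"
proof (rule set_integrable_bound[OF assms(3) set_borel_measurable_continuous[OF assms(1,2)]])
  show "AE x in lborel. x \<in> A \<longrightarrow> norm (f x) \<le> norm (g x)"
    using assms(4) by (intro AE_I2) force
qed

lemma set_integral_norm_bound_le:
  fixes f :: "'a \<Rightarrow> 'b::euclidean_space"
  assumes "set_integrable M A g" and "\<And>x. x \<in> A \<Longrightarrow> norm (f x) \<le> g x"
  shows "norm (LINT x:A|M. f x) \<le> (LINT x:A|M. g x)"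
proof -
  have "norm (LINT x:A|M. f x) \<le> (\<integral>x. norm (indicator A x *\<^sub>R f x) \<partial>M)"
    unfolding set_lebesgue_integral_def by (rule integral_norm_bound)
  also have "\<dots> \<le> (LINT x:A|M. g x)"
    unfolding set_lebesgue_integral_def
  proof (rule integral_mono')
    show "integrable M (\<lambda>x. indicator A x *\<^sub>R g x)"
      using assms(1) by (simp add: set_integrable_def)
    show "norm (indicator A x *\<^sub>R f x) \<le> indicator A x *\<^sub>R g x" for x
      using assms(2)[of x] by (auto simp: indicator_def)
    show "0 \<le> indicator A x *\<^sub>R g x" for x
      using assms(2)[of x] order_trans[OF norm_ge_zero[of "f x"]] by (auto simp: indicator_def)
  qed
  finally show ?thesis .
qed

lemma set_integral_dominated_convergence:
  fixes f :: "'a \<Rightarrow> 'b::euclidean_space"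
  assumes g: "set_integrable M A g"
    and s: "\<And>n. set_borel_measurable M A (s n)"
    and bound: "\<And>n x. x \<in> A \<Longrightarrow> norm (s n x) \<le> g x"
    and lim: "\<And>x. x \<in> A \<Longrightarrow> (\<lambda>n. s n x) \<longlonglongrightarrow> f x"
  shows "(\<lambda>n. LINT x:A|M. s n x) \<longlonglongrightarrow> (LINT x:A|M. f x)"
  unfolding set_lebesgue_integral_def
proof (rule integral_dominated_convergence[where w = "\<lambda>x. indicator A x *\<^sub>R g x"])
  have lim': "(\<lambda>n. indicator A x *\<^sub>R s n x) \<longlonglongrightarrow> indicator A x *\<^sub>R f x" for x
    using lim[of x] by (auto simp: indicator_def)
  show "(\<lambda>x. indicator A x *\<^sub>R f x) \<in> borel_measurable M"
    using lim' by (rule borel_measurable_LIMSEQ_metric[rotated])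
      (use s in \<open>simp add: set_borel_measurable_def\<close>)
  show "AE x in M. (\<lambda>n. indicator A x *\<^sub>R s n x) \<longlonglongrightarrow> indicator A x *\<^sub>R f x"
    using lim' by simp
  show "AE x in M. norm (indicator A x *\<^sub>R s n x) \<le> indicator A x *\<^sub>R g x" for n
    using bound by (intro AE_I2) (auto simp: indicator_def)
qed (use g s in \<open>simp_all add: set_integrable_def set_borel_measurable_def\<close>)

lemma integral_Icc_tendsto_set_integral:
  fixes f :: "nat \<Rightarrow> real \<Rightarrow> 'b::euclidean_space"
  assumes sub: "\<And>n. {a n..b n} \<subseteq> A" and cont: "\<And>n. continuous_on {a n..b n} (f n)"
    and g: "set_integrable lborel A g"
    and bound: "\<And>n x. x \<in> {a n..b n} \<Longrightarrow> norm (f n x) \<le> g x"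
    and exhaust: "\<And>x. x \<in> A \<Longrightarrow> \<forall>\<^sub>F n in sequentially. x \<in> {a n..b n}"
    and lim: "\<And>x. x \<in> A \<Longrightarrow> (\<lambda>n. f n x) \<longlonglongrightarrow> F x"
    and nonneg: "\<And>x. x \<in> A \<Longrightarrow> g x \<ge> 0"
  shows "(\<lambda>n. integral {a n..b n} (f n)) \<longlonglongrightarrow> (LINT x:A|lborel. F x)"
proof -
  let ?f = "\<lambda>n x. indicator {a n..b n} x *\<^sub>R f n x"
  have restrict: "(\<lambda>x. indicator A x *\<^sub>R ?f n x) = ?f n" for n
    using sub[of n] by (auto simp: indicator_def fun_eq_iff)
  have int: "set_integrable lborel {a n..b n} (f n)" for n
    using cont by (rule borel_integrable_atLeastAtMost')
  have "(\<lambda>n. LINT x:A|lborel. ?f n x) \<longlonglongrightarrow> (LINT x:A|lborel. F x)"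
  proof (rule set_integral_dominated_convergence[OF g])
    show "set_borel_measurable lborel A (?f n)" for n
      using int[of n] by (simp only: set_borel_measurable_def restrict set_integrable_def borel_measurable_integrable)
    show "norm (?f n x) \<le> g x" if "x \<in> A" for n x
      using bound[of x n] nonneg[OF that] by (auto simp: indicator_def)
    show "(\<lambda>n. ?f n x) \<longlonglongrightarrow> F x" if "x \<in> A" for x
      by (rule Lim_transform_eventually[OF lim[OF that]])
        (use exhaust[OF that] in eventually_elim, simp)
  qed
  moreover have "(LINT x:A|lborel. ?f n x) = integral {a n..b n} (f n)" for n
    using set_borel_integral_eq_integral(2)[OF int] by (simp only: set_lebesgue_integral_def restrict)
  ultimately show ?thesis by simp
qed

lemma set_integrable_lborel_iff_absolutely_integrable:
  fixes f :: "real \<Rightarrow> 'b::euclidean_space"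
  assumes "A \<in> sets borel" "continuous_on A f"
  shows "set_integrable lborel A f \<longleftrightarrow> f absolutely_integrable_on A"
proof -
  have "(\<lambda>x. indicator A x *\<^sub>R f x) \<in> borel_measurable lborel"
    using borel_measurable_continuous_on_indicator[OF assms] by simp
  then show ?thesis
    unfolding set_integrable_def by (rule integrable_completion[symmetric])
qed

lemma set_integral_substitution:
  fixes f :: "real \<Rightarrow> 'b::euclidean_space" and g :: "real \<Rightarrow> real"
  assumes bij: "bij_betw g S T"
    and deriv: "\<And>x. x \<in> S \<Longrightarrow> (g has_field_derivative g' x) (at x)" and g': "continuous_on S g'"
    and f: "continuous_on T f" "set_integrable lborel T f"
    and borel: "S \<in> sets borel" "T \<in> sets borel"
  shows "set_integrable lborel S (\<lambda>x. \<bar>g' x\<bar> *\<^sub>R f (g x))"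
    and "(LINT x:S|lborel. \<bar>g' x\<bar> *\<^sub>R f (g x)) = (LINT y:T|lborel. f y)"
proof -
  have im: "g ` S = T" and inj: "inj_on g S"
    using bij by (auto simp: bij_betw_def)
  have "continuous_on S g"
    using deriv by (meson DERIV_isCont continuous_at_imp_continuous_on)
  then have cont: "continuous_on S (\<lambda>x. \<bar>g' x\<bar> *\<^sub>R f (g x))"
    by (intro continuous_intros g' continuous_on_compose2[OF f(1)]) (use im in auto)
  have "f absolutely_integrable_on g ` S \<and> integral (g ` S) f = integral T f"
    using f im set_integrable_lborel_iff_absolutely_integrable[OF borel(2) f(1)] by simp
  then have transformed: "(\<lambda>x. \<bar>g' x\<bar> *\<^sub>R f (g x)) absolutely_integrable_on S \<and>
      integral S (\<lambda>x. \<bar>g' x\<bar> *\<^sub>R f (g x)) = integral T f"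
    by (subst has_absolute_integral_change_of_variables_real)
       (use borel inj deriv in \<open>auto intro: has_field_derivative_at_within\<close>)
  then show int: "set_integrable lborel S (\<lambda>x. \<bar>g' x\<bar> *\<^sub>R f (g x))"
    using set_integrable_lborel_iff_absolutely_integrable[OF borel(1) cont] by simp
  show "(LINT x:S|lborel. \<bar>g' x\<bar> *\<^sub>R f (g x)) = (LINT y:T|lborel. f y)"
    using transformed set_borel_integral_eq_integral(2)[OF int] set_borel_integral_eq_integral(2)[OF f(2)] by simp
qed

lemma set_integral_scale_Ioi:
  fixes f :: "real \<Rightarrow> 'b::euclidean_space"
  assumes "c > 0"
  shows "set_integrable lborel {0<..} (\<lambda>x. f (c * x)) \<longleftrightarrow> set_integrable lborel {0<..} f"
    and "(LINT x:{0<..}|lborel. f (c * x)) = (1 / c) *\<^sub>R (LINT x:{0<..}|lborel. f x)"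
proof -
  let ?f = "\<lambda>x. indicator {0<..} x *\<^sub>R f x"
  have scaled: "(\<lambda>x. indicator {0<..} x *\<^sub>R f (c * x)) = (\<lambda>x. ?f (0 + c * x))"
    using assms by (auto simp: indicator_def zero_less_mult_iff fun_eq_iff)
  show "set_integrable lborel {0<..} (\<lambda>x. f (c * x)) \<longleftrightarrow> set_integrable lborel {0<..} f"
    unfolding set_integrable_def scaled
    by (rule lborel_integrable_real_affine_iff) (use assms in simp)
  have "(LINT x:{0<..}|lborel. f x) = \<bar>c\<bar> *\<^sub>R (LINT x|lborel. ?f (0 + c * x))"
    unfolding set_lebesgue_integral_def
    by (rule lborel_integral_real_affine) (use assms in simp)
  then show "(LINT x:{0<..}|lborel. f (c * x)) = (1 / c) *\<^sub>R (LINT x:{0<..}|lborel. f x)"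
    using assms unfolding set_lebesgue_integral_def scaled by simp
qed

lemma set_integrable_reflect:
  fixes f :: "real \<Rightarrow> 'b::euclidean_space"
  shows "set_integrable lborel (uminus ` A) (\<lambda>x. f (- x)) \<longleftrightarrow> set_integrable lborel A f"
proof -
  have "x \<in> uminus ` A \<longleftrightarrow> - x \<in> A" for x
    by force
  then have "(\<lambda>x. indicator (uminus ` A) x *\<^sub>R f (- x)) = (\<lambda>x. indicator A (0 + (- 1) * x) *\<^sub>R f (0 + (- 1) * x))"
    by (simp add: indicator_def fun_eq_iff)
  then show ?thesis
    unfolding set_integrable_def
    by (simp only:) (rule lborel_integrable_real_affine_iff, simp)
qed

lemma set_integral_Fubini:
  fixes f :: "real \<Rightarrow> real \<Rightarrow> 'b::euclidean_space"
  assumes A: "A \<in> sets borel" and B: "B \<in> sets borel"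
    and cont: "continuous_on (A \<times> B) (\<lambda>(x, y). f x y)"
    and inner: "\<And>x. x \<in> A \<Longrightarrow> set_integrable lborel B (f x)"
    and outer: "set_integrable lborel A (\<lambda>x. LINT y:B|lborel. norm (f x y))"
  shows "(LINT x:A|lborel. LINT y:B|lborel. f x y) = (LINT y:B|lborel. LINT x:A|lborel. f x y)"
proof -
  let ?F = "\<lambda>p. indicator (A \<times> B) p *\<^sub>R (case p of (x, y) \<Rightarrow> f x y)"
  have row: "?F (x, y) = indicator A x *\<^sub>R (indicator B y *\<^sub>R f x y)"
    and col: "?F (x, y) = indicator B y *\<^sub>R (indicator A x *\<^sub>R f x y)" for x y
    by (auto simp: indicator_def)
  have "?F \<in> borel_measurable borel"
    by (rule borel_measurable_continuous_on_indicator[OF _ cont]) (use A B in \<open>auto simp: borel_prod[symmetric]\<close>)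
  then have meas: "?F \<in> borel_measurable (lborel \<Otimes>\<^sub>M lborel)"
    by (simp add: lborel_prod)
  have "integrable (lborel \<Otimes>\<^sub>M lborel) ?F"
  proof (rule lborel_pair.Fubini_integrable[OF meas])
    have "(\<lambda>x. \<integral>y. norm (?F (x, y)) \<partial>lborel) = (\<lambda>x. indicator A x *\<^sub>R (LINT y:B|lborel. norm (f x y)))"
      by (auto simp: set_lebesgue_integral_def indicator_def fun_eq_iff intro!: Bochner_Integration.integral_cong)
    then show "integrable lborel (\<lambda>x. \<integral>y. norm (?F (x, y)) \<partial>lborel)"
      using outer by (simp add: set_integrable_def)
    show "AE x in lborel. integrable lborel (\<lambda>y. ?F (x, y))"
    proof (intro AE_I2)
      show "integrable lborel (\<lambda>y. ?F (x, y))" for x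
        unfolding row using inner[of x] by (cases "x \<in> A") (auto simp: set_integrable_def)
    qed
  qed
  then have "integrable (lborel \<Otimes>\<^sub>M lborel) (case_prod (\<lambda>x y. ?F (x, y)))"
    by (simp add: case_prod_beta')
  from lborel_pair.Fubini_integral[OF this]
  have "(\<integral>y. (\<integral>x. ?F (x, y) \<partial>lborel) \<partial>lborel) = (\<integral>x. (\<integral>y. ?F (x, y) \<partial>lborel) \<partial>lborel)" .
  moreover have "(\<integral>x. (\<integral>y. ?F (x, y) \<partial>lborel) \<partial>lborel) = (LINT x:A|lborel. LINT y:B|lborel. f x y)"
    by (simp only: row set_lebesgue_integral_def integral_scaleR_right)
  moreover have "(\<integral>y. (\<integral>x. ?F (x, y) \<partial>lborel) \<partial>lborel) = (LINT y:B|lborel. LINT x:A|lborel. f x y)"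
    by (simp only: col set_lebesgue_integral_def integral_scaleR_right)
  ultimately show ?thesis by simp
qed

lemma has_field_derivative_set_integral:
  fixes f :: "complex \<Rightarrow> 'a \<Rightarrow> complex"
  assumes r: "r > 0" and int: "\<And>w. w \<in> ball z r \<Longrightarrow> set_integrable M A (f w)"
    and deriv: "\<And>t. t \<in> A \<Longrightarrow> ((\<lambda>w. f w t) has_field_derivative f' t) (at z)"
    and L: "set_integrable M A L"
    and lipschitz: "\<And>w t. w \<in> ball z r \<Longrightarrow> t \<in> A \<Longrightarrow> norm (f w t - f z t) \<le> L t * norm (w - z)"
  shows "((\<lambda>w. LINT t:A|M. f w t) has_field_derivative (LINT t:A|M. f' t)) (at z)"
  unfolding has_field_derivative_iff tendsto_at_iff_sequentially
proof (intro allI impI)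
  fix X :: "nat \<Rightarrow> complex"
  assume X: "\<forall>i. X i \<in> UNIV - {z}" and X_lim: "X \<longlonglongrightarrow> z"
  have "\<forall>\<^sub>F n in sequentially. X n \<in> ball z r"
    using X_lim r by (intro topological_tendstoD) auto
  then obtain k where k: "\<And>n. n \<ge> k \<Longrightarrow> X n \<in> ball z r"
    by (auto simp: eventually_sequentially)
  define Y where "Y n = X (n + k)" for n
  have Y: "Y n \<in> ball z r" "Y n \<noteq> z" for n
    using k X by (auto simp: Y_def)
  have Y_lim: "Y \<longlonglongrightarrow> z"
    unfolding Y_def using X_lim by (rule LIMSEQ_ignore_initial_segment)
  have int_z: "set_integrable M A (f z)"
    using int r by simp
  have "(\<lambda>n. LINT t:A|M. (f (Y n) t - f z t) / (Y n - z)) \<longlonglongrightarrow> (LINT t:A|M. f' t)"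
  proof (rule set_integral_dominated_convergence[OF L])
    show "set_borel_measurable M A (\<lambda>t. (f (Y n) t - f z t) / (Y n - z))" for n
      by (intro set_integrable_imp_set_borel_measurable set_integrable_divide set_integral_diff(1) int Y int_z)
    show "norm ((f (Y n) t - f z t) / (Y n - z)) \<le> L t" if "t \<in> A" for n t
      using lipschitz[OF Y(1) that, of n] Y(2)[of n] by (simp add: norm_divide field_simps)
    show "(\<lambda>n. (f (Y n) t - f z t) / (Y n - z)) \<longlonglongrightarrow> f' t" if "t \<in> A" for t
      using deriv[OF that] Y(2) Y_lim
      unfolding has_field_derivative_iff tendsto_at_iff_sequentially by (auto simp: o_def)
  qed
  moreover have "(LINT t:A|M. (f (Y n) t - f z t) / (Y n - z)) =
      ((LINT t:A|M. f (Y n) t) - (LINT t:A|M. f z t)) / (Y n - z)" for n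
    using int[OF Y(1)] int_z by simp
  ultimately have "(\<lambda>n. ((LINT t:A|M. f (X (n + k)) t) - (LINT t:A|M. f z t)) / (X (n + k) - z))
      \<longlonglongrightarrow> (LINT t:A|M. f' t)"
    by (simp only: Y_def)
  then show "((\<lambda>w. ((LINT t:A|M. f w t) - (LINT t:A|M. f z t)) / (w - z)) \<circ> X) \<longlonglongrightarrow> (LINT t:A|M. f' t)"
    unfolding o_def by (rule LIMSEQ_offset)
qed

lemma norm_diff_le_holomorphic_bounded:
  fixes f :: "complex \<Rightarrow> complex"
  assumes f: "f holomorphic_on ball z r" "\<And>v. v \<in> ball z r \<Longrightarrow> norm (f v) \<le> B" and w: "w \<in> ball z (r / 2)"
  shows "norm (f w - f z) \<le> 2 * B / r * norm (w - z)"
proof (rule field_differentiable_bound[where S = "ball z (r / 2)" and f' = "deriv f"])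
  have r: "r > 0"
    using w zero_le_dist[of z w] unfolding mem_ball by linarith
  fix y assume y: "y \<in> ball z (r / 2)"
  have sub: "cball y (r / 2) \<subseteq> ball z r"
  proof
    fix v assume "v \<in> cball y (r / 2)"
    then show "v \<in> ball z r"
      using y dist_triangle[of z v y] by (simp add: dist_commute)
  qed
  have "norm ((deriv ^^ 1) f y) \<le> fact 1 * B / (r / 2) ^ 1"
  proof (rule Cauchy_inequality)
    show "f holomorphic_on ball y (r / 2)"
      using order_trans[OF ball_subset_cball sub] by (rule holomorphic_on_subset[OF f(1)])
    show "continuous_on (cball y (r / 2)) f"
      using holomorphic_on_subset[OF f(1) sub] by (rule holomorphic_on_imp_continuous_on)
    show "norm (f v) \<le> B" if "norm (y - v) = r / 2" for v
      by (rule f(2), rule subsetD[OF sub]) (use that in \<open>simp add: dist_norm\<close>)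
  qed (use r in simp)
  then show "norm (deriv f y) \<le> 2 * B / r" by (simp add: field_simps)
  show "(f has_field_derivative deriv f y) (at y within ball z (r / 2))"
    by (rule holomorphic_derivI[OF f(1) open_ball]) (use y r in simp)
next
  show "z \<in> ball z (r / 2)"
    using w zero_le_dist[of z w] unfolding mem_ball dist_self by linarith
qed (use w in simp_all)

lemma holomorphic_on_set_integral:
  fixes f :: "complex \<Rightarrow> 'a \<Rightarrow> complex"
  assumes U: "open U"
    and hol: "\<And>t. t \<in> A \<Longrightarrow> (\<lambda>z. f z t) holomorphic_on U"
    and meas: "\<And>z. z \<in> U \<Longrightarrow> set_borel_measurable M A (f z)"
    and dom: "\<And>z. z \<in> U \<Longrightarrow> \<exists>e>0. \<exists>g. set_integrable M A g \<and>
                (\<forall>w\<in>ball z e \<inter> U. \<forall>t\<in>A. norm (f w t) \<le> (g t :: real))"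
  shows "(\<lambda>z. LINT t:A|M. f z t) holomorphic_on U"
proof (subst holomorphic_on_open[OF U], intro ballI exI)
  fix z assume z: "z \<in> U"
  obtain e g where e: "e > 0" and g: "set_integrable M A g"
    and bound: "\<And>w t. w \<in> ball z e \<Longrightarrow> w \<in> U \<Longrightarrow> t \<in> A \<Longrightarrow> norm (f w t) \<le> g t"
    using dom[OF z] by auto
  obtain r' where r': "r' > 0" "ball z r' \<subseteq> U"
    using U z open_contains_ball by blast
  define r where "r = min r' e"
  have r: "r > 0" "ball z r \<subseteq> U" "ball z r \<subseteq> ball z e"
    using e r' by (auto simp: r_def)
  show "((\<lambda>z. LINT t:A|M. f z t) has_field_derivative (LINT t:A|M. deriv (\<lambda>z. f z t) z)) (at z)"
  proof (rule has_field_derivative_set_integral[where r = "r / 2" and L = "\<lambda>t. 2 * g t / r"])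
    fix w assume w: "w \<in> ball z (r / 2)"
    then have "w \<in> ball z r" using r(1) by simp
    then have wU: "w \<in> U" "w \<in> ball z e"
      using r by auto
    show "set_integrable M A (f w)"
    proof (rule set_integrable_bound[OF g meas[OF wU(1)]])
      show "AE t in M. t \<in> A \<longrightarrow> norm (f w t) \<le> norm (g t)"
        using bound wU by (intro AE_I2) force
    qed
    show "norm (f w t - f z t) \<le> 2 * g t / r * norm (w - z)" if "t \<in> A" for t
      by (rule norm_diff_le_holomorphic_bounded[OF holomorphic_on_subset[OF hol[OF that] r(2)] bound w])
        (use that r in auto)
  next
    show "((\<lambda>z. f z t) has_field_derivative deriv (\<lambda>z. f z t) z) (at z)" if "t \<in> A" for t
      by (rule holomorphic_derivI[OF hol[OF that] U z])
    show "set_integrable M A (\<lambda>t. 2 * g t / r)" using g by simp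
  qed (use r in simp)
qed

lemma set_integrable_mult_bounded_continuous:
  fixes W f :: "real \<Rightarrow> 'b::{euclidean_space, real_normed_field}"
  assumes "A \<in> sets borel" "set_integrable lborel A W" "continuous_on A f"
    and "\<And>t. t \<in> A \<Longrightarrow> norm (f t) \<le> C"
  shows "set_integrable lborel A (\<lambda>t. W t * f t)"
proof (rule set_integrable_bound)
  show "set_integrable lborel A (\<lambda>t. C * norm (W t))"
    using assms(2) by (intro set_integrable_mult_right set_integrable_norm)
  have [measurable]: "(\<lambda>t. indicator A t *\<^sub>R W t) \<in> borel_measurable lborel"
      "(\<lambda>t. indicator A t *\<^sub>R f t) \<in> borel_measurable lborel"
    using set_integrable_imp_set_borel_measurable[OF assms(2)] set_borel_measurable_continuous[OF assms(1,3)]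
    by (simp_all add: set_borel_measurable_def)
  have "(\<lambda>t. indicator A t *\<^sub>R (W t * f t)) = (\<lambda>t. (indicator A t *\<^sub>R W t) * (indicator A t *\<^sub>R f t))"
    by (auto simp: indicator_def)
  moreover have "\<dots> \<in> borel_measurable lborel" by measurable
  ultimately show "set_borel_measurable lborel A (\<lambda>t. W t * f t)"
    unfolding set_borel_measurable_def by (simp only:)
  show "AE t in lborel. t \<in> A \<longrightarrow> norm (W t * f t) \<le> norm (C * norm (W t))"
  proof (intro AE_I2 impI)
    fix t assume "t \<in> A"
    then have "norm (W t * f t) \<le> C * norm (W t)"
      using assms(4)[of t] by (subst mult.commute) (simp add: norm_mult mult_right_mono)
    then show "norm (W t * f t) \<le> norm (C * norm (W t))" by simp
  qed
qed

lemma norm_set_integral_mult_bounded_le: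
  fixes W f :: "'a \<Rightarrow> 'b::{euclidean_space, real_normed_field}"
  assumes "set_integrable M A W" and "\<And>t. t \<in> A \<Longrightarrow> norm (f t) \<le> C"
  shows "norm (LINT t:A|M. W t * f t) \<le> C * (LINT t:A|M. norm (W t))"
proof -
  have "norm (LINT t:A|M. W t * f t) \<le> (LINT t:A|M. C * norm (W t))"
  proof (rule set_integral_norm_bound_le)
    show "set_integrable M A (\<lambda>t. C * norm (W t))"
      using assms(1) by (intro set_integrable_mult_right set_integrable_norm)
    show "norm (W t * f t) \<le> C * norm (W t)" if "t \<in> A" for t
      using assms(2)[OF that] by (subst mult.commute) (simp add: norm_mult mult_right_mono)
  qed
  then show ?thesis by simp
qed

lemma holomorphic_on_set_integral_mult_bounded:
  fixes f :: "complex \<Rightarrow> real \<Rightarrow> complex"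
  assumes U: "open U" and A: "A \<in> sets borel" and W: "set_integrable lborel A W"
    and hol: "\<And>t. t \<in> A \<Longrightarrow> (\<lambda>z. f z t) holomorphic_on U"
    and cont: "\<And>z. z \<in> U \<Longrightarrow> continuous_on A (f z)"
    and bound: "\<And>z. z \<in> U \<Longrightarrow> \<exists>e>0. \<exists>C. \<forall>w\<in>ball z e \<inter> U. \<forall>t\<in>A. norm (f w t) \<le> C"
  shows "(\<lambda>z. LINT t:A|lborel. W t * f z t) holomorphic_on U"
proof (rule holomorphic_on_set_integral[OF U])
  show "(\<lambda>z. W t * f z t) holomorphic_on U" if "t \<in> A" for t
    by (intro holomorphic_intros hol that)
  fix z assume z: "z \<in> U"
  obtain e C where e: "e > 0" and C: "\<And>w t. w \<in> ball z e \<inter> U \<Longrightarrow> t \<in> A \<Longrightarrow> norm (f w t) \<le> C"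
    using bound[OF z] by blast
  have "norm (f z t) \<le> C" if "t \<in> A" for t
    using C[of z t] z e that by simp
  then show "set_borel_measurable lborel A (\<lambda>t. W t * f z t)"
    by (intro set_integrable_imp_set_borel_measurable set_integrable_mult_bounded_continuous[OF A W cont[OF z]])
  have "norm (W t * f w t) \<le> C * norm (W t)" if "w \<in> ball z e \<inter> U" "t \<in> A" for w t
    using C[OF that] by (subst mult.commute) (simp add: norm_mult mult_right_mono)
  moreover have "set_integrable lborel A (\<lambda>t. C * norm (W t))"
    using W by (intro set_integrable_mult_right set_integrable_norm)
  ultimately show "\<exists>e>0. \<exists>g. set_integrable lborel A g \<and> (\<forall>w\<in>ball z e \<inter> U. \<forall>t\<in>A. norm (W t * f w t) \<le> g t)"
    using e by blast
qed

section \<open>The Gamma and Beta integrals\<close>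

lemma holomorphic_eq_if_eq_on_real_interval:
  fixes f g :: "complex \<Rightarrow> complex"
  assumes hol: "f holomorphic_on S" "g holomorphic_on S" and S: "open S" "connected S" "z \<in> S"
    and ab: "a < b" "\<And>x. a < x \<Longrightarrow> x < b \<Longrightarrow> of_real x \<in> S"
    and eq: "\<And>x. a < x \<Longrightarrow> x < b \<Longrightarrow> f (of_real x) = g (of_real x)"
  shows "f z = g z"
proof -
  define m where "m = (a + b) / 2"
  have m: "m \<in> {a<..<b}"
    using ab(1) by (simp add: m_def)
  then have "m islimpt {a<..<b}"
    by (intro interior_limit_point) (simp add: interior_open)
  then have "complex_of_real m islimpt complex_of_real ` {a<..<b}"
    by (rule islimpt_isCont_image) (auto simp: eventually_at_filter)
  then have "f z - g z = 0"
    by (rule analytic_continuation[where S = S and f = "\<lambda>z. f z - g z", rotated 5])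
       (use hol S ab m eq in \<open>auto intro!: holomorphic_intros\<close>)
  then show ?thesis by simp
qed

lemma not_nonpos_Ints_Re: "Re z > 0 \<Longrightarrow> z \<notin> \<int>\<^sub>\<le>\<^sub>0"
  by (auto elim!: nonpos_Ints_cases)

lemma not_nonpos_Reals_Re: "Re z > 0 \<Longrightarrow> z \<notin> \<real>\<^sub>\<le>\<^sub>0"
  by (auto simp: complex_nonpos_Reals_iff)

lemma norm_of_real_powr: "t > 0 \<Longrightarrow> norm (complex_of_real t powr z) = t powr Re z"
  by (simp add: norm_powr_real_powr)

lemma continuous_on_powr_const:
  fixes f :: "'a::topological_space \<Rightarrow> complex"
  assumes "continuous_on A f" "\<And>x. x \<in> A \<Longrightarrow> f x \<notin> \<real>\<^sub>\<le>\<^sub>0"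
  shows "continuous_on A (\<lambda>x. f x powr c)"
  using assms unfolding continuous_on_def by (auto intro!: tendsto_powr_complex)

definition Gamma_weight :: "'a::ln \<Rightarrow> real \<Rightarrow> 'a" where
  "Gamma_weight z t = of_real t powr (z - 1) * of_real (exp (- t))"

definition Beta_weight :: "'a::ln \<Rightarrow> 'a \<Rightarrow> real \<Rightarrow> 'a" where
  "Beta_weight a b r = of_real r powr (a - 1) * of_real (1 - r) powr (b - 1)"

lemma Gamma_weight_real: "Gamma_weight x t = t powr (x - 1) * exp (- t)"
  by (simp add: Gamma_weight_def)

lemma Beta_weight_real: "Beta_weight a b r = r powr (a - 1) * (1 - r) powr (b - 1)"
  by (simp add: Beta_weight_def)

lemma Gamma_weight_of_real: "t > 0 \<Longrightarrow> Gamma_weight (complex_of_real x) t = of_real (Gamma_weight x t)"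
  using powr_of_real[of t "x - 1"] by (simp add: Gamma_weight_def)

lemma Beta_weight_of_real:
  "r \<in> {0<..<1} \<Longrightarrow> Beta_weight (complex_of_real a) (of_real b) r = of_real (Beta_weight a b r)"
  using powr_of_real[of r "a - 1"] powr_of_real[of "1 - r" "b - 1"] by (simp add: Beta_weight_def)

lemma norm_Gamma_weight: "t > 0 \<Longrightarrow> norm (Gamma_weight z t :: complex) = Gamma_weight (Re z) t"
  by (simp add: Gamma_weight_def norm_mult norm_of_real_powr flip: of_real_exp)

lemma norm_Beta_weight:
  assumes "r \<in> {0<..<1}"
  shows "norm (Beta_weight a b r :: complex) = Beta_weight (Re a) (Re b) r"
  using assms norm_of_real_powr[of r "a - 1"] norm_of_real_powr[of "1 - r" "b - 1"]
  by (simp add: Beta_weight_def norm_mult)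

lemma Gamma_weight_pos: "t > 0 \<Longrightarrow> Gamma_weight (x :: real) t > 0"
  by (simp add: Gamma_weight_real)

lemma Beta_weight_pos: "r \<in> {0<..<1} \<Longrightarrow> Beta_weight (a :: real) b r > 0"
  by (simp add: Beta_weight_real)

lemma Gamma_weight_plus1: "t > 0 \<Longrightarrow> Gamma_weight (z + 1 :: complex) t = of_real t * Gamma_weight z t"
  by (simp add: Gamma_weight_def powr_diff)

lemma Beta_weight_plus1:
  assumes "r \<in> {0<..<1}"
  shows "Beta_weight (a + 1) (b + 1) r = of_real (r * (1 - r)) * (Beta_weight a b r :: complex)"
proof -
  have shift: "x powr z = x * x powr (z - 1)" if "x \<noteq> 0" for x z :: complex
    using that by (simp add: powr_diff)
  have nonzero: "complex_of_real r \<noteq> 0" "complex_of_real (1 - r) \<noteq> 0"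
    using assms by auto
  show ?thesis
    unfolding Beta_weight_def add_diff_cancel_right' of_real_mult
    by (simp only: shift[OF nonzero(1), of a] shift[OF nonzero(2), of b] mult_ac)
qed

lemma continuous_on_Gamma_weight: "continuous_on {0<..} (Gamma_weight z :: real \<Rightarrow> complex)"
  unfolding Gamma_weight_def
  by (intro continuous_intros continuous_on_powr_const) (auto simp: complex_nonpos_Reals_iff)

lemma continuous_on_Beta_weight: "continuous_on {0<..<1} (Beta_weight a b :: real \<Rightarrow> complex)"
  unfolding Beta_weight_def
  by (intro continuous_intros continuous_on_powr_const) (auto simp: complex_nonpos_Reals_iff)

lemma
  assumes "Re z > 0"
  shows set_integrable_Gamma_weight: "set_integrable lborel {0<..} (Gamma_weight z)"
    and set_integral_Gamma_weight: "(LINT t:{0<..}|lborel. Gamma_weight z t) = Gamma z"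
proof -
  have weight: "Gamma_weight z = (\<lambda>t. of_real t powr (z - 1) / of_real (exp t))"
    by (simp add: fun_eq_iff Gamma_weight_def exp_minus field_simps)
  show int: "set_integrable lborel {0<..} (Gamma_weight z)"
    using absolutely_integrable_Gamma_integral'[OF assms] continuous_on_Gamma_weight[of z]
    by (subst set_integrable_lborel_iff_absolutely_integrable) (auto simp: weight)
  show "(LINT t:{0<..}|lborel. Gamma_weight z t) = Gamma z"
    using set_borel_integral_eq_integral(2)[OF int] Gamma_integral_complex'[OF assms]
    by (simp add: weight integral_unique)
qed

lemma
  assumes "x > (0 :: real)"
  shows set_integrable_Gamma_weight_real: "set_integrable lborel {0<..} (Gamma_weight x)"
    and set_integral_Gamma_weight_real: "(LINT t:{0<..}|lborel. Gamma_weight x t) = Gamma x"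
proof -
  have of_real: "Gamma_weight (complex_of_real x) t = of_real (Gamma_weight x t)" if "t \<in> {0<..}" for t
    using that by (simp add: Gamma_weight_of_real)
  have "set_integrable lborel {0<..} (\<lambda>t. complex_of_real (Gamma_weight x t))"
    by (rule set_integrable_eq_on[OF set_integrable_Gamma_weight of_real]) (use assms in auto)
  then show "set_integrable lborel {0<..} (Gamma_weight x)"
    by (simp only: set_integrable_of_real_iff)
  have "complex_of_real (LINT t:{0<..}|lborel. Gamma_weight x t) = (LINT t:{0<..}|lborel. Gamma_weight (of_real x) t)"
    unfolding set_integral_complex_of_real[symmetric] by (rule set_integral_cong) (simp only: of_real)
  also have "\<dots> = Gamma (of_real x)"
    by (rule set_integral_Gamma_weight) (use assms in simp)
  finally show "(LINT t:{0<..}|lborel. Gamma_weight x t) = Gamma x"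
    by (simp only: Gamma_complex_of_real of_real_eq_iff)
qed

lemma
  assumes "a > 0" "b > (0 :: real)"
  shows set_integrable_Beta_weight_real: "set_integrable lborel {0<..<1} (Beta_weight a b)"
    and set_integral_Beta_weight_real: "(LINT r:{0<..<1}|lborel. Beta_weight a b r) = Beta a b"
proof -
  show int: "set_integrable lborel {0<..<1} (Beta_weight a b)"
    unfolding Beta_weight_real[abs_def] by (rule set_integrable_subset[OF integrable_Beta[OF assms]]) auto
  have "(Beta_weight a b has_integral Beta a b) {0<..<1}"
    unfolding Beta_weight_real[abs_def]
    using has_integral_Beta_real[OF assms] by (simp add: has_integral_Icc_iff_Ioo)
  then show "(LINT r:{0<..<1}|lborel. Beta_weight a b r) = Beta a b"
    using set_borel_integral_eq_integral(2)[OF int] by (simp add: integral_unique)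
qed

lemma set_integrable_Beta_weight:
  assumes "Re a > 0" "Re b > 0"
  shows "set_integrable lborel {0<..<1} (Beta_weight a b)"
  by (rule set_integrable_bound_continuous[OF _ continuous_on_Beta_weight set_integrable_Beta_weight_real[OF assms]])
     (auto simp: norm_Beta_weight)

lemma holomorphic_on_Beta_integral:
  fixes f :: "real \<Rightarrow> complex"
  assumes U: "open U" and a: "a holomorphic_on U" and b: "b holomorphic_on U"
    and pos: "\<And>z. z \<in> U \<Longrightarrow> Re (a z) > 0" "\<And>z. z \<in> U \<Longrightarrow> Re (b z) > 0"
    and f: "continuous_on {0<..<1} f" "\<And>r. r \<in> {0<..<1} \<Longrightarrow> norm (f r) \<le> C"
  shows "(\<lambda>z. LINT r:{0<..<1}|lborel. Beta_weight (a z) (b z) r * f r) holomorphic_on U"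
proof (rule holomorphic_on_set_integral[OF U])
  show "(\<lambda>z. Beta_weight (a z) (b z) r * f r) holomorphic_on U" if "r \<in> {0<..<1}" for r
    unfolding Beta_weight_def using that by (intro holomorphic_intros a b) auto
  fix z assume z: "z \<in> U"
  show "set_borel_measurable lborel {0<..<1} (\<lambda>r. Beta_weight (a z) (b z) r * f r)"
    by (intro set_borel_measurable_continuous continuous_on_mult continuous_on_Beta_weight f) auto
  obtain \<alpha> \<beta> where \<alpha>\<beta>: "0 < \<alpha>" "\<alpha> < Re (a z)" "0 < \<beta>" "\<beta> < Re (b z)"
    using dense[OF pos(1)[OF z]] dense[OF pos(2)[OF z]] by blast
  have "isCont a z" "isCont b z"
    using a b U z holomorphic_on_imp_continuous_on continuous_on_eq_continuous_at by blast+
  then have "((\<lambda>w. Re (a w)) \<longlongrightarrow> Re (a z)) (nhds z)" "((\<lambda>w. Re (b w)) \<longlongrightarrow> Re (b z)) (nhds z)"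
    by (auto simp: isCont_def tendsto_at_iff_tendsto_nhds intro!: tendsto_Re)
  then have "\<forall>\<^sub>F w in nhds z. Re (a w) > \<alpha> \<and> Re (b w) > \<beta>"
    using \<alpha>\<beta> by (intro eventually_conj order_tendstoD(1))
  then obtain e where e: "e > 0" "\<And>w. w \<in> ball z e \<Longrightarrow> Re (a w) > \<alpha> \<and> Re (b w) > \<beta>"
    by (auto simp: eventually_nhds_metric dist_commute)
  have "norm (Beta_weight (a w) (b w) r * f r) \<le> C * Beta_weight \<alpha> \<beta> r"
    if "w \<in> ball z e" and r: "r \<in> {0<..<1}" for w r
  proof -
    have "norm (Beta_weight (a w) (b w) r) \<le> Beta_weight \<alpha> \<beta> r"
      unfolding norm_Beta_weight[OF r] Beta_weight_real
      using e(2)[OF that(1)] r by (intro mult_mono powr_mono') auto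
    then have "norm (Beta_weight (a w) (b w) r) * norm (f r) \<le> Beta_weight \<alpha> \<beta> r * C"
      using f(2)[OF r] by (rule mult_mono) (use Beta_weight_pos[OF r] in \<open>auto intro: less_imp_le\<close>)
    then show ?thesis by (simp add: norm_mult mult.commute)
  qed
  moreover have "set_integrable lborel {0<..<1} (\<lambda>r. C * Beta_weight \<alpha> \<beta> r)"
    by (intro set_integrable_mult_right set_integrable_Beta_weight_real \<alpha>\<beta>)
  ultimately show "\<exists>e>0. \<exists>g. set_integrable lborel {0<..<1} g \<and>
      (\<forall>w\<in>ball z e \<inter> U. \<forall>r\<in>{0<..<1}. norm (Beta_weight (a w) (b w) r * f r) \<le> g r)"
    using e(1) by blast
qed

lemma set_integral_Beta_weight:
  assumes "Re a > 0" "Re b > 0"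
  shows "(LINT r:{0<..<1}|lborel. Beta_weight a b r) = Beta a b"
proof -
  let ?I = "\<lambda>a b. LINT r:{0<..<1}|lborel. Beta_weight a b r * 1"
  let ?H = "{z. Re z > 0}"
  have H: "open ?H" "connected ?H"
    by (auto intro: open_halfspace_Re_gt convex_connected convex_halfspace_Re_gt)
  have hol: "(\<lambda>z. ?I (f z) (g z)) holomorphic_on ?H" "(\<lambda>z. Beta (f z) (g z)) holomorphic_on ?H"
    if "f holomorphic_on ?H" "g holomorphic_on ?H" "\<And>z. z \<in> ?H \<Longrightarrow> Re (f z) > 0" "\<And>z. z \<in> ?H \<Longrightarrow> Re (g z) > 0" for f g
    using that by (intro holomorphic_on_Beta_integral[where C = 1] holomorphic_intros not_nonpos_Ints_Re H; simp)+
  have reals: "?I (of_real x) (of_real y) = Beta (of_real x) (of_real y :: complex)" if "x > 0" "y > 0" for x y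
  proof -
    have "?I (of_real x) (of_real y :: complex) = (LINT r:{0<..<1}|lborel. complex_of_real (Beta_weight x y r))"
      by (rule set_integral_cong) (simp add: Beta_weight_of_real)
    also have "\<dots> = of_real (Beta x y)"
      using that by (simp only: set_integral_complex_of_real set_integral_Beta_weight_real)
    finally show ?thesis by (simp only: Beta_complex_of_real)
  qed
  have "?I (of_real x) b = Beta (of_real x) b" if "x > 0" for x
  proof (rule holomorphic_eq_if_eq_on_real_interval[of "\<lambda>z. ?I (of_real x) z" ?H "\<lambda>z. Beta (of_real x) z" b 0 1])
    show "(\<lambda>z. ?I (of_real x) z) holomorphic_on ?H" "(\<lambda>z. Beta (of_real x) z) holomorphic_on ?H"
      by (rule hol[of "\<lambda>_. of_real x" "\<lambda>z. z"]; simp add: that holomorphic_on_ident)+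
  qed (use assms that H reals in auto)
  moreover have "(\<lambda>z. ?I z b) holomorphic_on ?H" "(\<lambda>z. Beta z b) holomorphic_on ?H"
    by (rule hol[of "\<lambda>z. z" "\<lambda>_. b"]; simp add: assms holomorphic_on_ident)+
  ultimately have "?I a b = Beta a b"
    by (intro holomorphic_eq_if_eq_on_real_interval[of "\<lambda>z. ?I z b" ?H "\<lambda>z. Beta z b" a 0 1]) (use assms H in auto)
  then show ?thesis by simp
qed

lemma
  assumes x: "x > (0 :: real)" and c: "c > 0"
  shows set_integrable_Laplace_powr_real: "set_integrable lborel {0<..} (\<lambda>t. t powr (x - 1) * exp (- (c * t)))"
    and set_integral_Laplace_powr_real: "(LINT t:{0<..}|lborel. t powr (x - 1) * exp (- (c * t))) = Gamma x * c powr (- x)"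
proof -
  have scaled: "t powr (x - 1) * exp (- (c * t)) = c powr (1 - x) * Gamma_weight x (c * t)" if "t \<in> {0<..}" for t
    using that c by (simp add: Gamma_weight_real powr_mult powr_diff)
  have "set_integrable lborel {0<..} (\<lambda>t. c powr (1 - x) * Gamma_weight x (c * t))"
    using set_integral_scale_Ioi(1)[OF c, of "Gamma_weight x"] set_integrable_Gamma_weight_real[OF x] by simp
  then show "set_integrable lborel {0<..} (\<lambda>t. t powr (x - 1) * exp (- (c * t)))"
    by (rule set_integrable_eq_on) (simp only: scaled)
  have "(LINT t:{0<..}|lborel. t powr (x - 1) * exp (- (c * t))) =
      (LINT t:{0<..}|lborel. c powr (1 - x) * Gamma_weight x (c * t))"
    by (rule set_integral_cong) (rule scaled)
  also have "\<dots> = c powr (1 - x) * (1 / c * Gamma x)"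
    using set_integral_scale_Ioi(2)[OF c, of "Gamma_weight x"] set_integral_Gamma_weight_real[OF x] by simp
  finally show "(LINT t:{0<..}|lborel. t powr (x - 1) * exp (- (c * t))) = Gamma x * c powr (- x)"
    using c by (simp add: powr_diff powr_minus field_simps)
qed

lemma norm_powr_mult_exp:
  "t > 0 \<Longrightarrow> norm (complex_of_real t powr (z - 1) * exp (- (a * of_real t))) = t powr (Re z - 1) * exp (- (Re a * t))"
  by (simp add: norm_mult norm_of_real_powr)

lemma set_integrable_Laplace_powr:
  assumes "Re z > 0" "Re a > 0"
  shows "set_integrable lborel {0<..} (\<lambda>t. complex_of_real t powr (z - 1) * exp (- (a * of_real t)))"
proof (rule set_integrable_bound_continuous[OF _ _ set_integrable_Laplace_powr_real[OF assms]])
  show "continuous_on {0<..} (\<lambda>t. complex_of_real t powr (z - 1) * exp (- (a * of_real t)))"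
    by (intro continuous_intros continuous_on_powr_const) (auto simp: complex_nonpos_Reals_iff)
qed (auto simp: norm_powr_mult_exp)

lemma set_integral_Laplace_powr_holomorphic:
  assumes z: "Re z > 0"
  shows "(\<lambda>a. LINT t:{0<..}|lborel. complex_of_real t powr (z - 1) * exp (- (a * of_real t))) holomorphic_on {a. Re a > 0}"
    (is "(\<lambda>a. LINT t:{0<..}|lborel. ?f a t) holomorphic_on ?H")
proof (rule holomorphic_on_set_integral)
  fix a assume a: "a \<in> ?H"
  have "norm (?f w t) \<le> t powr (Re z - 1) * exp (- (Re a / 2 * t))"
    if "w \<in> ball a (Re a / 2)" "t \<in> {0<..}" for w t
  proof -
    have "Re w \<ge> Re a / 2"
      using that abs_Re_le_cmod[of "a - w"] by (simp add: dist_norm)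
    then show ?thesis
      using that by (auto simp: norm_powr_mult_exp intro!: mult_left_mono)
  qed
  then show "\<exists>e>0. \<exists>g. set_integrable lborel {0<..} g \<and> (\<forall>w\<in>ball a e \<inter> ?H. \<forall>t\<in>{0<..}. norm (?f w t) \<le> g t)"
    using a set_integrable_Laplace_powr_real[OF z, of "Re a / 2"]
    by (intro exI[of _ "Re a / 2"] exI[of _ "\<lambda>t. t powr (Re z - 1) * exp (- (Re a / 2 * t))"] conjI) auto
qed (auto intro!: holomorphic_intros open_halfspace_Re_gt set_integrable_imp_set_borel_measurable set_integrable_Laplace_powr z)

lemma set_integral_Laplace_powr:
  assumes z: "Re z > 0" and a: "Re a > 0"
  shows "(LINT t:{0<..}|lborel. complex_of_real t powr (z - 1) * exp (- (a * of_real t))) = Gamma z * a powr (- z)"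
proof (rule holomorphic_eq_if_eq_on_real_interval[where S = "{a. Re a > 0}" and a = 0 and b = 1 and z = a])
  show "(\<lambda>a. Gamma z * a powr (- z)) holomorphic_on {a. Re a > 0}"
    by (intro holomorphic_intros not_nonpos_Reals_Re) auto
  fix x :: real assume x: "0 < x"
  have "(LINT t:{0<..}|lborel. complex_of_real t powr (z - 1) * exp (- (of_real x * of_real t))) =
      (LINT t:{0<..}|lborel. of_real x powr (1 - z) * Gamma_weight z (x * t))"
  proof (rule set_integral_cong)
    fix t :: real assume "t \<in> {0<..}"
    then show "complex_of_real t powr (z - 1) * exp (- (of_real x * of_real t)) = of_real x powr (1 - z) * Gamma_weight z (x * t)"
      using x by (simp add: Gamma_weight_def powr_times_real powr_diff exp_of_real[symmetric])
  qed
  also have "\<dots> = of_real x powr (1 - z) * (1 / of_real x * Gamma z)"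
    using set_integral_scale_Ioi(2)[OF x, of "Gamma_weight z"] set_integral_Gamma_weight[OF z]
    by (simp add: scaleR_conv_of_real)
  finally show "(LINT t:{0<..}|lborel. complex_of_real t powr (z - 1) * exp (- (of_real x * of_real t))) =
      Gamma z * of_real x powr (- z)"
    using x by (simp add: powr_diff powr_minus field_simps)
qed (use set_integral_Laplace_powr_holomorphic[OF z] a in \<open>auto intro: open_halfspace_Re_gt convex_connected convex_halfspace_Re_gt\<close>)

lemma
  assumes "Re a > 0"
  shows set_integrable_exp_Ioi: "set_integrable lborel {0<..} (\<lambda>t. exp (- (a * of_real t)))"
    and set_integral_exp_Ioi: "(LINT t:{0<..}|lborel. exp (- (a * of_real t))) = 1 / a"
proof -
  have exp: "exp (- (a * of_real t)) = of_real t powr (1 - 1) * exp (- (a * of_real t))" if "t \<in> {0<..}" for t :: real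
    using that by simp
  show "set_integrable lborel {0<..} (\<lambda>t. exp (- (a * of_real t)))"
    using set_integrable_Laplace_powr[of 1, OF _ assms]
    by (rule set_integrable_cong[OF refl refl exp, THEN iffD2, rotated]) simp_all
  have "(LINT t:{0<..}|lborel. exp (- (a * of_real t))) = Gamma 1 * a powr (- 1)"
    using set_integral_Laplace_powr[of 1, OF _ assms] by (subst set_integral_cong[OF exp]) simp_all
  then show "(LINT t:{0<..}|lborel. exp (- (a * of_real t))) = 1 / a"
    using assms by (cases "a = 0") (simp_all add: powr_minus divide_inverse)
qed

lemma
  assumes "a > (0 :: real)"
  shows set_integrable_exp_Ioi_real: "set_integrable lborel {0<..} (\<lambda>t. exp (- (a * t)))"
    and set_integral_exp_Ioi_real: "(LINT t:{0<..}|lborel. exp (- (a * t))) = 1 / a"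
proof -
  have exp: "exp (- (complex_of_real a * of_real t)) = of_real (exp (- (a * t)))" for t
    by (simp flip: exp_of_real)
  show "set_integrable lborel {0<..} (\<lambda>t. exp (- (a * t)))"
    using set_integrable_exp_Ioi[of "of_real a"] assms by (simp only: exp set_integrable_of_real_iff Re_complex_of_real)
  have "complex_of_real (LINT t:{0<..}|lborel. exp (- (a * t))) = of_real (1 / a)"
    using set_integral_exp_Ioi[of "of_real a"] assms
    by (simp only: exp set_integral_complex_of_real Re_complex_of_real of_real_divide of_real_1)
  then show "(LINT t:{0<..}|lborel. exp (- (a * t))) = 1 / a"
    by (simp only: of_real_eq_iff)
qed

lemma set_integral_frac_substitution:
  fixes f :: "real \<Rightarrow> 'b::euclidean_space"
  assumes f: "continuous_on {0<..<1} f" "set_integrable lborel {0<..<1} f"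
  shows "set_integrable lborel {0<..} (\<lambda>s. (1 / (1 + s)\<^sup>2) *\<^sub>R f (s / (1 + s)))"
    and "(LINT s:{0<..}|lborel. (1 / (1 + s)\<^sup>2) *\<^sub>R f (s / (1 + s))) = (LINT r:{0<..<1}|lborel. f r)"
proof -
  have bij: "bij_betw (\<lambda>s :: real. s / (1 + s)) {0<..} {0<..<1}"
    by (rule bij_betw_byWitness[where f' = "\<lambda>v. v / (1 - v)"]) (auto simp: field_simps)
  have deriv: "((\<lambda>s. s / (1 + s)) has_field_derivative 1 / (1 + s)\<^sup>2) (at s)" if "s \<in> {0<..}" for s :: real
    by (rule derivative_eq_intros refl)+ (use that in \<open>auto simp: field_simps power2_eq_square\<close>)
  have "continuous_on {0<..} (\<lambda>s :: real. 1 / (1 + s)\<^sup>2)"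
    by (intro continuous_intros) auto
  from set_integral_substitution[OF bij deriv this f]
  show "set_integrable lborel {0<..} (\<lambda>s. (1 / (1 + s)\<^sup>2) *\<^sub>R f (s / (1 + s)))"
    and "(LINT s:{0<..}|lborel. (1 / (1 + s)\<^sup>2) *\<^sub>R f (s / (1 + s))) = (LINT r:{0<..<1}|lborel. f r)"
    by simp_all
qed

lemma Beta_weight_frac:
  assumes "s > 0"
  shows "Beta_weight a b (s / (1 + s)) = s powr (a - 1) * (1 + s) powr (2 - (a + b))"
proof -
  have "1 - s / (1 + s) = 1 / (1 + s)"
    using assms by (simp add: field_simps)
  then have "Beta_weight a b (s / (1 + s)) = s powr (a - 1) / ((1 + s) powr (a - 1) * (1 + s) powr (b - 1))"
    using assms by (simp add: Beta_weight_real powr_divide)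
  also have "(1 + s) powr (a - 1) * (1 + s) powr (b - 1) = (1 + s) powr (- (2 - (a + b)))"
    by (simp flip: powr_add)
  finally show ?thesis
    by (simp only: powr_minus divide_inverse inverse_inverse_eq)
qed

lemma continuous_on_Beta_weight_real: "continuous_on {0<..<1} (Beta_weight a b :: real \<Rightarrow> real)"
  unfolding Beta_weight_real[abs_def] by (intro continuous_intros) auto

lemma
  assumes ab: "a > 0" "b > (0 :: real)"
  shows set_integrable_Beta_Ioi: "set_integrable lborel {0<..} (\<lambda>s. s powr (a - 1) * (1 + s) powr (- (a + b)))"
    and set_integral_Beta_Ioi: "(LINT s:{0<..}|lborel. s powr (a - 1) * (1 + s) powr (- (a + b))) = Beta a b"
proof -
  note sub = set_integral_frac_substitution[OF continuous_on_Beta_weight_real set_integrable_Beta_weight_real[OF ab]]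
  have weight: "(1 / (1 + s)\<^sup>2) *\<^sub>R Beta_weight a b (s / (1 + s)) = s powr (a - 1) * (1 + s) powr (- (a + b))"
    if "s \<in> {0<..}" for s
  proof -
    have "(1 + s) powr (2 - (a + b)) = (1 + s)\<^sup>2 * (1 + s) powr (- (a + b))"
      unfolding diff_conv_add_uminus powr_add using that by (simp add: powr_numeral)
    then show ?thesis
      using that by (simp add: Beta_weight_frac)
  qed
  show "set_integrable lborel {0<..} (\<lambda>s. s powr (a - 1) * (1 + s) powr (- (a + b)))"
    by (rule set_integrable_eq_on[OF sub(1) weight])
  show "(LINT s:{0<..}|lborel. s powr (a - 1) * (1 + s) powr (- (a + b))) = Beta a b"
    using sub(2) set_integral_Beta_weight_real[OF ab] by (simp only: weight cong: set_integral_cong)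
qed

lemma Beta_half_eq_chi:
  assumes "p > 0"
  shows "Beta (1/2) (p / 2) = 2 * chi p / p"
proof -
  have "p / 2 \<notin> \<int>\<^sub>\<le>\<^sub>0"
    using assms by auto
  then have "chi p = p / 2 * (sqrt pi * Gamma (p / 2) / Gamma (p / 2 + 1/2))"
    unfolding chi_def by (subst Gamma_plus1) simp_all
  then show ?thesis
    using assms by (simp add: Beta_def Gamma_one_half_real add.commute)
qed

lemma
  assumes p: "p > 0"
  shows set_integrable_one_plus_square_powr: "set_integrable lborel {0<..} (\<lambda>y :: real. (1 + y\<^sup>2) powr (- ((p + 1) / 2)))"
    and set_integral_one_plus_square_powr: "(LINT y:{0<..}|lborel. (1 + y\<^sup>2) powr (- ((p + 1) / 2))) = chi p / p"
proof -
  let ?f = "\<lambda>s :: real. s powr (1/2 - 1) * (1 + s) powr (- (1/2 + p / 2))"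
  have bij: "bij_betw (\<lambda>y :: real. y\<^sup>2) {0<..} {0<..}"
    by (rule bij_betw_byWitness[where f' = sqrt]) auto
  have deriv: "((\<lambda>y. y\<^sup>2) has_field_derivative 2 * y) (at y)" for y :: real
    by (auto intro!: derivative_eq_intros)
  have "continuous_on {0<..} ?f" "continuous_on {0<..} (\<lambda>y :: real. 2 * y)"
    by (intro continuous_intros; auto)+
  note sub = set_integral_substitution[OF bij deriv this(2,1) set_integrable_Beta_Ioi]
  have integrand: "\<bar>2 * y\<bar> *\<^sub>R ?f (y\<^sup>2) = 2 * (1 + y\<^sup>2) powr (- ((p + 1) / 2))" if "y \<in> {0<..}" for y
  proof -
    have "(y\<^sup>2) powr (1/2 - 1) = inverse y"
      using that powr_minus[of "y\<^sup>2" "1/2"] by (simp add: powr_half_sqrt)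
    moreover have "- (1/2 + p / 2) = - ((p + 1) / 2)"
      by (simp add: field_simps)
    ultimately have "?f (y\<^sup>2) = inverse y * (1 + y\<^sup>2) powr (- ((p + 1) / 2))"
      by (simp only:)
    then show ?thesis
      using that by simp
  qed
  have "set_integrable lborel {0<..} (\<lambda>y :: real. 2 * (1 + y\<^sup>2) powr (- ((p + 1) / 2)))"
    by (rule set_integrable_eq_on[OF sub(1) integrand]) (use p in auto)
  then show "set_integrable lborel {0<..} (\<lambda>y :: real. (1 + y\<^sup>2) powr (- ((p + 1) / 2)))"
    by (subst (asm) set_integrable_mult_right_iff) auto
  have "(LINT y:{0<..}|lborel. 2 * (1 + y\<^sup>2) powr (- ((p + 1) / 2))) = (LINT y:{0<..}|lborel. \<bar>2 * y\<bar> *\<^sub>R ?f (y\<^sup>2))"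
    by (rule set_integral_cong) (simp only: integrand)
  also have "\<dots> = (LINT s:{0<..}|lborel. ?f s)"
    by (rule sub(2)) (use p in auto)
  also have "\<dots> = Beta (1/2) (p / 2)"
    by (rule set_integral_Beta_Ioi) (use p in auto)
  finally show "(LINT y:{0<..}|lborel. (1 + y\<^sup>2) powr (- ((p + 1) / 2))) = chi p / p"
    by (simp add: Beta_half_eq_chi[OF p])
qed

section \<open>The basic terminant\<close>

definition terminant :: "real \<Rightarrow> complex \<Rightarrow> complex" where
  "terminant p q = (LINT u:{0<..}|lborel. of_real (Gamma_weight p u) * inverse (1 + of_real u * q))"

lemma norm_one_plus_ge_1:
  assumes "Re q \<ge> 0" "u \<ge> 0"
  shows "norm (1 + of_real u * q) \<ge> 1"
proof -
  have "1 \<le> Re (1 + of_real u * q)" using assms by simp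
  also have "\<dots> \<le> norm (1 + of_real u * q)" by (rule complex_Re_le_cmod)
  finally show ?thesis .
qed

lemma norm_one_plus_ge_Im:
  assumes "Im q \<noteq> 0"
  shows "norm (1 + of_real u * q) \<ge> \<bar>Im q\<bar> / norm q"
proof -
  have "\<bar>Im q\<bar> = \<bar>Im ((1 + of_real u * q) * cnj q)\<bar>"
    by (simp add: algebra_simps)
  also have "\<dots> \<le> norm ((1 + of_real u * q) * cnj q)" by (rule abs_Im_le_cmod)
  finally have "\<bar>Im q\<bar> \<le> norm (1 + of_real u * q) * norm q" by (simp only: norm_mult complex_mod_cnj)
  then show ?thesis using assms by (auto simp: divide_le_eq)
qed

lemma one_plus_mult_notin_nonpos_Reals:
  fixes q :: complex
  assumes "q \<notin> \<real>\<^sub>\<le>\<^sub>0" "u \<ge> 0"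
  shows "1 + of_real u * q \<notin> \<real>\<^sub>\<le>\<^sub>0"
proof (cases "u = 0")
  case False
  then have "u > 0" using assms by simp
  then have "0 < Re q \<Longrightarrow> 0 < 1 + u * Re q" by (simp add: add_pos_pos)
  with \<open>u > 0\<close> assms show ?thesis
    by (auto simp: complex_nonpos_Reals_iff not_le)
qed simp

lemma one_plus_mult_nonzero:
  fixes q :: complex
  assumes "q \<notin> \<real>\<^sub>\<le>\<^sub>0" "u \<ge> 0"
  shows "1 + of_real u * q \<noteq> 0"
  using one_plus_mult_notin_nonpos_Reals[OF assms] by auto

lemma norm_one_plus_locally_bounded_below:
  fixes q :: complex
  assumes "q \<notin> \<real>\<^sub>\<le>\<^sub>0"
  obtains e d where "e > 0" "d > 0" "\<And>w u. w \<in> ball q e \<Longrightarrow> u \<ge> 0 \<Longrightarrow> norm (1 + of_real u * w) \<ge> d"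
proof (cases "Im q = 0")
  case True
  then have "Re q > 0" using assms by (auto simp: complex_nonpos_Reals_iff)
  moreover have "Re w \<ge> 0" if "w \<in> ball q (Re q)" for w
    using that abs_Re_le_cmod[of "q - w"] by (simp add: dist_norm)
  ultimately show ?thesis
    using that[of "Re q" 1] norm_one_plus_ge_1 by auto
next
  case False
  let ?e = "\<bar>Im q\<bar> / 2"
  have "norm (1 + of_real u * w) \<ge> ?e / (norm q + ?e)" if "w \<in> ball q ?e" for w u
  proof -
    have near: "norm (q - w) < ?e" using that by (simp add: dist_norm)
    have "\<bar>Im w\<bar> \<ge> ?e" using near abs_Im_le_cmod[of "q - w"] by simp
    moreover from this False have Im_w: "Im w \<noteq> 0" by auto
    moreover have "norm w \<le> norm q + ?e" using near norm_triangle_ineq3[of q w] by simp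
    ultimately have "?e / (norm q + ?e) \<le> \<bar>Im w\<bar> / norm w"
      by (intro frac_le) auto
    also have "\<dots> \<le> norm (1 + of_real u * w)" by (rule norm_one_plus_ge_Im[OF Im_w])
    finally show ?thesis .
  qed
  then show ?thesis using that[of ?e "?e / (norm q + ?e)"] False by (auto simp: add_nonneg_pos)
qed

lemma set_integrable_of_real_Gamma_weight:
  "p > 0 \<Longrightarrow> set_integrable lborel {0<..} (\<lambda>u. complex_of_real (Gamma_weight p u))"
  by (simp only: set_integrable_of_real_iff set_integrable_Gamma_weight_real)

lemma norm_terminant_le:
  assumes p: "p > 0" and d: "d > 0" "\<And>u. u > 0 \<Longrightarrow> norm (1 + of_real u * q) \<ge> d"
  shows "norm (terminant p q) \<le> Gamma p / d"
proof -
  have "norm (terminant p q) \<le> inverse d * (LINT u:{0<..}|lborel. norm (complex_of_real (Gamma_weight p u)))"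
    unfolding terminant_def
  proof (rule norm_set_integral_mult_bounded_le[OF set_integrable_of_real_Gamma_weight[OF p]])
    show "norm (inverse (1 + of_real u * q)) \<le> inverse d" if "u \<in> {0<..}" for u
      using that d by (intro norm_inverse_le_norm) auto
  qed
  also have "(LINT u:{0<..}|lborel. norm (complex_of_real (Gamma_weight p u))) = (LINT u:{0<..}|lborel. Gamma_weight p u)"
    by (rule set_integral_cong) (simp add: Gamma_weight_pos less_imp_le)
  finally show ?thesis
    by (simp add: set_integral_Gamma_weight_real[OF p] divide_inverse mult.commute)
qed

lemma norm_terminant_le_Re:
  assumes "p > 0" "Re q \<ge> 0"
  shows "norm (terminant p q) \<le> Gamma p"
  using norm_terminant_le[of p 1 q] norm_one_plus_ge_1[OF assms(2)] assms(1) by simp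

lemma norm_terminant_le_Im:
  assumes "p > 0" "Im q \<noteq> 0"
  shows "norm (terminant p q) \<le> Gamma p * (norm q / \<bar>Im q\<bar>)"
proof -
  have "q \<noteq> 0" using assms(2) by auto
  then have "\<bar>Im q\<bar> / norm q > 0" using assms(2) by simp
  from norm_terminant_le[OF assms(1) this] norm_one_plus_ge_Im[OF assms(2)] show ?thesis by simp
qed

lemma continuous_on_terminant_kernel:
  assumes "q \<notin> \<real>\<^sub>\<le>\<^sub>0"
  shows "continuous_on {0<..} (\<lambda>u. inverse (1 + complex_of_real u * q))"
  by (intro continuous_intros) (use one_plus_mult_nonzero[OF assms] in auto)

lemma terminant_holomorphic:
  assumes p: "p > 0"
  shows "terminant p holomorphic_on - \<real>\<^sub>\<le>\<^sub>0"
proof -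
  have "(\<lambda>q. LINT u:{0<..}|lborel. of_real (Gamma_weight p u) * inverse (1 + of_real u * q)) holomorphic_on - \<real>\<^sub>\<le>\<^sub>0"
  proof (rule holomorphic_on_set_integral_mult_bounded[OF _ _ set_integrable_of_real_Gamma_weight[OF p]])
    show "(\<lambda>q. inverse (1 + of_real u * q)) holomorphic_on - \<real>\<^sub>\<le>\<^sub>0" if "u \<in> {0<..}" for u :: real
      using that by (intro holomorphic_intros one_plus_mult_nonzero) auto
    fix q :: complex assume "q \<in> - \<real>\<^sub>\<le>\<^sub>0"
    then have q: "q \<notin> \<real>\<^sub>\<le>\<^sub>0" by simp
    then show "continuous_on {0<..} (\<lambda>u. inverse (1 + of_real u * q))"
      by (rule continuous_on_terminant_kernel)
    obtain e d where e: "e > 0" and d: "d > 0" "\<And>w u. w \<in> ball q e \<Longrightarrow> u \<ge> 0 \<Longrightarrow> norm (1 + of_real u * w) \<ge> d"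
      by (rule norm_one_plus_locally_bounded_below[OF q]) blast
    have "norm (inverse (1 + of_real u * w)) \<le> inverse d" if "w \<in> ball q e" "u \<in> {0<..}" for w u
      using that d by (intro norm_inverse_le_norm) auto
    then show "\<exists>e>0. \<exists>C. \<forall>w\<in>ball q e \<inter> - \<real>\<^sub>\<le>\<^sub>0. \<forall>u\<in>{0<..}. norm (inverse (1 + of_real u * w)) \<le> C"
      using e by blast
  qed auto
  then show ?thesis by (simp add: terminant_def[abs_def])
qed

lemma set_integrable_terminant:
  assumes p: "p > 0" and q: "q \<notin> \<real>\<^sub>\<le>\<^sub>0"
  shows "set_integrable lborel {0<..} (\<lambda>u. complex_of_real (Gamma_weight p u) * inverse (1 + of_real u * q))"
proof -
  obtain e d where e: "e > 0" and d: "d > 0" "\<And>w u. w \<in> ball q e \<Longrightarrow> u \<ge> 0 \<Longrightarrow> norm (1 + of_real u * w) \<ge> d"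
    by (rule norm_one_plus_locally_bounded_below[OF q]) blast
  show ?thesis
  proof (rule set_integrable_mult_bounded_continuous[OF _ set_integrable_of_real_Gamma_weight[OF p] continuous_on_terminant_kernel[OF q]])
    show "norm (inverse (1 + of_real u * q)) \<le> inverse d" if "u \<in> {0<..}" for u
      using that d e by (intro norm_inverse_le_norm) auto
  qed simp
qed

lemma terminant_plus1:
  assumes p: "p > 0" and q: "q \<notin> \<real>\<^sub>\<le>\<^sub>0"
  shows "terminant p q = of_real (Gamma p) - q * terminant (p + 1) q"
proof -
  let ?W = "\<lambda>p u. complex_of_real (Gamma_weight p u)"
  have "terminant p q = (LINT u:{0<..}|lborel. ?W p u - q * (?W (p + 1) u * inverse (1 + of_real u * q)))"
    unfolding terminant_def
  proof (rule set_integral_cong)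
    fix u :: real assume u: "u \<in> {0<..}"
    then have "?W (p + 1) u = of_real u * ?W p u"
      using Gamma_weight_plus1[of u "of_real p"] Gamma_weight_of_real[of u p] Gamma_weight_of_real[of u "p + 1"] by simp
    then show "?W p u * inverse (1 + of_real u * q) = ?W p u - q * (?W (p + 1) u * inverse (1 + of_real u * q))"
      using one_plus_mult_nonzero[OF q, of u] u by (simp add: field_simps)
  qed
  also have "\<dots> = (LINT u:{0<..}|lborel. ?W p u) - (LINT u:{0<..}|lborel. q * (?W (p + 1) u * inverse (1 + of_real u * q)))"
    using p by (intro set_integral_diff(2) set_integrable_of_real_Gamma_weight set_integrable_mult_right set_integrable_terminant q) auto
  also have "\<dots> = of_real (Gamma p) - q * terminant (p + 1) q"
    by (simp only: set_integral_mult_right terminant_def set_integral_complex_of_real set_integral_Gamma_weight_real[OF p])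
  finally show ?thesis .
qed

lemma terminant_cnj: "terminant p (cnj q) = cnj (terminant p q)"
  unfolding terminant_def set_lebesgue_integral_def
  by (subst Bochner_Integration.integral_cnj[symmetric]) simp

lemma set_integral_Gamma_weight_exp:
  assumes p: "p > 0" and w: "Re w \<ge> 0"
  shows "(LINT u:{0<..}|lborel. of_real (Gamma_weight p u) * exp (- (w * of_real u))) =
    of_real (Gamma p) * (1 + w) powr (- of_real p)"
proof -
  have "(LINT u:{0<..}|lborel. of_real (Gamma_weight p u) * exp (- (w * of_real u))) =
      (LINT u:{0<..}|lborel. complex_of_real u powr (of_real p - 1) * exp (- ((1 + w) * of_real u)))"
  proof (rule set_integral_cong)
    fix u :: real assume "u \<in> {0<..}"
    then have weight: "complex_of_real (Gamma_weight p u) = of_real u powr (of_real p - 1) * exp (- of_real u)"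
      by (simp add: Gamma_weight_of_real[symmetric]) (simp add: Gamma_weight_def flip: exp_of_real)
    show "of_real (Gamma_weight p u) * exp (- (w * of_real u)) =
        complex_of_real u powr (of_real p - 1) * exp (- ((1 + w) * of_real u))"
      unfolding weight by (simp add: mult.assoc exp_add[symmetric] algebra_simps)
  qed
  then show ?thesis
    using set_integral_Laplace_powr[of "of_real p" "1 + w"] p w by (simp add: Gamma_complex_of_real)
qed

lemma Re_Laplace_exponent:
  assumes "Re a > 0" "Re (a * q) \<ge> 0" "u > 0"
  shows "Re (a * (1 + of_real u * q)) \<ge> Re a" "Re (a * (1 + of_real u * q)) > 0"
proof -
  have "Re (a * (1 + of_real u * q)) = Re a + u * Re (a * q)"
    by (simp add: algebra_simps)
  then show "Re (a * (1 + of_real u * q)) \<ge> Re a"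
    using assms by simp
  then show "Re (a * (1 + of_real u * q)) > 0"
    using assms(1) by (rule less_le_trans[rotated])
qed

lemma Gamma_weight_exp_Fubini:
  assumes p: "p > 0" and a: "Re a > 0" and aq: "Re (a * q) \<ge> 0"
  defines "f \<equiv> \<lambda>u y. complex_of_real (Gamma_weight p u) * exp (- (a * (1 + of_real u * q) * of_real y))"
  shows "(LINT u:{0<..}|lborel. LINT y:{0<..}|lborel. f u y) = (LINT y:{0<..}|lborel. LINT u:{0<..}|lborel. f u y)"
proof (rule set_integral_Fubini)
  let ?\<rho> = "\<lambda>u. Re (a * (1 + of_real u * q))"
  have \<rho>_ge: "?\<rho> u \<ge> Re a" and \<rho>_pos: "?\<rho> u > 0" if "u \<in> {0<..}" for u
    using Re_Laplace_exponent[OF a aq] that by auto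
  have norm_f: "norm (f u y) = Gamma_weight p u * exp (- (?\<rho> u * y))" if "u \<in> {0<..}" for u y
    using that by (simp add: f_def norm_mult Gamma_weight_pos less_imp_le)
  show "continuous_on ({0<..} \<times> {0<..}) (\<lambda>(u, y). f u y)"
    unfolding f_def Gamma_weight_real case_prod_beta by (intro continuous_intros) auto
  show "set_integrable lborel {0<..} (f u)" if "u \<in> {0<..}" for u
    unfolding f_def by (intro set_integrable_mult_right set_integrable_exp_Ioi \<rho>_pos that)
  have inner: "(LINT y:{0<..}|lborel. norm (f u y)) = Gamma_weight p u * (1 / ?\<rho> u)" if "u \<in> {0<..}" for u
    unfolding norm_f[OF that] using set_integral_exp_Ioi_real[OF \<rho>_pos[OF that]] by (simp only: set_integral_mult_right)
  have outer: "set_integrable lborel {0<..} (\<lambda>u. Gamma_weight p u * (1 / ?\<rho> u))"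
  proof (rule set_integrable_mult_bounded_continuous[OF _ set_integrable_Gamma_weight_real[OF p]])
    show "continuous_on {0<..} (\<lambda>u. 1 / ?\<rho> u)"
      by (intro continuous_intros ballI) (use \<rho>_pos in force)
    show "norm (1 / ?\<rho> u) \<le> 1 / Re a" if "u \<in> {0<..}" for u
      using a \<rho>_ge[OF that] by (simp add: frac_le)
  qed simp
  show "set_integrable lborel {0<..} (\<lambda>u. LINT y:{0<..}|lborel. norm (f u y))"
    by (rule set_integrable_eq_on[OF outer]) (simp only: inner)
qed auto

text \<open>Writing the kernel as a Laplace integral along the ray through \<open>a\<close> and integrating over
  \<open>u\<close> first.\<close>

lemma terminant_eq_Laplace:
  assumes p: "p > 0" and a: "Re a > 0" and aq: "Re (a * q) \<ge> 0"
  shows "terminant p q = a * of_real (Gamma p) *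
    (LINT y:{0<..}|lborel. exp (- (a * of_real y)) * (1 + a * q * of_real y) powr (- of_real p))"
proof -
  let ?f = "\<lambda>u y. complex_of_real (Gamma_weight p u) * exp (- (a * (1 + of_real u * q) * of_real y))"
  have "terminant p q = (LINT u:{0<..}|lborel. a * (LINT y:{0<..}|lborel. ?f u y))"
    unfolding terminant_def
  proof (rule set_integral_cong)
    fix u :: real assume u: "u \<in> {0<..}"
    have "a \<noteq> 0" "u > 0" using a u by auto
    then show "of_real (Gamma_weight p u) * inverse (1 + of_real u * q) = a * (LINT y:{0<..}|lborel. ?f u y)"
      unfolding set_integral_mult_right set_integral_exp_Ioi[OF Re_Laplace_exponent(2)[OF a aq \<open>u > 0\<close>]] by (simp add: divide_inverse)
  qed
  moreover have "(LINT y:{0<..}|lborel. LINT u:{0<..}|lborel. ?f u y) =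
      (LINT y:{0<..}|lborel. of_real (Gamma p) * (exp (- (a * of_real y)) * (1 + a * q * of_real y) powr (- of_real p)))"
  proof (rule set_integral_cong)
    fix y :: real assume y: "y \<in> {0<..}"
    have "(LINT u:{0<..}|lborel. ?f u y) =
        (LINT u:{0<..}|lborel. exp (- (a * of_real y)) * (of_real (Gamma_weight p u) * exp (- (a * q * of_real y * of_real u))))"
      by (rule set_integral_cong) (simp add: exp_add[symmetric] algebra_simps)
    also have "\<dots> = exp (- (a * of_real y)) * (of_real (Gamma p) * (1 + a * q * of_real y) powr (- of_real p))"
      using p mult_nonneg_nonneg[OF aq, of y] y
      by (subst set_integral_mult_right, subst set_integral_Gamma_weight_exp) simp_all
    finally show "(LINT u:{0<..}|lborel. ?f u y) =
        of_real (Gamma p) * (exp (- (a * of_real y)) * (1 + a * q * of_real y) powr (- of_real p))"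
      by (simp only: mult.left_commute)
  qed
  ultimately show ?thesis
    using Gamma_weight_exp_Fubini[OF p a aq] by simp
qed

lemma chi_nonneg: "p > 0 \<Longrightarrow> chi p \<ge> 0"
  unfolding chi_def by (simp add: Gamma_real_pos less_imp_le)

text \<open>For \<open>a = - \<i> / q\<close> the Laplace integrand is bounded uniformly in \<open>q\<close>, even as \<open>q\<close> approaches the
  negative real axis.\<close>

lemma norm_terminant_plus1_le_chi:
  assumes p: "p > 0" and q: "Im q < 0"
  shows "norm (q * terminant (p + 1) q) \<le> Gamma p * chi p"
proof -
  define a where "a = - \<i> / q"
  let ?f = "\<lambda>y. exp (- (a * of_real y)) * (1 + a * q * of_real y) powr (- of_real (p + 1))"
  have "q \<noteq> 0" using q by auto
  then have aq: "a * q = - \<i>" by (simp add: a_def)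
  have a: "Re a > 0"
    using q by (simp add: a_def Re_divide divide_neg_pos sum_power2_gt_zero_iff)
  have "Gamma (p + 1) = p * Gamma p" "Gamma p > 0"
    using p by (auto intro!: Gamma_plus1)
  note Gamma_p = this
  have bound: "norm (LINT y:{0<..}|lborel. ?f y) \<le> (LINT y:{0<..}|lborel. (1 + y\<^sup>2) powr (- ((p + 1) / 2)))"
  proof (rule set_integral_norm_bound_le[OF set_integrable_one_plus_square_powr[OF p]])
    fix y :: real assume "y \<in> {0<..}"
    then have "norm (exp (- (a * of_real y))) \<le> 1"
      using a by simp
    moreover have "norm ((1 + a * q * of_real y) powr (- complex_of_real (p + 1))) = (1 + y\<^sup>2) powr (- ((p + 1) / 2))"
      unfolding aq by (subst norm_powr_real_powr') (auto simp: cmod_def powr_half_sqrt[symmetric] powr_powr minus_divide_left)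
    ultimately show "norm (?f y) \<le> (1 + y\<^sup>2) powr (- ((p + 1) / 2))"
      by (simp only: norm_mult) (simp add: mult_left_le_one_le)
  qed
  have "terminant (p + 1) q = a * of_real (Gamma (p + 1)) * (LINT y:{0<..}|lborel. ?f y)"
    by (rule terminant_eq_Laplace) (use p a aq in auto)
  then have "q * terminant (p + 1) q = (a * q) * of_real (Gamma (p + 1)) * (LINT y:{0<..}|lborel. ?f y)"
    by (simp only: mult_ac)
  then have "norm (q * terminant (p + 1) q) = Gamma (p + 1) * norm (LINT y:{0<..}|lborel. ?f y)"
    using Gamma_p p by (simp only: aq norm_mult norm_minus_cancel norm_ii norm_of_real) simp
  also have "\<dots> \<le> Gamma (p + 1) * (chi p / p)"
    using bound Gamma_p p unfolding set_integral_one_plus_square_powr[OF p] by (intro mult_left_mono) auto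
  finally show ?thesis
    using Gamma_p p by simp
qed

lemma norm_terminant_le_chi_lower_half_plane:
  assumes p: "p > 0" and q: "Im q < 0"
  shows "norm (terminant p q) \<le> Gamma p * (1 + chi p)"
proof -
  have "q \<notin> \<real>\<^sub>\<le>\<^sub>0" using q by (auto simp: complex_nonpos_Reals_iff)
  then have "norm (terminant p q) \<le> norm (complex_of_real (Gamma p)) + norm (q * terminant (p + 1) q)"
    unfolding terminant_plus1[OF p \<open>q \<notin> \<real>\<^sub>\<le>\<^sub>0\<close>] by (intro norm_triangle_ineq4)
  then show ?thesis
    using norm_terminant_plus1_le_chi[OF assms] Gamma_real_pos[OF p] by (simp add: algebra_simps)
qed

lemma norm_terminant_le_chi:
  assumes p: "p > 0" and q: "q \<notin> \<real>\<^sub>\<le>\<^sub>0"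
  shows "norm (terminant p q) \<le> Gamma p * (1 + chi p)"
proof -
  consider "Im q < 0" | "Im q > 0" | "Im q = 0" "Re q > 0"
    using q by (force simp: complex_nonpos_Reals_iff)
  then show ?thesis
  proof cases
    case 2
    then show ?thesis
      using norm_terminant_le_chi_lower_half_plane[OF p, of "cnj q"] by (simp add: terminant_cnj)
  next
    case 3
    then have "norm (terminant p q) \<le> Gamma p" using p by (intro norm_terminant_le_Re) simp_all
    also have "\<dots> \<le> Gamma p * (1 + chi p)"
      using chi_nonneg[OF p] p by (simp add: algebra_simps Gamma_real_pos less_imp_le)
    finally show ?thesis .
  qed (rule norm_terminant_le_chi_lower_half_plane[OF p])
qed

section \<open>The remainder function\<close>

lemma of_real_mult_notin_nonpos_Reals:
  assumes "y \<notin> \<real>\<^sub>\<le>\<^sub>0" "c > 0"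
  shows "complex_of_real c * y \<notin> \<real>\<^sub>\<le>\<^sub>0"
  using assms by (auto simp: complex_nonpos_Reals_iff mult_le_0_iff)

lemma divide_of_real_notin_nonpos_Reals:
  assumes "x \<notin> \<real>\<^sub>\<le>\<^sub>0" "t > 0"
  shows "x / complex_of_real t \<notin> \<real>\<^sub>\<le>\<^sub>0"
  using of_real_mult_notin_nonpos_Reals[OF assms(1), of "1 / t"] assms(2) by simp

definition terminant_beta :: "real \<Rightarrow> complex \<Rightarrow> complex \<Rightarrow> complex" where
  "terminant_beta p \<mu> y = (LINT r:{0<..<1}|lborel.
     Beta_weight (of_real p + \<mu>) (of_real p - \<mu>) r * terminant p (of_real (2 * r * (1 - r)) * y))"

definition legendre_terminant :: "real \<Rightarrow> complex \<Rightarrow> complex \<Rightarrow> complex \<Rightarrow> complex" where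
  "legendre_terminant p s \<mu> x = (LINT t:{0<..}|lborel. Gamma_weight s t * terminant_beta p \<mu> (x / of_real t))"

lemma norm_terminant_beta_le:
  assumes \<mu>: "\<bar>Re \<mu>\<bar> < p" and B: "\<And>c. c > 0 \<Longrightarrow> norm (terminant p (of_real c * y)) \<le> B"
  shows "norm (terminant_beta p \<mu> y) \<le> B * Beta (p + Re \<mu>) (p - Re \<mu>)"
proof -
  have "norm (terminant_beta p \<mu> y) \<le> B * (LINT r:{0<..<1}|lborel. norm (Beta_weight (of_real p + \<mu>) (of_real p - \<mu>) r))"
    unfolding terminant_beta_def
    using \<mu> by (intro norm_set_integral_mult_bounded_le set_integrable_Beta_weight B) auto
  also have "(LINT r:{0<..<1}|lborel. norm (Beta_weight (of_real p + \<mu>) (of_real p - \<mu>) r)) =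
      (LINT r:{0<..<1}|lborel. Beta_weight (p + Re \<mu>) (p - Re \<mu>) r)"
    by (rule set_integral_cong) (simp add: norm_Beta_weight)
  also have "\<dots> = Beta (p + Re \<mu>) (p - Re \<mu>)"
    using \<mu> by (intro set_integral_Beta_weight_real) auto
  finally show ?thesis .
qed

lemma norm_terminant_beta_ray_le:
  assumes \<mu>: "\<bar>Re \<mu>\<bar> < p" and B: "\<And>c. c > 0 \<Longrightarrow> norm (terminant p (of_real c * x)) \<le> B" and t: "t > 0"
  shows "norm (terminant_beta p \<mu> (x / of_real t)) \<le> B * Beta (p + Re \<mu>) (p - Re \<mu>)"
proof (rule norm_terminant_beta_le[OF \<mu>])
  fix c :: real assume "c > 0"
  then show "norm (terminant p (of_real c * (x / of_real t))) \<le> B"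
    using B[of "c / t"] t by simp
qed

lemma norm_terminant_ray_le_chi:
  assumes "p > 0" "y \<notin> \<real>\<^sub>\<le>\<^sub>0" "c > 0"
  shows "norm (terminant p (of_real c * y)) \<le> Gamma p * (1 + chi p)"
  by (intro norm_terminant_le_chi of_real_mult_notin_nonpos_Reals assms)

lemma continuous_on_terminant_beta_factor:
  assumes "p > 0" "y \<notin> \<real>\<^sub>\<le>\<^sub>0"
  shows "continuous_on {0<..<1} (\<lambda>r. terminant p (of_real (2 * r * (1 - r)) * y))"
  by (rule continuous_on_compose2[OF holomorphic_on_imp_continuous_on[OF terminant_holomorphic[OF assms(1)]]])
     (use of_real_mult_notin_nonpos_Reals[OF assms(2), of "2 * _ * (1 - _)"] in \<open>auto intro!: continuous_intros\<close>)

lemma set_integrable_terminant_beta: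
  assumes "\<bar>Re \<mu>\<bar> < p" "y \<notin> \<real>\<^sub>\<le>\<^sub>0"
  shows "set_integrable lborel {0<..<1}
    (\<lambda>r. Beta_weight (of_real p + \<mu>) (of_real p - \<mu>) r * terminant p (of_real (2 * r * (1 - r)) * y))"
  using assms by (intro set_integrable_mult_bounded_continuous[OF _ set_integrable_Beta_weight
      continuous_on_terminant_beta_factor norm_terminant_ray_le_chi]) auto

lemma terminant_beta_holomorphic:
  assumes "\<bar>Re \<mu>\<bar> < p"
  shows "terminant_beta p \<mu> holomorphic_on - \<real>\<^sub>\<le>\<^sub>0"
proof -
  have p: "p > 0" using assms by linarith
  have "(\<lambda>y. LINT r:{0<..<1}|lborel. Beta_weight (of_real p + \<mu>) (of_real p - \<mu>) r *
      terminant p (of_real (2 * r * (1 - r)) * y)) holomorphic_on - \<real>\<^sub>\<le>\<^sub>0"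
  proof (rule holomorphic_on_set_integral_mult_bounded)
    show "set_integrable lborel {0<..<1} (Beta_weight (of_real p + \<mu>) (of_real p - \<mu>))"
      using assms by (intro set_integrable_Beta_weight) auto
    show "(\<lambda>y. terminant p (of_real (2 * r * (1 - r)) * y)) holomorphic_on - \<real>\<^sub>\<le>\<^sub>0" if "r \<in> {0<..<1}" for r
      by (rule holomorphic_on_compose_gen[OF _ terminant_holomorphic[OF p], unfolded o_def])
         (use of_real_mult_notin_nonpos_Reals[of _ "2 * r * (1 - r)"] that in \<open>auto intro!: holomorphic_intros\<close>)
    show "\<exists>e>0. \<exists>C. \<forall>w\<in>ball y e \<inter> - \<real>\<^sub>\<le>\<^sub>0. \<forall>r\<in>{0<..<1}. norm (terminant p (of_real (2 * r * (1 - r)) * w)) \<le> C" for y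
      using p by (intro exI[of _ 1] exI[of _ "Gamma p * (1 + chi p)"] conjI ballI norm_terminant_ray_le_chi) auto
    show "continuous_on {0<..<1} (\<lambda>r. terminant p (of_real (2 * r * (1 - r)) * y))" if "y \<in> - \<real>\<^sub>\<le>\<^sub>0" for y
      using p that by (intro continuous_on_terminant_beta_factor) auto
  qed auto
  then show ?thesis by (simp add: terminant_beta_def[abs_def])
qed

lemma open_Re_strip: "open {\<mu>. \<bar>Re \<mu>\<bar> < b}"
  by (intro open_Collect_less continuous_intros)

lemma connected_Re_strip: "connected {\<mu>. \<bar>Re \<mu>\<bar> < b}"
proof -
  have "{\<mu>. \<bar>Re \<mu>\<bar> < b} = {\<mu>. Re \<mu> < b} \<inter> {\<mu>. Re \<mu> > - b}" by auto
  then show ?thesis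
    by (simp add: convex_connected convex_Int convex_halfspace_Re_lt convex_halfspace_Re_gt)
qed

lemma terminant_beta_holomorphic_order:
  assumes "p > 0" "y \<notin> \<real>\<^sub>\<le>\<^sub>0"
  shows "(\<lambda>\<mu>. terminant_beta p \<mu> y) holomorphic_on {\<mu>. \<bar>Re \<mu>\<bar> < p}"
  unfolding terminant_beta_def
proof (rule holomorphic_on_Beta_integral)
  show "continuous_on {0<..<1} (\<lambda>r. terminant p (of_real (2 * r * (1 - r)) * y))"
    by (rule continuous_on_terminant_beta_factor[OF assms])
  show "norm (terminant p (of_real (2 * r * (1 - r)) * y)) \<le> Gamma p * (1 + chi p)" if "r \<in> {0<..<1}" for r
    using that by (intro norm_terminant_ray_le_chi assms) simp
qed (auto intro!: holomorphic_intros open_Re_strip)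

lemma terminant_beta_plus1:
  assumes \<mu>: "\<bar>Re \<mu>\<bar> < p" and y: "y \<notin> \<real>\<^sub>\<le>\<^sub>0"
  shows "terminant_beta p \<mu> y =
    of_real (Gamma p) * Beta (of_real p + \<mu>) (of_real p - \<mu>) - 2 * y * terminant_beta (p + 1) \<mu> y"
proof -
  let ?W = "\<lambda>p. Beta_weight (of_real p + \<mu>) (of_real p - \<mu>)"
  let ?q = "\<lambda>r. of_real (2 * r * (1 - r)) * y"
  have p: "p > 0" using \<mu> by linarith
  have "terminant_beta p \<mu> y =
      (LINT r:{0<..<1}|lborel. of_real (Gamma p) * ?W p r - 2 * y * (?W (p + 1) r * terminant (p + 1) (?q r)))"
    unfolding terminant_beta_def
  proof (rule set_integral_cong)
    fix r :: real assume r: "r \<in> {0<..<1}"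
    define c where "c = complex_of_real (r * (1 - r))"
    have q: "?q r = 2 * c * y"
      by (simp add: c_def)
    have "?q r \<notin> \<real>\<^sub>\<le>\<^sub>0"
      using r by (intro of_real_mult_notin_nonpos_Reals y) auto
    then have terminant: "terminant p (2 * c * y) = of_real (Gamma p) - 2 * c * y * terminant (p + 1) (2 * c * y)"
      unfolding q by (rule terminant_plus1[OF p])
    have "of_real (p + 1) + \<mu> = of_real p + \<mu> + 1" "of_real (p + 1) - \<mu> = of_real p - \<mu> + 1"
      by simp_all
    then have weight: "?W (p + 1) r = c * ?W p r"
      by (simp only: c_def Beta_weight_plus1[OF r])
    show "?W p r * terminant p (?q r) =
        of_real (Gamma p) * ?W p r - 2 * y * (?W (p + 1) r * terminant (p + 1) (?q r))"
      unfolding q terminant weight by (simp add: algebra_simps)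
  qed
  also have "\<dots> = (LINT r:{0<..<1}|lborel. of_real (Gamma p) * ?W p r) -
      (LINT r:{0<..<1}|lborel. 2 * y * (?W (p + 1) r * terminant (p + 1) (?q r)))"
    using \<mu> y by (intro set_integral_diff(2) set_integrable_mult_right set_integrable_Beta_weight set_integrable_terminant_beta) auto
  also have "(LINT r:{0<..<1}|lborel. of_real (Gamma p) * ?W p r) = of_real (Gamma p) * Beta (of_real p + \<mu>) (of_real p - \<mu>)"
    using \<mu> by (subst set_integral_mult_right, subst set_integral_Beta_weight) auto
  finally show ?thesis
    by (simp only: set_integral_mult_right terminant_beta_def)
qed

lemma continuous_on_legendre_terminant_factor:
  assumes \<mu>: "\<bar>Re \<mu>\<bar> < p" and x: "x \<notin> \<real>\<^sub>\<le>\<^sub>0"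
  shows "continuous_on {0<..} (\<lambda>t. terminant_beta p \<mu> (x / of_real t))"
  by (rule continuous_on_compose2[OF holomorphic_on_imp_continuous_on[OF terminant_beta_holomorphic[OF \<mu>]]])
     (use divide_of_real_notin_nonpos_Reals[OF x] in \<open>auto intro!: continuous_intros\<close>)

lemma norm_legendre_terminant_factor_le:
  assumes "\<bar>Re \<mu>\<bar> < p" "x \<notin> \<real>\<^sub>\<le>\<^sub>0" "t > 0"
  shows "norm (terminant_beta p \<mu> (x / of_real t)) \<le> Gamma p * (1 + chi p) * Beta (p + Re \<mu>) (p - Re \<mu>)"
  using assms by (intro norm_terminant_beta_ray_le norm_terminant_ray_le_chi) auto

lemma set_integrable_legendre_terminant:
  assumes "\<bar>Re \<mu>\<bar> < p" "x \<notin> \<real>\<^sub>\<le>\<^sub>0" "Re s > 0"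
  shows "set_integrable lborel {0<..} (\<lambda>t. Gamma_weight s t * terminant_beta p \<mu> (x / of_real t))"
  using assms by (intro set_integrable_mult_bounded_continuous[OF _ set_integrable_Gamma_weight
      continuous_on_legendre_terminant_factor norm_legendre_terminant_factor_le]) auto

lemma norm_legendre_terminant_le:
  assumes \<mu>: "\<bar>Re \<mu>\<bar> < p" and s: "Re s > 0"
    and B: "\<And>c. c > 0 \<Longrightarrow> norm (terminant p (of_real c * x)) \<le> B"
  shows "norm (legendre_terminant p s \<mu> x) \<le> B * Beta (p + Re \<mu>) (p - Re \<mu>) * Gamma (Re s)"
proof -
  have "norm (legendre_terminant p s \<mu> x) \<le>
      B * Beta (p + Re \<mu>) (p - Re \<mu>) * (LINT t:{0<..}|lborel. norm (Gamma_weight s t))"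
    unfolding legendre_terminant_def
    by (intro norm_set_integral_mult_bounded_le set_integrable_Gamma_weight s norm_terminant_beta_ray_le[OF \<mu> B]) auto
  also have "(LINT t:{0<..}|lborel. norm (Gamma_weight s t)) = (LINT t:{0<..}|lborel. Gamma_weight (Re s) t)"
    by (rule set_integral_cong) (simp add: norm_Gamma_weight)
  finally show ?thesis
    by (simp only: set_integral_Gamma_weight_real[OF s])
qed

lemma legendre_terminant_holomorphic:
  assumes \<mu>: "\<bar>Re \<mu>\<bar> < p" and s: "Re s > 0"
  shows "legendre_terminant p s \<mu> holomorphic_on - \<real>\<^sub>\<le>\<^sub>0"
proof -
  have "(\<lambda>x. LINT t:{0<..}|lborel. Gamma_weight s t * terminant_beta p \<mu> (x / of_real t)) holomorphic_on - \<real>\<^sub>\<le>\<^sub>0"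
  proof (rule holomorphic_on_set_integral_mult_bounded[OF _ _ set_integrable_Gamma_weight[OF s]])
    show "(\<lambda>x. terminant_beta p \<mu> (x / of_real t)) holomorphic_on - \<real>\<^sub>\<le>\<^sub>0" if "t \<in> {0<..}" for t
      by (rule holomorphic_on_compose_gen[OF _ terminant_beta_holomorphic[OF \<mu>], unfolded o_def])
         (use divide_of_real_notin_nonpos_Reals[of _ t] that in \<open>auto intro!: holomorphic_intros\<close>)
    show "\<exists>e>0. \<exists>C. \<forall>w\<in>ball x e \<inter> - \<real>\<^sub>\<le>\<^sub>0. \<forall>t\<in>{0<..}. norm (terminant_beta p \<mu> (w / of_real t)) \<le> C" for x
      by (intro exI[of _ 1] exI[of _ "Gamma p * (1 + chi p) * Beta (p + Re \<mu>) (p - Re \<mu>)"] conjI ballI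
          norm_legendre_terminant_factor_le \<mu>) auto
  qed (auto intro!: continuous_on_legendre_terminant_factor \<mu>)
  then show ?thesis by (simp add: legendre_terminant_def[abs_def])
qed

lemma legendre_terminant_holomorphic_order:
  assumes p: "p > 0" and x: "x \<notin> \<real>\<^sub>\<le>\<^sub>0" and s: "Re s > 0"
  shows "(\<lambda>\<mu>. legendre_terminant p s \<mu> x) holomorphic_on {\<mu>. \<bar>Re \<mu>\<bar> < p}"
  unfolding legendre_terminant_def
proof (rule holomorphic_on_set_integral_mult_bounded[OF open_Re_strip _ set_integrable_Gamma_weight[OF s]])
  let ?U = "{\<mu>. \<bar>Re \<mu>\<bar> < p}"
  show "(\<lambda>\<mu>. terminant_beta p \<mu> (x / of_real t)) holomorphic_on ?U" if "t \<in> {0<..}" for t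
    by (rule terminant_beta_holomorphic_order) (use p that divide_of_real_notin_nonpos_Reals[OF x] in auto)
  fix \<mu> assume "\<mu> \<in> ?U"
  then have \<mu>: "\<bar>Re \<mu>\<bar> < p" by simp
  then show "continuous_on {0<..} (\<lambda>t. terminant_beta p \<mu> (x / of_real t))"
    by (rule continuous_on_legendre_terminant_factor[OF _ x])
  let ?b = "\<lambda>w. Gamma p * (1 + chi p) * Beta (p + Re w) (p - Re w)"
  have "isCont ?b \<mu>"
    unfolding Beta_def using \<mu> by (intro continuous_intros) (auto simp: Gamma_eq_zero_iff p)
  then have "(?b \<longlongrightarrow> ?b \<mu>) (nhds \<mu>)"
    using tendsto_at_iff_tendsto_nhds[of ?b \<mu>] by (simp only: isCont_def)
  then have "\<forall>\<^sub>F w in nhds \<mu>. ?b w < ?b \<mu> + 1"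
    by (rule order_tendstoD(2)) simp
  then obtain e where e: "e > 0" "\<And>w. w \<in> ball \<mu> e \<Longrightarrow> ?b w < ?b \<mu> + 1"
    by (auto simp: eventually_nhds_metric dist_commute)
  have "norm (terminant_beta p w (x / of_real t)) \<le> ?b \<mu> + 1" if "w \<in> ball \<mu> e \<inter> ?U" "t \<in> {0<..}" for w t
    using norm_legendre_terminant_factor_le[OF _ x, of w p t] e(2)[of w] that by auto
  then show "\<exists>e>0. \<exists>C. \<forall>w\<in>ball \<mu> e \<inter> ?U. \<forall>t\<in>{0<..}. norm (terminant_beta p w (x / of_real t)) \<le> C"
    using e(1) by blast
qed auto

lemma legendre_terminant_plus1:
  assumes \<mu>: "\<bar>Re \<mu>\<bar> < p" and x: "x \<notin> \<real>\<^sub>\<le>\<^sub>0" and s: "Re s > 0"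
  shows "legendre_terminant p (s + 1) \<mu> x =
    of_real (Gamma p) * Beta (of_real p + \<mu>) (of_real p - \<mu>) * Gamma (s + 1) - 2 * x * legendre_terminant (p + 1) s \<mu> x"
proof -
  let ?K = "of_real (Gamma p) * Beta (of_real p + \<mu>) (of_real p - \<mu>)"
  let ?f = "\<lambda>t. Gamma_weight s t * terminant_beta (p + 1) \<mu> (x / of_real t)"
  have "legendre_terminant p (s + 1) \<mu> x = (LINT t:{0<..}|lborel. ?K * Gamma_weight (s + 1) t - 2 * x * ?f t)"
    unfolding legendre_terminant_def
  proof (rule set_integral_cong)
    fix t :: real assume t: "t \<in> {0<..}"
    then have arg: "x / of_real t \<notin> \<real>\<^sub>\<le>\<^sub>0" and weight: "Gamma_weight (s + 1) t = of_real t * Gamma_weight s t"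
      using divide_of_real_notin_nonpos_Reals[OF x] by (auto simp: Gamma_weight_plus1)
    show "Gamma_weight (s + 1) t * terminant_beta p \<mu> (x / of_real t) = ?K * Gamma_weight (s + 1) t - 2 * x * ?f t"
      unfolding terminant_beta_plus1[OF \<mu> arg] weight using t by (simp add: field_simps)
  qed
  also have "\<dots> = (LINT t:{0<..}|lborel. ?K * Gamma_weight (s + 1) t) - (LINT t:{0<..}|lborel. 2 * x * ?f t)"
    using s \<mu> by (intro set_integral_diff(2) set_integrable_mult_right set_integrable_Gamma_weight set_integrable_legendre_terminant x) auto
  also have "(LINT t:{0<..}|lborel. ?K * Gamma_weight (s + 1) t) = ?K * Gamma (s + 1)"
    using s by (subst set_integral_mult_right, subst set_integral_Gamma_weight) auto
  finally show ?thesis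
    by (simp only: set_integral_mult_right legendre_terminant_def)
qed

lemma Gamma_of_nat_plus_half: "Gamma (real N + 1/2) = fact (2 * N) * sqrt pi / (4 ^ N * fact N)"
proof (induction N)
  case 0
  then show ?case by (simp add: Gamma_one_half_real)
next
  case (Suc N)
  have "real N + 1/2 \<notin> \<int>\<^sub>\<le>\<^sub>0" by (auto elim!: nonpos_Ints_cases)
  then have "Gamma (real (Suc N) + 1/2) = (real N + 1/2) * Gamma (real N + 1/2)"
    using Gamma_plus1[of "real N + 1/2"] by (simp add: add_ac)
  moreover have "(fact (2 * Suc N) :: real) = (2 * real N + 2) * (2 * real N + 1) * fact (2 * N)"
    by (simp add: algebra_simps)
  moreover have "(fact (Suc N) :: real) = (real N + 1) * fact N"
    by (simp add: algebra_simps)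
  ultimately show ?case
    unfolding Suc by (simp only:) (simp add: divide_simps, simp add: algebra_simps)
qed

lemma a_coeff_pochhammer:
  fixes \<mu> :: "'a :: field_char_0"
  shows "a_coeff N \<mu> = pochhammer (1/2 - \<mu>) N * pochhammer (1/2 + \<mu>) N / ((- 2) ^ N * fact N)"
proof -
  have "(\<Prod>k=1..N. 4 * \<mu>\<^sup>2 - (2 * of_nat k - 1)\<^sup>2) = (-4) ^ N * pochhammer (1/2 - \<mu>) N * pochhammer (1/2 + \<mu>) N"
  proof (induction N)
    case (Suc N)
    have factor: "4 * \<mu>\<^sup>2 - (2 * of_nat (Suc N) - 1)\<^sup>2 = (-4) * (1/2 - \<mu> + of_nat N) * (1/2 + \<mu> + of_nat N)"
      by (simp add: field_simps power2_eq_square)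
    have "(\<Prod>k=1..Suc N. 4 * \<mu>\<^sup>2 - (2 * of_nat k - 1)\<^sup>2) =
        (\<Prod>k=1..N. 4 * \<mu>\<^sup>2 - (2 * of_nat k - 1)\<^sup>2) * (4 * \<mu>\<^sup>2 - (2 * of_nat (Suc N) - 1)\<^sup>2)" by simp
    also have "\<dots> = (-4) ^ Suc N * pochhammer (1/2 - \<mu>) (Suc N) * pochhammer (1/2 + \<mu>) (Suc N)"
      unfolding Suc factor pochhammer_Suc power_Suc by (simp only: mult_ac)
    finally show ?case .
  qed simp
  moreover have "(8 :: 'a) ^ N = (-4) ^ N * (- 2) ^ N" by (simp add: power_mult_distrib[symmetric])
  ultimately show ?thesis unfolding a_coeff_def by simp
qed

lemma pochhammer_eq_rGamma_Gamma:
  fixes z :: complex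
  assumes "z + of_nat N \<notin> \<int>\<^sub>\<le>\<^sub>0"
  shows "pochhammer z N = rGamma z * Gamma (z + of_nat N)"
  using pochhammer_rGamma[of z N] assms by (simp add: Gamma_def rGamma_eq_zero_iff)

lemma rGamma_half_reflection:
  "rGamma (1/2 - \<mu>) * rGamma (1/2 + \<mu>) = cos (of_real pi * \<mu>) / (of_real pi :: complex)"
proof -
  have "rGamma (1/2 - \<mu>) * rGamma (1 - (1/2 - \<mu>)) = sin (of_real pi * (1/2 - \<mu>)) / of_real pi"
    by (rule rGamma_reflection_complex)
  moreover have "sin (of_real pi * (1/2 - \<mu>)) = cos (of_real pi * \<mu>)"
    by (simp add: cos_sin_eq algebra_simps)
  ultimately show ?thesis by (simp add: algebra_simps)
qed

lemma pi_powr_three_halves: "pi powr (3/2) = pi * sqrt pi"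
  using powr_add[of pi 1 "1/2"] by (simp add: powr_half_sqrt)

lemma a_coeff_eq_Beta:
  fixes \<mu> :: complex
  assumes "\<bar>Re \<mu>\<bar> < real N + 1/2"
  shows "a_coeff N \<mu> = (- 2) ^ N * (cos (of_real pi * \<mu>) / of_real (pi powr (3/2))) *
    (of_real (Gamma (real N + 1/2)) * Beta (of_real (real N + 1/2) + \<mu>) (of_real (real N + 1/2) - \<mu>))"
proof -
  let ?a = "of_real (real N + 1/2) + \<mu>" and ?b = "of_real (real N + 1/2) - \<mu>"
  have ab: "1/2 + \<mu> + of_nat N = ?a" "1/2 - \<mu> + of_nat N = ?b"
    by simp_all
  have "?a \<notin> \<int>\<^sub>\<le>\<^sub>0" "?b \<notin> \<int>\<^sub>\<le>\<^sub>0"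
    using assms by (auto intro!: not_nonpos_Ints_Re)
  then have "pochhammer (1/2 - \<mu>) N * pochhammer (1/2 + \<mu>) N =
      (rGamma (1/2 - \<mu>) * rGamma (1/2 + \<mu>)) * (Gamma ?a * Gamma ?b)"
    unfolding ab[symmetric] by (simp add: pochhammer_eq_rGamma_Gamma)
  also have "\<dots> = cos (of_real pi * \<mu>) / of_real pi * (fact (2 * N) * Beta ?a ?b)"
  proof -
    have "?a + ?b = of_nat (2 * N) + 1" by simp
    then have "Gamma (?a + ?b) = fact (2 * N)"
      using Gamma_fact[of "2 * N", where 'a = complex] by (simp add: add_ac)
    then have "Gamma ?a * Gamma ?b = fact (2 * N) * Beta ?a ?b"
      unfolding Beta_def by simp
    then show ?thesis by (simp only: rGamma_half_reflection)
  qed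
  finally have "a_coeff N \<mu> = cos (of_real pi * \<mu>) / of_real pi * (fact (2 * N) * Beta ?a ?b) / ((- 2) ^ N * fact N)"
    unfolding a_coeff_pochhammer by simp
  also have "fact (2 * N) = complex_of_real (Gamma (real N + 1/2) * 4 ^ N * fact N / sqrt pi)"
    unfolding Gamma_of_nat_plus_half by simp
  finally show ?thesis
    using power_mult_distrib[of "- 2" "- 2 :: complex" N] unfolding pi_powr_three_halves by (simp add: field_simps)
qed

lemma of_real_a_coeff: "complex_of_real (a_coeff N m) = a_coeff N (of_real m)"
  by (simp add: a_coeff_def)

lemma of_real_cos_pi: "cos (complex_of_real pi * of_real m) = of_real (cos (pi * m))"
  by (metis cos_of_real of_real_mult)

lemma a_coeff_eq_Beta_real:
  fixes m :: real
  assumes "\<bar>m\<bar> < real N + 1/2"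
  shows "a_coeff N m = (- 2) ^ N * (cos (pi * m) / pi powr (3/2)) *
    (Gamma (real N + 1/2) * Beta (real N + 1/2 + m) (real N + 1/2 - m))"
proof -
  have "complex_of_real (a_coeff N m) = of_real ((- 2) ^ N * (cos (pi * m) / pi powr (3/2)) *
      (Gamma (real N + 1/2) * Beta (real N + 1/2 + m) (real N + 1/2 - m)))"
    using a_coeff_eq_Beta[of "of_real m" N] assms
    unfolding of_real_a_coeff of_real_cos_pi of_real_add[symmetric] of_real_diff[symmetric] Beta_complex_of_real
    by simp
  then show ?thesis by (simp only: of_real_eq_iff)
qed

lemma cos_pi_eq_0_iff: "cos (pi * x) = 0 \<longleftrightarrow> (\<exists>k::int. odd k \<and> 2 * x = of_int k)"
proof -
  have "cos (pi * x) = 0 \<longleftrightarrow> (\<exists>k::int. odd k \<and> pi * x = of_int k * (pi / 2))"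
    unfolding cos_zero_iff_int by blast
  also have "\<dots> \<longleftrightarrow> (\<exists>k::int. odd k \<and> 2 * x = of_int k)"
    by (intro ex_cong conj_cong refl) (auto simp: field_simps)
  finally show ?thesis .
qed

lemma eventually_cos_pi_nonzero:
  assumes "cos (pi * m) = 0"
  shows "\<forall>\<^sub>F x in at m. cos (pi * x) \<noteq> 0"
proof -
  obtain k :: int where k: "odd k" "2 * m = of_int k"
    using assms unfolding cos_pi_eq_0_iff by blast
  have "cos (pi * x) \<noteq> 0" if x: "x \<noteq> m" "dist x m < 1" for x
  proof
    assume "cos (pi * x) = 0"
    then obtain l :: int where l: "odd l" "2 * x = of_int l"
      unfolding cos_pi_eq_0_iff by blast
    have "\<bar>of_int l - real_of_int k\<bar> < 2"
      using x(2) unfolding k(2)[symmetric] l(2)[symmetric] by (simp add: dist_real_def)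
    then have "\<bar>l - k\<bar> < 2" by linarith
    moreover have "even (l - k)" using k l by simp
    ultimately have "l = k" by presburger
    then show False using x(1) k(2) l(2) by simp
  qed
  then show ?thesis
    unfolding eventually_at by (intro exI[of _ 1]) auto
qed

lemma a_cos_ratio_eq_Beta:
  assumes "\<bar>m\<bar> < real N + 1/2"
  shows "a_cos_ratio N m = 2 ^ N / pi powr (3/2) * (Gamma (real N + 1/2) * Beta (real N + 1/2 + m) (real N + 1/2 - m))"
proof -
  let ?g = "\<lambda>x. 2 ^ N / pi powr (3/2) * (Gamma (real N + 1/2) * Beta (real N + 1/2 + x) (real N + 1/2 - x))"
  have ratio: "\<bar>a_coeff N x\<bar> / \<bar>cos (pi * x)\<bar> = ?g x" if "\<bar>x\<bar> < real N + 1/2" "cos (pi * x) \<noteq> 0" for x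
  proof -
    have "Gamma (real N + 1/2) > 0" "Beta (real N + 1/2 + x) (real N + 1/2 - x) > 0"
      using that(1) by (auto simp: Beta_def intro!: Gamma_real_pos)
    then show ?thesis
      unfolding a_coeff_eq_Beta_real[OF that(1)] using that(2) by (simp add: abs_mult power_abs)
  qed
  show ?thesis
  proof (cases "cos (pi * m) = 0")
    case False
    then show ?thesis using ratio[OF assms] unfolding a_cos_ratio_def cos_pi_eq_0_iff by auto
  next
    case True
    have "(?g \<longlongrightarrow> ?g m) (at m)"
      unfolding Beta_def by (intro tendsto_intros) (use assms in \<open>auto simp: Gamma_eq_zero_iff\<close>)
    moreover have "\<forall>\<^sub>F x in at m. ?g x = \<bar>a_coeff N x\<bar> / \<bar>cos (pi * x)\<bar>"
    proof -
      have "open {x. \<bar>x\<bar> < real N + 1/2}" by (intro open_Collect_less continuous_intros)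
      then have "\<forall>\<^sub>F x in at m. x \<in> {x. \<bar>x\<bar> < real N + 1/2}"
        using assms by (intro eventually_at_in_open') auto
      with eventually_cos_pi_nonzero[OF True] show ?thesis
        by eventually_elim (simp add: ratio)
    qed
    ultimately have "((\<lambda>x. \<bar>a_coeff N x\<bar> / \<bar>cos (pi * x)\<bar>) \<longlongrightarrow> ?g m) (at m)"
      by (rule Lim_transform_eventually)
    then have "Lim (at m) (\<lambda>x. \<bar>a_coeff N x\<bar> / \<bar>cos (pi * x)\<bar>) = ?g m"
      by (intro tendsto_Lim) auto
    then show ?thesis using True unfolding a_cos_ratio_def cos_pi_eq_0_iff by auto
  qed
qed

definition legendre_rem :: "nat \<Rightarrow> complex \<Rightarrow> complex \<Rightarrow> complex \<Rightarrow> complex" where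
  "legendre_rem N x \<mu> \<nu> = (- 2 * x) ^ N * (cos (of_real pi * \<mu>) / of_real (pi powr (3/2))) *
     legendre_terminant (real N + 1/2) (\<nu> - of_nat N + 1/2) \<mu> x"

lemma legendre_rem_holomorphic:
  assumes "\<bar>Re \<mu>\<bar> < real N + 1/2" "Re \<nu> > real N - 1/2"
  shows "(\<lambda>x. legendre_rem N x \<mu> \<nu>) holomorphic_on - \<real>\<^sub>\<le>\<^sub>0"
  unfolding legendre_rem_def using assms by (intro holomorphic_intros legendre_terminant_holomorphic) auto

lemma legendre_rem_holomorphic_order:
  assumes "x \<notin> \<real>\<^sub>\<le>\<^sub>0" "Re \<nu> > real N - 1/2"
  shows "(\<lambda>\<mu>. legendre_rem N x \<mu> \<nu>) holomorphic_on {\<mu>. \<bar>Re \<mu>\<bar> < real N + 1/2}"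
  unfolding legendre_rem_def using assms by (intro holomorphic_intros legendre_terminant_holomorphic_order) auto

lemma legendre_rem_Suc:
  assumes \<mu>: "\<bar>Re \<mu>\<bar> < real N + 1/2" and x: "x \<notin> \<real>\<^sub>\<le>\<^sub>0" and \<nu>: "Re \<nu> > real (Suc N) - 1/2"
  shows "legendre_rem N x \<mu> \<nu> = a_coeff N \<mu> * Gamma (\<nu> - of_nat N + 1/2) * x ^ N + legendre_rem (Suc N) x \<mu> \<nu>"
proof -
  have "Re (\<nu> - of_nat (Suc N) + 1/2) > 0" using \<nu> by simp
  note recurrence = legendre_terminant_plus1[OF \<mu> x this]
  have shift: "real (Suc N) + 1/2 = real N + 1/2 + 1" "\<nu> - of_nat N + 1/2 = \<nu> - of_nat (Suc N) + 1/2 + 1"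
    by simp_all
  have "(A * X) * c * (K * G - 2 * x * T) = A * c * K * G * X + ((- 2 * x) * (A * X)) * c * T" for A X c K G T
    by (simp add: algebra_simps)
  then show ?thesis
    unfolding legendre_rem_def a_coeff_eq_Beta[OF \<mu>] shift recurrence power_Suc power_mult_distrib by blast
qed

definition legendre_sum :: "nat \<Rightarrow> complex \<Rightarrow> complex \<Rightarrow> complex \<Rightarrow> complex" where
  "legendre_sum N x \<mu> \<nu> = (\<Sum>n<N. a_coeff n \<mu> * Gamma (\<nu> - of_nat n + 1/2) * x ^ n) + legendre_rem N x \<mu> \<nu>"

lemma legendre_sum_holomorphic:
  assumes "\<bar>Re \<mu>\<bar> < real N + 1/2" "Re \<nu> > real N - 1/2"
  shows "(\<lambda>x. legendre_sum N x \<mu> \<nu>) holomorphic_on - \<real>\<^sub>\<le>\<^sub>0"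
  unfolding legendre_sum_def using assms by (intro holomorphic_intros legendre_rem_holomorphic)

lemma legendre_sum_holomorphic_order:
  assumes "x \<notin> \<real>\<^sub>\<le>\<^sub>0" "Re \<nu> > real N - 1/2"
  shows "(\<lambda>\<mu>. legendre_sum N x \<mu> \<nu>) holomorphic_on {\<mu>. \<bar>Re \<mu>\<bar> < real N + 1/2}"
  unfolding legendre_sum_def a_coeff_def using assms by (intro holomorphic_intros legendre_rem_holomorphic_order) auto

lemma legendre_sum_eq_of_le:
  assumes "N \<le> M" and \<mu>: "\<bar>Re \<mu>\<bar> < real N + 1/2" and x: "x \<notin> \<real>\<^sub>\<le>\<^sub>0" and \<nu>: "Re \<nu> > real M - 1/2"
  shows "legendre_sum N x \<mu> \<nu> = legendre_sum M x \<mu> \<nu>"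
  using assms(1) \<nu>
proof (induction M rule: dec_induct)
  case (step M)
  have "legendre_sum N x \<mu> \<nu> = legendre_sum M x \<mu> \<nu>"
    using step by simp
  also have "\<dots> = legendre_sum (Suc M) x \<mu> \<nu>"
    using legendre_rem_Suc[of \<mu> M x \<nu>] step \<mu> x by (simp add: legendre_sum_def)
  finally show ?case .
qed simp

lemma legendre_sum_eq:
  assumes "\<bar>Re \<mu>\<bar> < real N + 1/2" "\<bar>Re \<mu>\<bar> < real M + 1/2" "Re \<nu> > real N - 1/2" "Re \<nu> > real M - 1/2"
    and "x \<notin> \<real>\<^sub>\<le>\<^sub>0"
  shows "legendre_sum N x \<mu> \<nu> = legendre_sum M x \<mu> \<nu>"
proof (cases N M rule: le_cases)
  case le
  then show ?thesis by (rule legendre_sum_eq_of_le) (use assms in auto)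
next
  case ge
  then show ?thesis by (rule legendre_sum_eq_of_le[symmetric]) (use assms in auto)
qed

lemma norm_legendre_rem_le:
  assumes \<mu>: "\<bar>Re \<mu>\<bar> < real N + 1/2" and \<nu>: "Re \<nu> > real N - 1/2"
    and B: "\<And>c. c > 0 \<Longrightarrow> norm (terminant (real N + 1/2) (of_real c * x)) \<le> Gamma (real N + 1/2) * B"
  shows "norm (legendre_rem N x \<mu> \<nu>) \<le> norm (cos (of_real pi * \<mu>)) * a_cos_ratio N (Re \<mu>) *
           Gamma (Re \<nu> - real N + 1/2) * norm x ^ N * B"
proof -
  have s: "Re (\<nu> - of_nat N + 1/2) > 0" using \<nu> by simp
  have "norm (legendre_rem N x \<mu> \<nu>) = (2 * norm x) ^ N * (norm (cos (of_real pi * \<mu>)) / pi powr (3/2)) *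
      norm (legendre_terminant (real N + 1/2) (\<nu> - of_nat N + 1/2) \<mu> x)"
    by (simp add: legendre_rem_def norm_mult norm_divide norm_power)
  also have "\<dots> \<le> (2 * norm x) ^ N * (norm (cos (of_real pi * \<mu>)) / pi powr (3/2)) *
      (Gamma (real N + 1/2) * B * Beta (real N + 1/2 + Re \<mu>) (real N + 1/2 - Re \<mu>) * Gamma (Re (\<nu> - of_nat N + 1/2)))"
    by (intro mult_left_mono norm_legendre_terminant_le \<mu> s B) auto
  also have "\<dots> = norm (cos (of_real pi * \<mu>)) * a_cos_ratio N (Re \<mu>) * Gamma (Re \<nu> - real N + 1/2) * norm x ^ N * B"
    unfolding a_cos_ratio_eq_Beta[OF \<mu>] by (simp add: power_mult_distrib mult_ac)
  finally show ?thesis .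
qed

section \<open>Euler's integral for the remainder\<close>

definition euler_weight :: "real \<Rightarrow> complex \<Rightarrow> real \<Rightarrow> complex" where
  "euler_weight m \<nu> s = of_real (s powr (- m - 1/2)) * of_real (1 + s) powr (of_real m - \<nu> - 1)"

definition euler_integral :: "real \<Rightarrow> complex \<Rightarrow> complex \<Rightarrow> complex" where
  "euler_integral m \<nu> y = (LINT s:{0<..}|lborel. euler_weight m \<nu> s * (1 + of_real s * y) powr of_real (- m - 1/2))"

lemma continuous_on_euler_weight: "continuous_on {0<..} (euler_weight m \<nu>)"
  unfolding euler_weight_def
  by (intro continuous_intros continuous_on_powr_const) (auto simp: complex_nonpos_Reals_iff)

lemma norm_euler_weight:
  "s > 0 \<Longrightarrow> norm (euler_weight m \<nu> s) = s powr ((1/2 - m) - 1) * (1 + s) powr (- ((1/2 - m) + (Re \<nu> + 1/2)))"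
  using norm_of_real_powr[of "1 + s" "of_real m - \<nu> - 1"] by (simp add: euler_weight_def norm_mult algebra_simps)

lemma set_integrable_euler_weight:
  assumes "\<bar>m\<bar> < 1/2" "Re \<nu> > - 1/2"
  shows "set_integrable lborel {0<..} (euler_weight m \<nu>)"
proof (rule set_integrable_bound_continuous[OF _ continuous_on_euler_weight])
  show "set_integrable lborel {0<..} (\<lambda>s. s powr ((1/2 - m) - 1) * (1 + s) powr (- ((1/2 - m) + (Re \<nu> + 1/2))))"
    by (rule set_integrable_Beta_Ioi) (use assms in auto)
qed (simp_all only: norm_euler_weight greaterThan_iff order_refl, simp)

lemma continuous_on_euler_kernel:
  fixes y :: complex
  assumes "y \<notin> \<real>\<^sub>\<le>\<^sub>0"
  shows "continuous_on {0<..} (\<lambda>s. (1 + of_real s * y) powr of_real (- m - 1/2))"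
  using one_plus_mult_notin_nonpos_Reals[OF assms] by (intro continuous_on_powr_const continuous_intros) auto

lemma norm_euler_kernel_locally_bounded:
  fixes y :: complex
  assumes "\<bar>m\<bar> < 1/2" "y \<notin> \<real>\<^sub>\<le>\<^sub>0"
  obtains e C where "e > 0"
    "\<And>w s. w \<in> ball y e \<Longrightarrow> s > 0 \<Longrightarrow> norm ((1 + of_real s * w) powr of_real (- m - 1/2)) \<le> C"
proof -
  obtain e d where e: "e > 0" and d: "d > 0" "\<And>w s. w \<in> ball y e \<Longrightarrow> s \<ge> 0 \<Longrightarrow> norm (1 + of_real s * w) \<ge> d"
    by (rule norm_one_plus_locally_bounded_below[OF assms(2)]) blast
  have "norm ((1 + of_real s * w) powr of_real (- m - 1/2)) \<le> d powr (- m - 1/2)"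
    if "w \<in> ball y e" "s > 0" for w s
  proof -
    have "norm ((1 + of_real s * w) powr of_real (- m - 1/2)) = norm (1 + of_real s * w) powr (- m - 1/2)"
      by (subst norm_powr_real_powr') auto
    also have "\<dots> \<le> d powr (- m - 1/2)"
      using d(2)[OF that(1), of s] d(1) that assms(1) by (intro powr_mono2') auto
    finally show ?thesis .
  qed
  with e show ?thesis using that by blast
qed

lemma set_integrable_euler:
  assumes m: "\<bar>m\<bar> < 1/2" and \<nu>: "Re \<nu> > - 1/2" and y: "y \<notin> \<real>\<^sub>\<le>\<^sub>0"
  shows "set_integrable lborel {0<..} (\<lambda>s. euler_weight m \<nu> s * (1 + of_real s * y) powr of_real (- m - 1/2))"
proof -
  obtain e C where e: "e > 0" and C: "\<And>w s. w \<in> ball y e \<Longrightarrow> s > 0 \<Longrightarrow> norm ((1 + of_real s * w) powr of_real (- m - 1/2)) \<le> C"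
    by (rule norm_euler_kernel_locally_bounded[OF m y]) blast
  show ?thesis
  proof (rule set_integrable_mult_bounded_continuous[OF _ set_integrable_euler_weight[OF m \<nu>] continuous_on_euler_kernel[OF y]])
    show "norm ((1 + of_real s * y) powr of_real (- m - 1/2)) \<le> C" if "s \<in> {0<..}" for s
      using that e by (intro C) auto
  qed simp
qed

lemma euler_integral_holomorphic:
  assumes m: "\<bar>m\<bar> < 1/2" and \<nu>: "Re \<nu> > - 1/2"
  shows "euler_integral m \<nu> holomorphic_on - \<real>\<^sub>\<le>\<^sub>0"
proof -
  have "(\<lambda>y. LINT s:{0<..}|lborel. euler_weight m \<nu> s * (1 + of_real s * y) powr of_real (- m - 1/2)) holomorphic_on - \<real>\<^sub>\<le>\<^sub>0"
  proof (rule holomorphic_on_set_integral_mult_bounded[OF _ _ set_integrable_euler_weight[OF m \<nu>]])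
    show "(\<lambda>y. (1 + of_real s * y) powr of_real (- m - 1/2)) holomorphic_on - \<real>\<^sub>\<le>\<^sub>0" if "s \<in> {0<..}" for s :: real
      using that by (intro holomorphic_intros one_plus_mult_notin_nonpos_Reals) auto
    fix y :: complex assume "y \<in> - \<real>\<^sub>\<le>\<^sub>0"
    then have y: "y \<notin> \<real>\<^sub>\<le>\<^sub>0" by simp
    then show "continuous_on {0<..} (\<lambda>s. (1 + of_real s * y) powr of_real (- m - 1/2))"
      by (rule continuous_on_euler_kernel)
    show "\<exists>e>0. \<exists>C. \<forall>w\<in>ball y e \<inter> - \<real>\<^sub>\<le>\<^sub>0. \<forall>s\<in>{0<..}. norm ((1 + of_real s * w) powr of_real (- m - 1/2)) \<le> C"
      by (rule norm_euler_kernel_locally_bounded[OF m y]) blast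
  qed auto
  then show ?thesis by (simp add: euler_integral_def[abs_def])
qed

definition gauss_laplace :: "real \<Rightarrow> real" where
  "gauss_laplace q = (LINT h:{0<..}|lborel. exp (- h - q / 4 * h\<^sup>2))"

lemma set_integrable_gauss:
  fixes a q :: real
  assumes "q \<ge> 0" "a > 0"
  shows "set_integrable lborel {0<..} (\<lambda>h. exp (- (a * h) - q * h\<^sup>2))"
proof (rule set_integrable_bound_continuous[OF _ _ set_integrable_exp_Ioi_real[OF assms(2)]])
  show "continuous_on {0<..} (\<lambda>h. exp (- (a * h) - q * h\<^sup>2))" by (intro continuous_intros)
qed (use assms in auto)

text \<open>The substitution \<open>s = h + q h\<^sup>2 / 4\<close> turns \<open>1 + s q\<close> into the square \<open>(1 + q h / 2)\<^sup>2\<close>.\<close>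

lemma bij_betw_quadratic_Ioi:
  fixes q :: real
  assumes q: "q > 0"
  shows "bij_betw (\<lambda>h. h + q / 4 * h\<^sup>2) {0<..} {0<..}"
proof (rule bij_betw_byWitness[where f' = "\<lambda>s. 2 * (sqrt (1 + s * q) - 1) / q"])
  have square: "1 + (h + q / 4 * h\<^sup>2) * q = (1 + q / 2 * h)\<^sup>2" for h
    by (simp add: power2_eq_square algebra_simps)
  show "\<forall>h\<in>{0<..}. 2 * (sqrt (1 + (h + q / 4 * h\<^sup>2) * q) - 1) / q = h"
    unfolding square using q by simp
  show "\<forall>s\<in>{0<..}. 2 * (sqrt (1 + s * q) - 1) / q + q / 4 * (2 * (sqrt (1 + s * q) - 1) / q)\<^sup>2 = s"
  proof
    fix s :: real assume "s \<in> {0<..}"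
    define r where "r = sqrt (1 + s * q)"
    have "r\<^sup>2 = 1 + s * q"
      using q \<open>s \<in> {0<..}\<close> by (simp add: r_def)
    moreover have "2 * (r - 1) / q + q / 4 * (2 * (r - 1) / q)\<^sup>2 = (r\<^sup>2 - 1) / q"
      using q by (simp add: power2_eq_square field_simps)
    ultimately show "2 * (sqrt (1 + s * q) - 1) / q + q / 4 * (2 * (sqrt (1 + s * q) - 1) / q)\<^sup>2 = s"
      unfolding r_def[symmetric] using q by simp
  qed
  show "(\<lambda>h. h + q / 4 * h\<^sup>2) ` {0<..} \<subseteq> {0<..}"
    using q by (auto intro!: add_pos_pos)
  show "(\<lambda>s. 2 * (sqrt (1 + s * q) - 1) / q) ` {0<..} \<subseteq> {0<..}"
    using q by auto
qed

lemma Laplace_inverse_sqrt_eq_gauss_laplace: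
  assumes q: "q > 0"
  shows "(LINT s:{0<..}|lborel. exp (- s) * (1 + q * s) powr (- 1/2)) = gauss_laplace q"
proof -
  let ?k = "\<lambda>s::real. exp (- s) * (1 + q * s) powr (- 1/2)"
  let ?g = "\<lambda>h::real. h + q / 4 * h\<^sup>2"
  let ?g' = "\<lambda>h::real. 1 + q / 2 * h"
  have pos: "1 + q * s > 0" if "s > 0" for s
    using that q by (simp add: add_pos_pos)
  have cont: "continuous_on {0<..} ?k"
    by (intro continuous_intros) (auto dest: pos)
  have int: "set_integrable lborel {0<..} ?k"
  proof (rule set_integrable_bound_continuous[OF _ cont set_integrable_exp_Ioi_real[of 1]])
    fix s :: real assume "s \<in> {0<..}"
    then have "(1 + q * s) powr (- 1/2) \<le> 1 powr (- 1/2)"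
      using q by (intro powr_mono2') auto
    then show "norm (?k s) \<le> exp (- (1 * s))" by simp
  qed auto
  have "(LINT s:{0<..}|lborel. ?k s) = (LINT h:{0<..}|lborel. \<bar>?g' h\<bar> *\<^sub>R ?k (?g h))"
    by (rule set_integral_substitution(2)[OF bij_betw_quadratic_Ioi[OF q] _ _ cont int, symmetric])
       (auto intro!: derivative_eq_intros continuous_intros)
  also have "\<dots> = (LINT h:{0<..}|lborel. exp (- h - q / 4 * h\<^sup>2))"
  proof (rule set_integral_cong)
    fix h :: real assume "h \<in> {0<..}"
    then have c: "?g' h > 0" using q by (simp add: add_pos_pos)
    have "1 + q * ?g h = (?g' h)\<^sup>2"
      by (simp add: power2_eq_square algebra_simps)
    then have "(1 + q * ?g h) powr (- 1/2) = inverse (?g' h)"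
      using c powr_minus[of "(?g' h)\<^sup>2" "1/2"] by (simp only: powr_half_sqrt zero_le_power2 real_sqrt_abs abs_of_pos minus_divide_left)
    then have "\<bar>?g' h\<bar> *\<^sub>R ?k (?g h) = exp (- ?g h)"
      using c by (simp only: real_scaleR_def abs_of_pos) simp
    then show "\<bar>?g' h\<bar> *\<^sub>R ?k (?g h) = exp (- h - q / 4 * h\<^sup>2)"
      by (simp only: minus_add_distrib diff_conv_add_uminus)
  qed
  finally show ?thesis
    unfolding gauss_laplace_def .
qed

lemma terminant_half_of_real:
  assumes q: "q > 0"
  shows "terminant (1/2) (of_real q) = of_real (sqrt pi * gauss_laplace q)"
proof -
  have "terminant (1/2) (of_real q) = of_real (sqrt pi) *
      (LINT s:{0<..}|lborel. exp (- of_real s) * (1 + of_real q * of_real s) powr (- of_real (1/2)))"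
    using terminant_eq_Laplace[of "1/2" 1 "of_real q"] q by (simp add: Gamma_one_half_real)
  also have "(LINT s:{0<..}|lborel. exp (- of_real s) * (1 + of_real q * of_real s) powr (- of_real (1/2))) =
      (LINT s:{0<..}|lborel. complex_of_real (exp (- s) * (1 + q * s) powr (- 1/2)))"
  proof (rule set_integral_cong)
    fix s :: real assume "s \<in> {0<..}"
    then have "0 \<le> 1 + q * s" using q by simp
    from powr_of_real[OF this, of "- 1/2"]
    show "exp (- of_real s) * (1 + of_real q * of_real s) powr (- of_real (1/2)) =
        complex_of_real (exp (- s) * (1 + q * s) powr (- 1/2))"
      by (simp flip: exp_of_real)
  qed
  also have "\<dots> = of_real (gauss_laplace q)"
    by (simp only: set_integral_complex_of_real Laplace_inverse_sqrt_eq_gauss_laplace[OF q])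
  finally show ?thesis by simp
qed

lemma continuous_on_gauss_laplace: "continuous_on {0<..} gauss_laplace"
proof -
  have "continuous_on {0<..} (\<lambda>q. terminant (1/2) (complex_of_real q))"
    by (rule continuous_on_compose2[OF holomorphic_on_imp_continuous_on[OF terminant_holomorphic]])
       (auto intro!: continuous_intros simp: complex_nonpos_Reals_iff)
  then have "continuous_on {0<..} (\<lambda>q. Re (terminant (1/2) (complex_of_real q)) / sqrt pi)"
    by (intro continuous_intros) auto
  then show ?thesis
    by (rule continuous_on_eq) (simp add: terminant_half_of_real)
qed

lemma gauss_laplace_le_1:
  assumes "q > 0"
  shows "norm (gauss_laplace q) \<le> 1"
proof -
  have "norm (gauss_laplace q) \<le> (LINT h:{0<..}|lborel. exp (- (1 * h)))"
    unfolding gauss_laplace_def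
    by (rule set_integral_norm_bound_le[OF set_integrable_exp_Ioi_real]) (use assms in auto)
  then show ?thesis
    using set_integral_exp_Ioi_real[of 1] by simp
qed

lemma terminant_beta_half_eq_gauss_laplace:
  assumes y: "y > 0"
  shows "terminant_beta (1/2) (of_real m) (of_real y) =
    of_real (sqrt pi * (LINT r:{0<..<1}|lborel. Beta_weight (1/2 + m) (1/2 - m) r * gauss_laplace (2 * r * (1 - r) * y)))"
proof -
  have "terminant_beta (1/2) (of_real m) (of_real y) = (LINT r:{0<..<1}|lborel.
      complex_of_real (sqrt pi * (Beta_weight (1/2 + m) (1/2 - m) r * gauss_laplace (2 * r * (1 - r) * y))))"
    unfolding terminant_beta_def
  proof (rule set_integral_cong)
    fix r :: real assume r: "r \<in> {0<..<1}"
    have "Beta_weight (of_real (1/2) + of_real m) (of_real (1/2) - of_real m) r = complex_of_real (Beta_weight (1/2 + m) (1/2 - m) r)"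
      using Beta_weight_of_real[OF r, of "1/2 + m" "1/2 - m"] by simp
    moreover have "terminant (1/2) (of_real (2 * r * (1 - r)) * of_real y) = of_real (sqrt pi * gauss_laplace (2 * r * (1 - r) * y))"
      using terminant_half_of_real[of "2 * r * (1 - r) * y"] r y by simp
    ultimately show "Beta_weight (of_real (1/2) + of_real m) (of_real (1/2) - of_real m) r *
        terminant (1/2) (of_real (2 * r * (1 - r)) * of_real y) =
        complex_of_real (sqrt pi * (Beta_weight (1/2 + m) (1/2 - m) r * gauss_laplace (2 * r * (1 - r) * y)))"
      by (simp only: of_real_mult mult_ac)
  qed
  then show ?thesis
    by (simp only: set_integral_complex_of_real set_integral_mult_right)
qed

lemma gauss_laplace_rescale:
  assumes k: "k > 0" and y: "y > 0"
  shows "gauss_laplace (2 * (k / (1 + k)) * (1 - k / (1 + k)) * y) =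
    (1 + k) * (LINT u:{0<..}|lborel. exp (- ((1 + k) * u) - k * y / 2 * u\<^sup>2))"
proof -
  let ?q = "2 * (k / (1 + k)) * (1 - k / (1 + k)) * y"
  have "1 - k / (1 + k) = 1 / (1 + k)"
    using k by (simp add: field_simps)
  then have "?q / 4 * (1 + k)\<^sup>2 = k * y / 2"
    using k by (simp add: power2_eq_square)
  then have "?q / 4 * ((1 + k) * u)\<^sup>2 = k * y / 2 * u\<^sup>2" for u
    by (simp only: power_mult_distrib mult.assoc[symmetric])
  then have "exp (- ((1 + k) * u) - ?q / 4 * ((1 + k) * u)\<^sup>2) = exp (- ((1 + k) * u) - k * y / 2 * u\<^sup>2)" for u
    by (simp only:)
  then have "(LINT u:{0<..}|lborel. exp (- ((1 + k) * u) - k * y / 2 * u\<^sup>2)) = (1 / (1 + k)) *\<^sub>R gauss_laplace ?q"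
    using set_integral_scale_Ioi(2)[of "1 + k" "\<lambda>h. exp (- h - ?q / 4 * h\<^sup>2)"] k
    by (simp only: gauss_laplace_def)
  then show ?thesis
    using k by simp
qed

text \<open>With \<open>r = k / (1 + k)\<close> and \<open>h = (1 + k) u\<close> the integral over \<open>k\<close> becomes a Gamma integral.\<close>

lemma Beta_gauss_laplace_eq_iterated:
  assumes m: "\<bar>m\<bar> < 1/2" and y: "y > 0"
  defines "F \<equiv> \<lambda>k u :: real. k powr (m - 1/2) * exp (- ((1 + k) * u) - k * y / 2 * u\<^sup>2)"
  shows "set_integrable lborel {0<..} (\<lambda>k. LINT u:{0<..}|lborel. F k u)"
    and "(LINT r:{0<..<1}|lborel. Beta_weight (1/2 + m) (1/2 - m) r * gauss_laplace (2 * r * (1 - r) * y)) =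
      (LINT k:{0<..}|lborel. LINT u:{0<..}|lborel. F k u)"
proof -
  let ?f = "\<lambda>r. Beta_weight (1/2 + m) (1/2 - m) r * gauss_laplace (2 * r * (1 - r) * y)"
  have G: "continuous_on {0<..<1} (\<lambda>r. gauss_laplace (2 * r * (1 - r) * y))"
    by (rule continuous_on_compose2[OF continuous_on_gauss_laplace]) (use y in \<open>auto intro!: continuous_intros\<close>)
  have f: "continuous_on {0<..<1} ?f" "set_integrable lborel {0<..<1} ?f"
    using m y
    by (auto intro!: continuous_on_mult continuous_on_Beta_weight_real G set_integrable_mult_bounded_continuous
        set_integrable_Beta_weight_real gauss_laplace_le_1)
  note sub = set_integral_frac_substitution[OF f]
  have F: "(1 / (1 + k)\<^sup>2) *\<^sub>R ?f (k / (1 + k)) = (LINT u:{0<..}|lborel. F k u)" if "k \<in> {0<..}" for k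
  proof -
    define I where "I = (LINT u:{0<..}|lborel. exp (- ((1 + k) * u) - k * y / 2 * u\<^sup>2))"
    have k: "k > 0" using that by simp
    have "?f (k / (1 + k)) = k powr (m - 1/2) * (1 + k) * ((1 + k) * I)"
      unfolding gauss_laplace_rescale[OF k y] Beta_weight_frac[OF k] I_def using k by simp
    then have "(1 / (1 + k)\<^sup>2) *\<^sub>R ?f (k / (1 + k)) = k powr (m - 1/2) * I"
      using k by (simp add: power2_eq_square)
    then show ?thesis
      by (simp only: F_def I_def set_integral_mult_right)
  qed
  show "set_integrable lborel {0<..} (\<lambda>k. LINT u:{0<..}|lborel. F k u)"
    by (rule set_integrable_eq_on[OF sub(1) F])
  show "(LINT r:{0<..<1}|lborel. ?f r) = (LINT k:{0<..}|lborel. LINT u:{0<..}|lborel. F k u)"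
    unfolding sub(2)[symmetric] by (rule set_integral_cong) (rule F)
qed

lemma terminant_beta_half_of_real:
  assumes m: "\<bar>m\<bar> < 1/2" and y: "y > 0"
  shows "terminant_beta (1/2) (of_real m) (of_real y) = of_real (sqrt pi * Gamma (1/2 + m) *
     (LINT u:{0<..}|lborel. u powr (- m - 1/2) * exp (- u) * (1 + u * (y / 2)) powr (- m - 1/2)))"
proof -
  let ?F = "\<lambda>k u :: real. k powr (m - 1/2) * exp (- ((1 + k) * u) - k * y / 2 * u\<^sup>2)"
  note iterated = Beta_gauss_laplace_eq_iterated[OF m y]
  have "(LINT k:{0<..}|lborel. LINT u:{0<..}|lborel. ?F k u) = (LINT u:{0<..}|lborel. LINT k:{0<..}|lborel. ?F k u)"
  proof (rule set_integral_Fubini)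
    show "continuous_on ({0<..} \<times> {0<..}) (\<lambda>(k, u). ?F k u)"
      unfolding case_prod_beta by (intro continuous_intros) auto
    show "set_integrable lborel {0<..} (?F k)" if "k \<in> {0<..}" for k
      using that y by (intro set_integrable_mult_right set_integrable_gauss) auto
    show "set_integrable lborel {0<..} (\<lambda>k. LINT u:{0<..}|lborel. norm (?F k u))"
      using iterated(1) by (simp add: abs_mult)
  qed auto
  also have "\<dots> = (LINT u:{0<..}|lborel. Gamma (1/2 + m) * (u powr (- m - 1/2) * exp (- u) * (1 + u * (y / 2)) powr (- m - 1/2)))"
  proof (rule set_integral_cong)
    fix u :: real assume u: "u \<in> {0<..}"
    define a where "a = u * (1 + u * (y / 2))"
    have pos: "1 + u * (y / 2) > 0" using u y by (simp add: add_pos_pos)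
    have a: "a > 0" using u pos by (simp add: a_def)
    have "(LINT k:{0<..}|lborel. ?F k u) = (LINT k:{0<..}|lborel. exp (- u) * (k powr ((1/2 + m) - 1) * exp (- (a * k))))"
      by (rule set_integral_cong) (simp add: a_def exp_add[symmetric] exp_diff[symmetric] algebra_simps power2_eq_square)
    also have "\<dots> = exp (- u) * (Gamma (1/2 + m) * a powr (- (1/2 + m)))"
      using m a by (subst set_integral_mult_right, subst set_integral_Laplace_powr_real) auto
    also have "a powr (- (1/2 + m)) = u powr (- m - 1/2) * (1 + u * (y / 2)) powr (- m - 1/2)"
      unfolding a_def using u pos by (subst powr_mult) (auto simp: algebra_simps)
    finally show "(LINT k:{0<..}|lborel. ?F k u) = Gamma (1/2 + m) * (u powr (- m - 1/2) * exp (- u) * (1 + u * (y / 2)) powr (- m - 1/2))"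
      by (simp add: mult_ac)
  qed
  finally show ?thesis
    unfolding terminant_beta_half_eq_gauss_laplace[OF y] iterated(2) by simp
qed

lemma terminant_beta_half_rescale:
  assumes m: "\<bar>m\<bar> < 1/2" and x: "x > 0" and t: "t > 0"
  shows "terminant_beta (1/2) (of_real m) (of_real x / of_real t) = of_real (sqrt pi * Gamma (1/2 + m) * t powr (1/2 - m) *
     (LINT s:{0<..}|lborel. s powr (- m - 1/2) * exp (- (t * s)) * (1 + s * (x / 2)) powr (- m - 1/2)))"
proof -
  let ?f = "\<lambda>u::real. u powr (- m - 1/2) * exp (- u) * (1 + u * (x / t / 2)) powr (- m - 1/2)"
  have "(LINT u:{0<..}|lborel. ?f u) = t * (LINT s:{0<..}|lborel. ?f (t * s))"
    using set_integral_scale_Ioi(2)[OF t, of ?f] t by simp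
  also have "(LINT s:{0<..}|lborel. ?f (t * s)) =
      (LINT s:{0<..}|lborel. t powr (- m - 1/2) * (s powr (- m - 1/2) * exp (- (t * s)) * (1 + s * (x / 2)) powr (- m - 1/2)))"
    by (rule set_integral_cong) (use t in \<open>simp add: powr_mult\<close>)
  also have "t * \<dots> = t powr (1/2 - m) *
      (LINT s:{0<..}|lborel. s powr (- m - 1/2) * exp (- (t * s)) * (1 + s * (x / 2)) powr (- m - 1/2))"
  proof -
    have "t * t powr (- m - 1/2) = t powr (1/2 - m)"
      using powr_add[of t 1 "- m - 1/2"] t by simp
    then show ?thesis
      unfolding set_integral_mult_right by (simp only: mult.assoc[symmetric])
  qed
  finally show ?thesis
    using terminant_beta_half_of_real[OF m, of "x / t"] x t by simp
qed

definition euler_Laplace :: "real \<Rightarrow> complex \<Rightarrow> real \<Rightarrow> real \<Rightarrow> real \<Rightarrow> complex" where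
  "euler_Laplace m \<nu> y s t = of_real (s powr (- m - 1/2) * (1 + s * y) powr (- m - 1/2)) *
     (of_real t powr (\<nu> + 1 - of_real m - 1) * exp (- (of_real (1 + s) * of_real t)))"

lemma continuous_on_euler_Laplace:
  assumes y: "y > 0"
  shows "continuous_on ({0<..} \<times> {0<..}) (\<lambda>(s, t). euler_Laplace m \<nu> y s t)"
proof -
  have pos: "1 + s * y \<noteq> 0" if "s > 0" for s
    using that y by (simp add: add_pos_pos less_imp_neq[symmetric])
  have "continuous_on ({0<..} \<times> {0<..}) (\<lambda>p. complex_of_real (snd p) powr (\<nu> + 1 - of_real m - 1))"
    by (intro continuous_on_powr_const continuous_intros) (auto simp: complex_nonpos_Reals_iff)
  moreover have "continuous_on ({0<..} \<times> {0<..}) (\<lambda>p. complex_of_real (fst p powr (- m - 1/2) * (1 + fst p * y) powr (- m - 1/2)))"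
    by (intro continuous_intros) (auto dest: pos)
  moreover have "continuous_on ({0<..} \<times> {0<..}) (\<lambda>p. exp (- (complex_of_real (1 + fst p) * of_real (snd p))))"
    by (intro continuous_intros)
  ultimately show ?thesis
    unfolding euler_Laplace_def case_prod_beta by (intro continuous_on_mult)
qed

lemma euler_Laplace_integral:
  assumes m: "\<bar>m\<bar> < 1/2" and \<nu>: "Re \<nu> > - 1/2" and y: "y > 0" and s: "s > 0"
  defines "E \<equiv> euler_weight m \<nu> s * (1 + of_real s * of_real y) powr of_real (- m - 1/2)"
  shows "set_integrable lborel {0<..} (euler_Laplace m \<nu> y s)"
    and "(LINT t:{0<..}|lborel. euler_Laplace m \<nu> y s t) = Gamma (\<nu> + 1 - of_real m) * E"
    and "(LINT t:{0<..}|lborel. norm (euler_Laplace m \<nu> y s t)) = Gamma (Re \<nu> + 1 - m) * norm E"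
proof -
  define \<kappa> where "\<kappa> = s powr (- m - 1/2) * (1 + s * y) powr (- m - 1/2)"
  let ?z = "\<nu> + 1 - of_real m"
  have z: "Re ?z > 0" and a: "Re (complex_of_real (1 + s)) > 0"
    using m \<nu> s by auto
  note Laplace = set_integrable_Laplace_powr[OF z a] set_integral_Laplace_powr[OF z a]
  have "1 + s * y \<ge> 0" using s y by simp
  from powr_of_real[OF this, of "- m - 1/2"]
  have E: "E = of_real \<kappa> * of_real (1 + s) powr (- ?z)"
    by (simp add: E_def euler_weight_def \<kappa>_def diff_diff_eq)
  have f: "euler_Laplace m \<nu> y s t = of_real \<kappa> * (of_real t powr (?z - 1) * exp (- (of_real (1 + s) * of_real t)))" for t
    by (simp only: euler_Laplace_def \<kappa>_def)
  show "set_integrable lborel {0<..} (euler_Laplace m \<nu> y s)"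
    unfolding f[abs_def] by (intro set_integrable_mult_right Laplace(1))
  show "(LINT t:{0<..}|lborel. euler_Laplace m \<nu> y s t) = Gamma ?z * E"
    unfolding f E set_integral_mult_right Laplace(2) by (simp only: mult_ac)
  have "(LINT t:{0<..}|lborel. norm (euler_Laplace m \<nu> y s t)) =
      (LINT t:{0<..}|lborel. \<kappa> * (t powr ((Re \<nu> + 1 - m) - 1) * exp (- ((1 + s) * t))))"
    by (rule set_integral_cong) (simp add: f norm_mult norm_of_real_powr \<kappa>_def abs_mult)
  also have "\<dots> = Gamma (Re \<nu> + 1 - m) * (\<kappa> * (1 + s) powr (- (Re \<nu> + 1 - m)))"
    by (subst set_integral_mult_right, subst set_integral_Laplace_powr_real) (use m \<nu> s in auto)
  also have "\<kappa> * (1 + s) powr (- (Re \<nu> + 1 - m)) = norm E"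
    using norm_of_real_powr[of "1 + s" "- ?z"] s by (simp add: E norm_mult \<kappa>_def abs_mult)
  finally show "(LINT t:{0<..}|lborel. norm (euler_Laplace m \<nu> y s t)) = Gamma (Re \<nu> + 1 - m) * norm E"
    by (simp add: mult_ac)
qed

lemma euler_integral_eq_Laplace:
  assumes m: "\<bar>m\<bar> < 1/2" and \<nu>: "Re \<nu> > - 1/2" and y: "y > 0"
  shows "Gamma (\<nu> + 1 - of_real m) * euler_integral m \<nu> (of_real y) =
    (LINT t:{0<..}|lborel. LINT s:{0<..}|lborel. euler_Laplace m \<nu> y s t)"
proof -
  let ?E = "\<lambda>s. euler_weight m \<nu> s * (1 + of_real s * of_real y) powr of_real (- m - 1/2)"
  note Laplace = euler_Laplace_integral[OF m \<nu> y]
  have "set_integrable lborel {0<..} ?E"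
    by (rule set_integrable_euler[OF m \<nu>]) (use y in \<open>simp add: complex_nonpos_Reals_iff\<close>)
  then have int: "set_integrable lborel {0<..} (\<lambda>s. Gamma (Re \<nu> + 1 - m) * norm (?E s))"
    by (intro set_integrable_mult_right set_integrable_norm)
  have "Gamma (\<nu> + 1 - of_real m) * euler_integral m \<nu> (of_real y) = (LINT s:{0<..}|lborel. Gamma (\<nu> + 1 - of_real m) * ?E s)"
    unfolding euler_integral_def by (rule set_integral_mult_right[symmetric])
  also have "\<dots> = (LINT s:{0<..}|lborel. LINT t:{0<..}|lborel. euler_Laplace m \<nu> y s t)"
    by (rule set_integral_cong) (simp only: greaterThan_iff Laplace(2))
  also have "\<dots> = (LINT t:{0<..}|lborel. LINT s:{0<..}|lborel. euler_Laplace m \<nu> y s t)"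
  proof (rule set_integral_Fubini[OF _ _ continuous_on_euler_Laplace[OF y]])
    show "set_integrable lborel {0<..} (\<lambda>s. LINT t:{0<..}|lborel. norm (euler_Laplace m \<nu> y s t))"
      by (rule set_integrable_eq_on[OF int]) (simp only: greaterThan_iff Laplace(3))
  qed (auto intro: Laplace(1))
  finally show ?thesis .
qed

lemma legendre_terminant_half_of_real:
  assumes m: "\<bar>m\<bar> < 1/2" and \<nu>: "Re \<nu> > - 1/2" and x: "x > 0"
  shows "legendre_terminant (1/2) (\<nu> + 1/2) (of_real m) (of_real x) =
    of_real (sqrt pi * Gamma (1/2 + m)) * (Gamma (\<nu> + 1 - of_real m) * euler_integral m \<nu> (of_real (x / 2)))"
proof -
  have "Gamma_weight (\<nu> + 1/2) t * terminant_beta (1/2) (of_real m) (of_real x / of_real t) =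
      of_real (sqrt pi * Gamma (1/2 + m)) * (LINT s:{0<..}|lborel. euler_Laplace m \<nu> (x / 2) s t)"
    if "t \<in> {0<..}" for t
  proof -
    let ?e = "\<lambda>s. s powr (- m - 1/2) * exp (- (t * s)) * (1 + s * (x / 2)) powr (- m - 1/2)"
    let ?w = "of_real t powr (\<nu> + 1 - of_real m - 1) * complex_of_real (exp (- t))"
    have t: "t > 0" using that by simp
    have "euler_Laplace m \<nu> (x / 2) s t = ?w * of_real (?e s)" for s
    proof -
      have "exp (- (of_real (1 + s) * complex_of_real t)) = of_real (exp (- t)) * of_real (exp (- (t * s)))"
        by (simp flip: exp_of_real exp_add add: algebra_simps)
      then show ?thesis
        by (simp only: euler_Laplace_def of_real_mult mult_ac)
    qed
    then have "(LINT s:{0<..}|lborel. euler_Laplace m \<nu> (x / 2) s t) = ?w * of_real (LINT s:{0<..}|lborel. ?e s)"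
      by (simp only: set_integral_mult_right set_integral_complex_of_real)
    moreover have "of_real t powr (\<nu> + 1 - of_real m - 1) =
        complex_of_real t powr (\<nu> + 1/2 - 1) * of_real (t powr (1/2 - m))"
      using powr_add[of "complex_of_real t" "\<nu> + 1/2 - 1" "of_real (1/2 - m)"] powr_of_real[of t "1/2 - m"] t
      by (simp add: algebra_simps)
    ultimately show ?thesis
      unfolding terminant_beta_half_rescale[OF m x t] Gamma_weight_def by (simp only: of_real_mult mult_ac)
  qed
  then have "legendre_terminant (1/2) (\<nu> + 1/2) (of_real m) (of_real x) =
      (LINT t:{0<..}|lborel. of_real (sqrt pi * Gamma (1/2 + m)) * (LINT s:{0<..}|lborel. euler_Laplace m \<nu> (x / 2) s t))"
    unfolding legendre_terminant_def by (rule set_integral_cong)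
  then show ?thesis
    using euler_integral_eq_Laplace[OF m \<nu>, of "x / 2"] x by (simp only: set_integral_mult_right half_gt_zero)
qed

lemma connected_slit: "connected (- \<real>\<^sub>\<le>\<^sub>0 :: complex set)"
proof -
  have "(\<real>\<^sub>\<le>\<^sub>0 :: complex set) = of_real ` {..0}"
    by (auto simp: nonpos_Reals_def)
  then show ?thesis
    using starlike_imp_connected[OF starlike_slotted_complex_plane_left[of 0]] by simp
qed

lemma legendre_rem_0_eq_euler_integral:
  assumes m: "\<bar>m\<bar> < 1/2" and \<nu>: "Re \<nu> > - 1/2" and x: "x \<notin> \<real>\<^sub>\<le>\<^sub>0"
  shows "legendre_rem 0 x (of_real m) \<nu> =
    rGamma (1/2 - of_real m) * Gamma (\<nu> + 1 - of_real m) * euler_integral m \<nu> (x / 2)"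
proof (rule holomorphic_eq_if_eq_on_real_interval[where S = "- \<real>\<^sub>\<le>\<^sub>0" and a = 0 and b = 1 and z = x
      and f = "\<lambda>x. legendre_rem 0 x (of_real m) \<nu>"
      and g = "\<lambda>x. rGamma (1/2 - of_real m) * Gamma (\<nu> + 1 - of_real m) * euler_integral m \<nu> (x / 2)"])
  have "euler_integral m \<nu> \<circ> (\<lambda>x. x / 2) holomorphic_on - \<real>\<^sub>\<le>\<^sub>0"
    by (rule holomorphic_on_compose_gen[OF _ euler_integral_holomorphic[OF m \<nu>]])
       (auto intro!: holomorphic_intros simp: complex_nonpos_Reals_iff)
  then show "(\<lambda>x. rGamma (1/2 - of_real m) * Gamma (\<nu> + 1 - of_real m) * euler_integral m \<nu> (x / 2)) holomorphic_on - \<real>\<^sub>\<le>\<^sub>0"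
    by (intro holomorphic_intros) (simp add: o_def)
  show "(\<lambda>x. legendre_rem 0 x (of_real m) \<nu>) holomorphic_on - \<real>\<^sub>\<le>\<^sub>0"
    by (rule legendre_rem_holomorphic) (use m \<nu> in auto)
  fix x :: real assume x: "0 < x"
  show "legendre_rem 0 (of_real x) (of_real m) \<nu> =
      rGamma (1/2 - of_real m) * Gamma (\<nu> + 1 - of_real m) * euler_integral m \<nu> (of_real x / 2)"
  proof -
    have "rGamma (1/2 + complex_of_real m) \<noteq> 0"
      using m not_nonpos_Ints_Re[of "1/2 + complex_of_real m"] by (simp add: rGamma_eq_zero_iff)
    then have "rGamma (1/2 + complex_of_real m) * Gamma (1/2 + of_real m) = 1"
      by (simp add: Gamma_def)
    then have reflection: "cos (of_real pi * of_real m) / of_real pi * Gamma (1/2 + of_real m) = rGamma (1/2 - complex_of_real m)"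
      unfolding rGamma_half_reflection[symmetric] mult.assoc by simp
    have "complex_of_real (Gamma (1/2 + m)) = Gamma (1/2 + of_real m)"
      using Gamma_complex_of_real[of "1/2 + m"] by simp
    then have factor: "cos (of_real pi * of_real m) / of_real (pi powr (3/2)) * of_real (sqrt pi * Gamma (1/2 + m)) =
        rGamma (1/2 - complex_of_real m)"
      unfolding reflection[symmetric] by (simp add: pi_powr_three_halves)
    have "legendre_rem 0 (of_real x) (of_real m) \<nu> =
        cos (of_real pi * of_real m) / of_real (pi powr (3/2)) * legendre_terminant (1/2) (\<nu> + 1/2) (of_real m) (of_real x)"
      by (simp add: legendre_rem_def)
    then show ?thesis
      unfolding legendre_terminant_half_of_real[OF m \<nu> x] by (simp only: mult.assoc[symmetric] factor of_real_divide of_real_numeral)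
  qed
qed (use x connected_slit in \<open>auto simp: complex_nonpos_Reals_iff closed_nonpos_Reals_complex\<close>)

section \<open>The Mehler--Dirichlet kernel on a half-strip\<close>

definition mehler_kernel :: "real \<Rightarrow> real \<Rightarrow> complex \<Rightarrow> complex \<Rightarrow> complex" where
  "mehler_kernel b m \<nu> t = exp ((\<nu> + 1/2) * t) * (cosh t - of_real (cos b)) powr of_real (- m - 1/2)"

definition mehler_strip :: "real \<Rightarrow> complex set" where
  "mehler_strip b = {t. \<bar>Im t\<bar> \<le> b \<and> (Re t \<noteq> 0 \<or> \<bar>Im t\<bar> < b)}"

lemma Re_cosh_complex: "Re (cosh t) = cosh (Re t) * cos (Im t)"
  and Im_cosh_complex: "Im (cosh t) = sinh (Re t) * sin (Im t)"
  by (simp_all add: cosh_def sinh_def Re_exp Im_exp algebra_simps)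

lemma cos_le_cosh: "cos (x :: real) \<le> cosh y"
  using cos_le_one[of x] cosh_real_ge_1[of y] by linarith

lemma cos_less_cos_abs: "b < pi \<Longrightarrow> \<bar>\<eta>\<bar> < b \<Longrightarrow> cos b < cos \<eta>"
  using cos_monotone_0_pi[of "\<bar>\<eta>\<bar>" b] by simp

lemma cosh_minus_cos_notin_nonpos_Reals:
  assumes b: "0 < b" "b < pi" and t: "t \<in> mehler_strip b"
  shows "cosh t - of_real (cos b) \<notin> \<real>\<^sub>\<le>\<^sub>0"
proof
  assume "cosh t - of_real (cos b) \<in> \<real>\<^sub>\<le>\<^sub>0"
  then have Re_le: "cosh (Re t) * cos (Im t) \<le> cos b" and Im_zero: "sinh (Re t) = 0 \<or> sin (Im t) = 0"
    by (simp_all add: complex_nonpos_Reals_iff Re_cosh_complex Im_cosh_complex)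
  show False
  proof (cases "Re t = 0")
    case True
    then have "cos b < cos (Im t)"
      using t b by (intro cos_less_cos_abs) (auto simp: mehler_strip_def)
    then show False using Re_le True by simp
  next
    case False
    then have "sin (Im t) = 0" using Im_zero by simp
    then have "Im t = 0"
      by (rule sin_eq_0_pi[rotated 2]) (use t b in \<open>auto simp: mehler_strip_def\<close>)
    then have "cosh (Re t) \<le> cos b" using Re_le by simp
    then show False
      using cos_less_cos_abs[of b 0] cosh_real_ge_1[of "Re t"] b by simp
  qed
qed

lemma norm_cosh_minus_cos_sq:
  "(norm (cosh t - of_real (cos b)))\<^sup>2 = (cosh (Re t) - cos (Im t - b)) * (cosh (Re t) - cos (Im t + b))"
proof -
  define C s c d S where "C = cosh (Re t)" "s = sin (Im t)" "c = cos (Im t)" "d = cos b" "S = sin b"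
  note defs = C_s_c_d_S_def
  have squares: "(sinh (Re t))\<^sup>2 = C\<^sup>2 - 1" "s\<^sup>2 = 1 - c\<^sup>2" "S\<^sup>2 = 1 - d\<^sup>2"
    by (simp_all add: defs sinh_square_eq sin_squared_eq)
  have "(norm (cosh t - of_real (cos b)))\<^sup>2 = (C * c - d)\<^sup>2 + (sinh (Re t))\<^sup>2 * s\<^sup>2"
    by (simp add: defs cmod_power2 Re_cosh_complex Im_cosh_complex power_mult_distrib)
  also have "\<dots> = (C - c * d)\<^sup>2 - s\<^sup>2 * S\<^sup>2"
    unfolding squares by (simp add: power2_eq_square algebra_simps)
  also have "\<dots> = (C - (c * d + s * S)) * (C - (c * d - s * S))"
    by (simp add: power2_eq_square algebra_simps)
  finally show ?thesis
    by (simp add: defs cos_add cos_diff)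
qed

lemma norm_cosh_minus_cos_ge_cosh: "norm (cosh t - of_real (cos b)) \<ge> cosh (Re t) - 1"
proof (rule power2_le_imp_le)
  show "(cosh (Re t) - 1)\<^sup>2 \<le> (norm (cosh t - of_real (cos b)))\<^sup>2"
    unfolding norm_cosh_minus_cos_sq unfolding power2_eq_square
    by (intro mult_mono) (auto simp: cosh_real_ge_1 cos_le_cosh)
qed simp

lemma norm_cosh_minus_cos_ge_cos: "norm (cosh t - of_real (cos b)) \<ge> cos (Im t) - cos b"
proof (rule power2_le_imp_le)
  have "cosh (\<i> * of_real (Im t)) - of_real (cos b) = complex_of_real (cos (Im t) - cos b)"
    by (simp add: cosh_conv_cos mult.assoc[symmetric] cos_of_real)
  then have "(cos (Im t) - cos b)\<^sup>2 = (norm (cosh (\<i> * of_real (Im t)) - complex_of_real (cos b)))\<^sup>2"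
    by (simp only: norm_of_real power2_abs)
  also have "\<dots> = (1 - cos (Im t - b)) * (1 - cos (Im t + b))"
    by (simp only: norm_cosh_minus_cos_sq) simp
  also have "\<dots> \<le> (norm (cosh t - of_real (cos b)))\<^sup>2"
    unfolding norm_cosh_minus_cos_sq by (intro mult_mono) (auto simp: cosh_real_ge_1 cos_le_cosh)
  finally show "(cos (Im t) - cos b)\<^sup>2 \<le> (norm (cosh t - of_real (cos b)))\<^sup>2" .
qed simp

lemma norm_mehler_kernel_le:
  assumes b: "\<bar>Im t\<bar> \<le> b" and m: "m > - 1/2" and d: "d > 0" "norm (cosh t - of_real (cos b)) \<ge> d"
  shows "norm (mehler_kernel b m \<nu> t) \<le> exp (\<bar>Im \<nu>\<bar> * b) * (exp ((Re \<nu> + 1/2) * Re t) * d powr (- m - 1/2))"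
proof -
  have "- (Im \<nu> * Im t) \<le> \<bar>Im \<nu>\<bar> * \<bar>Im t\<bar>" by (metis abs_ge_minus_self abs_mult)
  also have "\<dots> \<le> \<bar>Im \<nu>\<bar> * b" using b by (intro mult_left_mono) auto
  finally have "norm (exp ((\<nu> + 1/2) * t)) \<le> exp (\<bar>Im \<nu>\<bar> * b + (Re \<nu> + 1/2) * Re t)"
    by simp
  then have exp_le: "norm (exp ((\<nu> + 1/2) * t)) \<le> exp (\<bar>Im \<nu>\<bar> * b) * exp ((Re \<nu> + 1/2) * Re t)"
    by (simp only: exp_add)
  have "norm ((cosh t - of_real (cos b)) powr of_real (- m - 1/2)) = norm (cosh t - of_real (cos b)) powr (- m - 1/2)"
    by (subst norm_powr_real_powr') auto
  also have "\<dots> \<le> d powr (- m - 1/2)" using d m by (intro powr_mono2') auto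
  finally have "norm (mehler_kernel b m \<nu> t) \<le> exp (\<bar>Im \<nu>\<bar> * b) * exp ((Re \<nu> + 1/2) * Re t) * d powr (- m - 1/2)"
    unfolding mehler_kernel_def norm_mult by (intro mult_mono exp_le) auto
  then show ?thesis by (simp only: mult.assoc)
qed

lemma norm_mehler_kernel_le_cos:
  assumes b: "b < pi" "\<bar>Im t\<bar> < b" and m: "m > - 1/2" and \<nu>: "Re \<nu> \<ge> - 1/2" and t: "Re t \<le> 0"
  shows "norm (mehler_kernel b m \<nu> t) \<le>
    exp (\<bar>Im \<nu>\<bar> * b) * (exp ((Re \<nu> + 1/2) * Re t) * (cos (Im t) - cos b) powr (- m - 1/2))"
    and "norm (mehler_kernel b m \<nu> t) \<le> exp (\<bar>Im \<nu>\<bar> * b) * (cos (Im t) - cos b) powr (- m - 1/2)"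
proof -
  show bound: "norm (mehler_kernel b m \<nu> t) \<le>
    exp (\<bar>Im \<nu>\<bar> * b) * (exp ((Re \<nu> + 1/2) * Re t) * (cos (Im t) - cos b) powr (- m - 1/2))"
    using cos_less_cos_abs[OF b] b m
    by (intro norm_mehler_kernel_le norm_cosh_minus_cos_ge_cos) auto
  have "exp ((Re \<nu> + 1/2) * Re t) \<le> 1"
    using \<nu> t by (simp add: mult_nonneg_nonpos)
  then have "exp ((Re \<nu> + 1/2) * Re t) * (cos (Im t) - cos b) powr (- m - 1/2) \<le> 1 * (cos (Im t) - cos b) powr (- m - 1/2)"
    by (intro mult_right_mono) auto
  then show "norm (mehler_kernel b m \<nu> t) \<le> exp (\<bar>Im \<nu>\<bar> * b) * (cos (Im t) - cos b) powr (- m - 1/2)"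
    using bound by (auto elim!: order_trans)
qed

lemma continuous_on_mehler_kernel:
  assumes b: "0 < b" "b < pi"
  shows "continuous_on (mehler_strip b) (mehler_kernel b m \<nu>)"
proof -
  have "continuous_on (mehler_strip b) (\<lambda>t. (cosh t - complex_of_real (cos b)) powr of_real (- m - 1/2))"
    by (intro continuous_on_powr_const cosh_minus_cos_notin_nonpos_Reals[OF b])
       (auto simp: cosh_field_def intro!: continuous_intros)
  then show ?thesis
    unfolding mehler_kernel_def by (intro continuous_on_mult) (intro continuous_intros)
qed

lemma continuous_on_mehler_kernel_compose:
  assumes b: "0 < b" "b < pi" and g: "continuous_on A g" "\<And>x. x \<in> A \<Longrightarrow> g x \<in> mehler_strip b"
  shows "continuous_on A (\<lambda>x. mehler_kernel b m \<nu> (g x))"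
  by (rule continuous_on_compose2[OF continuous_on_mehler_kernel[OF b] g(1)]) (use g(2) in auto)

lemma mehler_kernel_tendsto:
  assumes b: "0 < b" "b < pi" and X: "X \<longlonglongrightarrow> l" "\<And>n. X n \<in> mehler_strip b" and l: "l \<in> mehler_strip b"
  shows "(\<lambda>n. mehler_kernel b m \<nu> (X n)) \<longlonglongrightarrow> mehler_kernel b m \<nu> l"
  by (rule continuous_on_tendsto_compose[OF continuous_on_mehler_kernel[OF b] X(1) l]) (use X(2) in auto)

lemma mehler_kernel_holomorphic:
  assumes b: "0 < b" "b < pi"
  shows "mehler_kernel b m \<nu> holomorphic_on {t. Re t < 0 \<and> \<bar>Im t\<bar> < b}"
proof -
  have "(\<lambda>t. exp ((\<nu> + 1/2) * t) * (cosh t - of_real (cos b)) powr of_real (- m - 1/2))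
      holomorphic_on {t. Re t < 0 \<and> \<bar>Im t\<bar> < b}"
    by (intro holomorphic_intros cosh_minus_cos_notin_nonpos_Reals[OF b]) (auto simp: mehler_strip_def cosh_field_def intro!: holomorphic_intros)
  then show ?thesis by (simp add: mehler_kernel_def[abs_def])
qed

lemma integral_rectangle_holomorphic:
  fixes f :: "complex \<Rightarrow> complex"
  assumes S: "open S" "convex S" and f: "f holomorphic_on S" and le: "a \<le> b" "c \<le> d"
    and sub: "\<And>x y. x \<in> {a..b} \<Longrightarrow> y \<in> {c..d} \<Longrightarrow> of_real x + \<i> * of_real y \<in> S"
  shows "integral {a..b} (\<lambda>x. f (of_real x + \<i> * of_real d)) - integral {a..b} (\<lambda>x. f (of_real x + \<i> * of_real c)) =
    integral {c..d} (\<lambda>y. \<i> * f (of_real b + \<i> * of_real y)) - integral {c..d} (\<lambda>y. \<i> * f (of_real a + \<i> * of_real y))"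
proof -
  obtain F where F: "\<And>t. t \<in> S \<Longrightarrow> (F has_field_derivative f t) (at t)"
    using holomorphic_convex_primitive'[OF S(2,1) f] at_within_open[OF _ S(1)] by metis
  have segment: "integral {u..v} (\<lambda>t. q * f (p + q * of_real t)) = F (p + q * of_real v) - F (p + q * of_real u)"
    if "u \<le> v" "\<And>t. t \<in> {u..v} \<Longrightarrow> p + q * of_real t \<in> S" for p q and u v :: real
  proof (rule integral_unique[OF fundamental_theorem_of_calculus[OF that(1)]])
    fix t assume "t \<in> {u..v}"
    have "((\<lambda>z. p + q * z) has_field_derivative q) (at (of_real t))"
      by (auto intro!: derivative_eq_intros)
    then have "((\<lambda>z. F (p + q * z)) has_field_derivative f (p + q * of_real t) * q) (at (of_real t))"
      by (rule DERIV_chain2[where f = F and g = "\<lambda>z. p + q * z", OF F[OF that(2)[OF \<open>t \<in> {u..v}\<close>]]])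
    then show "((\<lambda>t. F (p + q * of_real t)) has_vector_derivative q * f (p + q * of_real t)) (at t within {u..v})"
      by (subst mult.commute) (rule has_vector_derivative_real_field)
  qed
  show ?thesis
    using segment[of a b "\<i> * of_real c" 1] segment[of a b "\<i> * of_real d" 1]
      segment[of c d "of_real a" \<i>] segment[of c d "of_real b" \<i>] le sub
    by (simp add: add.commute)
qed

lemma mehler_kernel_rectangle:
  assumes b: "0 < b" "b < pi" and c: "0 < c" "c < b" and e: "0 < e" "e < L"
  shows "integral {- L..- e} (\<lambda>\<theta>. mehler_kernel b m \<nu> (of_real \<theta> + \<i> * of_real c)) -
         integral {- L..- e} (\<lambda>\<theta>. mehler_kernel b m \<nu> (of_real \<theta> + \<i> * of_real (- c))) =
         integral {- c..c} (\<lambda>\<eta>. \<i> * mehler_kernel b m \<nu> (of_real (- e) + \<i> * of_real \<eta>)) -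
         integral {- c..c} (\<lambda>\<eta>. \<i> * mehler_kernel b m \<nu> (of_real (- L) + \<i> * of_real \<eta>))"
proof (rule integral_rectangle_holomorphic[OF _ _ mehler_kernel_holomorphic[OF b]])
  have "{t. Re t < 0 \<and> \<bar>Im t\<bar> < b} = {t. Re t < 0} \<inter> {t. Im t < b} \<inter> {t. Im t > - b}"
    by auto
  then show "open {t. Re t < 0 \<and> \<bar>Im t\<bar> < b}" "convex {t. Re t < 0 \<and> \<bar>Im t\<bar> < b}"
    by (auto intro!: open_Int open_halfspace_Re_lt open_halfspace_Im_lt open_halfspace_Im_gt
        convex_Int convex_halfspace_Re_lt convex_halfspace_Im_lt convex_halfspace_Im_gt)
qed (use c e in auto)

lemma mult_powr_Re_nonneg:
  assumes "w \<noteq> 0" "Re w \<ge> 0" "Re y > 0"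
  shows "(w * y) powr a = w powr a * y powr a"
proof -
  have y: "y \<noteq> 0" using assms by auto
  have "\<bar>Im (Ln w)\<bar> \<le> pi / 2" using Re_Ln_pos_le[OF assms(1)] assms(2) by simp
  moreover have "\<bar>Im (Ln y)\<bar> < pi / 2" using Re_Ln_pos_lt[OF y] assms(3) by simp
  ultimately have "Ln (w * y) = Ln w + Ln y"
    by (intro Ln_times_simple) (use assms y in \<open>auto simp: abs_le_iff abs_less_iff\<close>)
  then show ?thesis using assms(1) y by (simp add: powr_def exp_add[symmetric] algebra_simps)
qed

lemma bij_betw_exp_minus_one: "bij_betw (\<lambda>\<theta>::real. exp (- \<theta>) - 1) {..<0} {0<..}"
  by (rule bij_betw_byWitness[where f' = "\<lambda>s. - ln (1 + s)"]) auto

lemma set_integral_exp_minus_one_substitution: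
  fixes f :: "real \<Rightarrow> 'b::euclidean_space"
  assumes f: "continuous_on {0<..} f" "set_integrable lborel {0<..} f"
  shows "set_integrable lborel {..<0} (\<lambda>\<theta>. exp (- \<theta>) *\<^sub>R f (exp (- \<theta>) - 1))"
    and "(LINT \<theta>:{..<0}|lborel. exp (- \<theta>) *\<^sub>R f (exp (- \<theta>) - 1)) = (LINT s:{0<..}|lborel. f s)"
proof -
  have deriv: "((\<lambda>\<theta>. exp (- \<theta>) - 1) has_field_derivative - exp (- \<theta>)) (at \<theta>)" for \<theta> :: real
    by (auto intro!: derivative_eq_intros)
  have "continuous_on {..<0} (\<lambda>\<theta>::real. - exp (- \<theta>))"
    by (intro continuous_intros)
  note sub = set_integral_substitution[OF bij_betw_exp_minus_one deriv this f]
  show "set_integrable lborel {..<0} (\<lambda>\<theta>. exp (- \<theta>) *\<^sub>R f (exp (- \<theta>) - 1))"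
    and "(LINT \<theta>:{..<0}|lborel. exp (- \<theta>) *\<^sub>R f (exp (- \<theta>) - 1)) = (LINT s:{0<..}|lborel. f s)"
    using sub by simp_all
qed

lemma cosh_sinh_exp_minus_one:
  fixes \<theta> :: real
  defines "s \<equiv> exp (- \<theta>) - 1"
  shows "cosh \<theta> = 1 + s\<^sup>2 / (2 * (1 + s))" and "sinh \<theta> = - (s / (1 + s) * (1 + s / 2))"
proof -
  have s: "exp (- \<theta>) = 1 + s" "1 + s \<noteq> 0" by (simp_all add: s_def)
  then have "exp \<theta> = 1 / (1 + s)" by (metis exp_minus inverse_eq_divide inverse_inverse_eq)
  then show "cosh \<theta> = 1 + s\<^sup>2 / (2 * (1 + s))" "sinh \<theta> = - (s / (1 + s) * (1 + s / 2))"
    using s by (simp_all add: cosh_field_def sinh_field_def field_simps power2_eq_square)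
qed

lemma cosh_minus_cos_ray:
  fixes \<theta> c :: real
  assumes "sin c \<noteq> 0"
  defines "s \<equiv> exp (- \<theta>) - 1"
  shows "cosh (of_real \<theta> + \<i> * of_real c) - of_real (cos c) = complex_of_real (s / (1 + s)) *
    (- \<i> * of_real (sin c) * (1 + of_real s * ((1 + \<i> * of_real (cot c)) / 2)))"
proof (rule complex_eqI)
  note hyp = cosh_sinh_exp_minus_one[of \<theta>, folded s_def]
  have s: "1 + s \<noteq> 0" by (simp add: s_def)
  have cot: "sin c * cot c = cos c" using assms(1) by (simp add: cot_def)
  have Re_of_real_mult: "Re (complex_of_real r * z) = r * Re z" for r z by simp
  let ?L = "cosh (of_real \<theta> + \<i> * of_real c) - complex_of_real (cos c)"
  let ?R = "complex_of_real (s / (1 + s)) * (- \<i> * of_real (sin c) * (1 + of_real s * ((1 + \<i> * of_real (cot c)) / 2)))"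
  have "Re ?L = s\<^sup>2 / (2 * (1 + s)) * cos c"
    by (simp add: Re_cosh_complex hyp algebra_simps)
  also have "\<dots> = s / (1 + s) * (s / 2 * (sin c * cot c))"
    unfolding cot by (simp add: power2_eq_square mult_ac)
  also have "\<dots> = Re ?R"
    unfolding Re_of_real_mult by simp
  finally show "Re ?L = Re ?R" .
  show "Im ?L = Im ?R"
    by (simp add: Im_cosh_complex hyp)
qed

lemma exp_mult_powr_eq_euler_weight:
  fixes \<theta> :: real
  assumes "\<theta> < 0"
  defines "s \<equiv> exp (- \<theta>) - 1"
  shows "exp ((\<nu> + 1/2) * of_real \<theta>) * of_real ((s / (1 + s)) powr (- m - 1/2)) = of_real (1 + s) * euler_weight m \<nu> s"
proof -
  have s: "s > 0" and exp: "1 + s = exp (- \<theta>)" using assms by (simp_all add: s_def)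
  have powr: "complex_of_real (1 + s) powr z = exp (- z * of_real \<theta>)" for z
    unfolding exp by (simp add: powr_def exp_of_real[symmetric])
  have "(1 + s) powr (- m - 1/2) = inverse ((1 + s) powr (m + 1/2))"
    using powr_minus[of "1 + s" "m + 1/2"] by simp
  then have "(s / (1 + s)) powr (- m - 1/2) = s powr (- m - 1/2) * (1 + s) powr (m + 1/2)"
    using s by (simp add: powr_divide field_simps)
  then have "exp ((\<nu> + 1/2) * of_real \<theta>) * of_real ((s / (1 + s)) powr (- m - 1/2)) =
      of_real (s powr (- m - 1/2)) * (exp ((\<nu> + 1/2) * of_real \<theta>) * of_real (1 + s) powr of_real (m + 1/2))"
    using s powr_of_real[of "1 + s" "m + 1/2"] by simp
  also have "exp ((\<nu> + 1/2) * of_real \<theta>) * of_real (1 + s) powr of_real (m + 1/2) =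
      of_real (1 + s) * of_real (1 + s) powr (of_real m - \<nu> - 1)"
  proof -
    have "complex_of_real (1 + s) = of_real (1 + s) powr 1" using s by simp
    then show ?thesis
      unfolding powr by (simp add: exp_add[symmetric] algebra_simps)
  qed
  finally show ?thesis
    by (simp add: euler_weight_def mult_ac)
qed

lemma mehler_kernel_ray:
  assumes b: "0 < b" "b < pi" and c: "\<bar>c\<bar> = b" and \<theta>: "\<theta> < 0"
  shows "mehler_kernel b m \<nu> (of_real \<theta> + \<i> * of_real c) =
     exp (\<i> * (\<nu> + 1/2) * of_real c) * (- \<i> * of_real (sin c)) powr of_real (- m - 1/2) *
     (exp (- \<theta>) *\<^sub>R (euler_weight m \<nu> (exp (- \<theta>) - 1) *
       (1 + of_real (exp (- \<theta>) - 1) * ((1 + \<i> * of_real (cot c)) / 2)) powr of_real (- m - 1/2)))"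
proof -
  define s where "s = exp (- \<theta>) - 1"
  let ?a = "complex_of_real (- m - 1/2)"
  let ?w = "- \<i> * complex_of_real (sin c)"
  let ?y = "1 + of_real s * ((1 + \<i> * complex_of_real (cot c)) / 2)"
  have s: "s > 0" "exp (- \<theta>) = 1 + s" using \<theta> by (simp_all add: s_def)
  have "sin c \<noteq> 0"
  proof
    assume "sin c = 0"
    then have "c = 0" by (rule sin_eq_0_pi[rotated 2]) (use b c in linarith)+
    then show False using b c by simp
  qed
  have "cos b = cos c" using c by (metis cos_abs_real)
  then have "(cosh (of_real \<theta> + \<i> * of_real c) - of_real (cos b)) powr ?a = (of_real (s / (1 + s)) * (?w * ?y)) powr ?a"
    using cosh_minus_cos_ray[OF \<open>sin c \<noteq> 0\<close>, of \<theta>] by (simp only: s_def)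
  also have "\<dots> = of_real (s / (1 + s)) powr ?a * (?w powr ?a * ?y powr ?a)"
  proof -
    have "(?w * ?y) powr ?a = ?w powr ?a * ?y powr ?a"
      by (rule mult_powr_Re_nonneg) (use s \<open>sin c \<noteq> 0\<close> in auto)
    moreover have "(of_real (s / (1 + s)) * (?w * ?y)) powr ?a = of_real (s / (1 + s)) powr ?a * (?w * ?y) powr ?a"
      by (rule powr_times_real_left) (use s in auto)
    ultimately show ?thesis by simp
  qed
  also have "of_real (s / (1 + s)) powr ?a = complex_of_real ((s / (1 + s)) powr (- m - 1/2))"
    using s by (intro powr_of_real) simp
  finally have "mehler_kernel b m \<nu> (of_real \<theta> + \<i> * of_real c) =
      exp (\<i> * (\<nu> + 1/2) * of_real c) * ?w powr ?a *
      (exp ((\<nu> + 1/2) * of_real \<theta>) * of_real ((s / (1 + s)) powr (- m - 1/2))) * ?y powr ?a"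
    by (simp only: mehler_kernel_def distrib_left exp_add mult_ac)
  also have "exp ((\<nu> + 1/2) * of_real \<theta>) * of_real ((s / (1 + s)) powr (- m - 1/2)) = of_real (1 + s) * euler_weight m \<nu> s"
    using exp_mult_powr_eq_euler_weight[OF \<theta>] by (simp only: s_def)
  finally show ?thesis
    unfolding s_def[symmetric] unfolding s(2) scaleR_conv_of_real by (simp only: mult_ac)
qed

lemma mehler_kernel_ray_integral:
  assumes m: "\<bar>m\<bar> < 1/2" and \<nu>: "Re \<nu> > - 1/2" and b: "0 < b" "b < pi" and c: "\<bar>c\<bar> = b"
  shows "(LINT \<theta>:{..<0}|lborel. mehler_kernel b m \<nu> (of_real \<theta> + \<i> * of_real c)) =
     exp (\<i> * (\<nu> + 1/2) * of_real c) * (- \<i> * of_real (sin c)) powr of_real (- m - 1/2) *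
     euler_integral m \<nu> ((1 + \<i> * of_real (cot c)) / 2)"
proof -
  let ?y = "(1 + \<i> * complex_of_real (cot c)) / 2"
  let ?E = "\<lambda>s. euler_weight m \<nu> s * (1 + of_real s * ?y) powr of_real (- m - 1/2)"
  have y: "?y \<notin> \<real>\<^sub>\<le>\<^sub>0" by (rule not_nonpos_Reals_Re) simp
  have "(LINT \<theta>:{..<0}|lborel. mehler_kernel b m \<nu> (of_real \<theta> + \<i> * of_real c)) =
      (LINT \<theta>:{..<0}|lborel. exp (\<i> * (\<nu> + 1/2) * of_real c) * (- \<i> * of_real (sin c)) powr of_real (- m - 1/2) *
        (exp (- \<theta>) *\<^sub>R ?E (exp (- \<theta>) - 1)))"
    by (rule set_integral_cong) (simp only: lessThan_iff mehler_kernel_ray[OF b c])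
  also have "\<dots> = exp (\<i> * (\<nu> + 1/2) * of_real c) * (- \<i> * of_real (sin c)) powr of_real (- m - 1/2) *
      (LINT \<theta>:{..<0}|lborel. exp (- \<theta>) *\<^sub>R ?E (exp (- \<theta>) - 1))"
    by (rule set_integral_mult_right)
  also have "(LINT \<theta>:{..<0}|lborel. exp (- \<theta>) *\<^sub>R ?E (exp (- \<theta>) - 1)) = (LINT s:{0<..}|lborel. ?E s)"
    by (intro set_integral_exp_minus_one_substitution(2) set_integrable_euler[OF m \<nu> y]
        continuous_on_mult continuous_on_euler_weight continuous_on_euler_kernel[OF y])
  finally show ?thesis
    unfolding euler_integral_def .
qed

lemma set_integrable_exp_mult_cosh_powr:
  fixes m a :: real
  assumes m: "m < 0" and a: "a > - m - 1/2"
  shows "set_integrable lborel {..<0} (\<lambda>\<theta>. exp (a * \<theta>) * (cosh \<theta> - 1) powr (- m - 1/2))"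
proof -
  let ?F = "\<lambda>s::real. s powr (- 2 * m - 1) * (1 + s) powr (- (- 2 * m + (a + m + 1/2)))"
  have "continuous_on {0<..} ?F" by (intro continuous_intros) auto
  moreover have "set_integrable lborel {0<..} ?F"
    by (rule set_integrable_Beta_Ioi) (use m a in auto)
  ultimately have int: "set_integrable lborel {..<0} (\<lambda>\<theta>. (1/2) powr (- m - 1/2) * (exp (- \<theta>) *\<^sub>R ?F (exp (- \<theta>) - 1)))"
    by (intro set_integrable_mult_right set_integral_exp_minus_one_substitution(1))
  show ?thesis
  proof (rule set_integrable_eq_on[OF int])
    fix \<theta> :: real assume \<theta>: "\<theta> \<in> {..<0}"
    define s where "s = exp (- \<theta>) - 1"
    have s: "s > 0" "exp (- \<theta>) = 1 + s" using \<theta> by (simp_all add: s_def)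
    have "cosh \<theta> - 1 = 1/2 * ((s powr 2) * (1 + s) powr (- 1))"
      unfolding cosh_sinh_exp_minus_one(1) s_def[symmetric] using s(1) by (simp add: powr_minus_divide)
    then have "(cosh \<theta> - 1) powr (- m - 1/2) = (1/2) powr (- m - 1/2) * (s powr (- 2 * m - 1) * (1 + s) powr (m + 1/2))"
      using s by (simp only: powr_mult powr_powr) (simp add: algebra_simps)
    moreover have "exp (a * \<theta>) = (1 + s) powr (- a)"
      unfolding s(2)[symmetric] by (simp add: powr_def)
    moreover have "(1 + s) * (1 + s) powr (- (- 2 * m + (a + m + 1/2))) = (1 + s) powr (- a) * (1 + s) powr (m + 1/2)"
    proof -
      have "1 + s = (1 + s) powr 1" using s by simp
      then have "(1 + s) * (1 + s) powr (- (- 2 * m + (a + m + 1/2))) = (1 + s) powr (1 + - (- 2 * m + (a + m + 1/2)))"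
        by (simp only: powr_add)
      also have "1 + - (- 2 * m + (a + m + 1/2)) = - a + (m + 1/2)" by simp
      finally show ?thesis by (simp only: powr_add)
    qed
    ultimately show "(1/2) powr (- m - 1/2) * (exp (- \<theta>) *\<^sub>R ?F (exp (- \<theta>) - 1)) =
        exp (a * \<theta>) * (cosh \<theta> - 1) powr (- m - 1/2)"
      unfolding s(2) by (simp add: mult_ac)
  qed
qed

lemma half_angle_values:
  fixes b \<eta> :: real
  assumes b: "b < pi" and \<eta>: "0 < \<eta>" "\<eta> < b"
  shows "0 < sin (\<eta>/2)" and "sin (\<eta>/2) < sin (b/2)" and "0 < cos (b/2)" and "cos (b/2) < cos (\<eta>/2)"
  using b \<eta> by (auto intro!: sin_gt_zero sin_monotone_2pi cos_gt_zero_pi cos_monotone_0_pi)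

lemma bij_betw_sin_half:
  assumes b: "0 < b" "b < pi"
  shows "bij_betw (\<lambda>\<eta>. (sin (\<eta>/2) / sin (b/2))\<^sup>2) {0<..<b} {0<..<1}"
proof (rule bij_betw_byWitness[where f' = "\<lambda>r. 2 * arcsin (sqrt r * sin (b/2))"])
  let ?g = "\<lambda>\<eta>. (sin (\<eta>/2) / sin (b/2))\<^sup>2"
  have B: "0 < sin (b/2)" "sin (b/2) \<le> 1" "arcsin (sin (b/2)) = b/2"
    using b sin_gt_zero[of "b/2"] arcsin_sin[of "b/2"] by simp_all
  have r: "0 < sqrt r * sin (b/2)" "sqrt r * sin (b/2) < sin (b/2)" if "r \<in> {0<..<1}" for r
    using that B by auto
  show "\<forall>\<eta>\<in>{0<..<b}. 2 * arcsin (sqrt (?g \<eta>) * sin (b/2)) = \<eta>"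
  proof
    fix \<eta> assume "\<eta> \<in> {0<..<b}"
    then have "sin (\<eta>/2) > 0" "arcsin (sin (\<eta>/2)) = \<eta>/2"
      using half_angle_values(1)[OF b(2), of \<eta>] arcsin_sin[of "\<eta>/2"] b by simp_all
    then show "2 * arcsin (sqrt (?g \<eta>) * sin (b/2)) = \<eta>" using B by simp
  qed
  show "\<forall>r\<in>{0<..<1}. ?g (2 * arcsin (sqrt r * sin (b/2))) = r"
  proof
    fix r :: real assume r': "r \<in> {0<..<1}"
    then have "sin (arcsin (sqrt r * sin (b/2))) = sqrt r * sin (b/2)"
      using r[OF r'] B by (intro sin_arcsin) linarith+
    then show "?g (2 * arcsin (sqrt r * sin (b/2))) = r" using r' B by simp
  qed
  show "?g ` {0<..<b} \<subseteq> {0<..<1}"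
  proof
    fix v assume "v \<in> ?g ` {0<..<b}"
    then obtain \<eta> where v: "v = ?g \<eta>" and \<eta>: "0 < \<eta>" "\<eta> < b" by auto
    then have "0 < sin (\<eta>/2) / sin (b/2)" "sin (\<eta>/2) / sin (b/2) < 1"
      using half_angle_values[OF b(2) \<eta>] B by auto
    then show "v \<in> {0<..<1}"
      unfolding v by (simp only: greaterThanLessThan_iff power_less_one_iff zero_less_power) simp
  qed
  show "(\<lambda>r. 2 * arcsin (sqrt r * sin (b/2))) ` {0<..<1} \<subseteq> {0<..<b}"
  proof
    fix \<eta> assume "\<eta> \<in> (\<lambda>r. 2 * arcsin (sqrt r * sin (b/2))) ` {0<..<1}"
    then obtain r where r': "r \<in> {0<..<1}" and \<eta>: "\<eta> = 2 * arcsin (sqrt r * sin (b/2))" by auto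
    show "\<eta> \<in> {0<..<b}"
      using arcsin_less_arcsin[of 0 "sqrt r * sin (b/2)"] arcsin_less_arcsin[of "sqrt r * sin (b/2)" "sin (b/2)"]
        r[OF r'] B \<eta> by auto
  qed
qed

lemma set_integral_sin_half_substitution:
  fixes f :: "real \<Rightarrow> 'b::euclidean_space"
  assumes b: "0 < b" "b < pi" and f: "continuous_on {0<..<1} f" "set_integrable lborel {0<..<1} f"
  defines "F \<equiv> \<lambda>\<eta>. (sin (\<eta>/2) * cos (\<eta>/2) / (sin (b/2))\<^sup>2) *\<^sub>R f ((sin (\<eta>/2) / sin (b/2))\<^sup>2)"
  shows "set_integrable lborel {0<..<b} F"
    and "(LINT \<eta>:{0<..<b}|lborel. F \<eta>) = (LINT r:{0<..<1}|lborel. f r)"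
proof -
  let ?g = "\<lambda>\<eta>. (sin (\<eta>/2) / sin (b/2))\<^sup>2"
  let ?g' = "\<lambda>\<eta>. sin (\<eta>/2) * cos (\<eta>/2) / (sin (b/2))\<^sup>2"
  have B: "0 < sin (b/2)" using b by (intro sin_gt_zero) auto
  have deriv: "(?g has_field_derivative ?g' \<eta>) (at \<eta>)" for \<eta>
    using B by (auto intro!: derivative_eq_intros simp: power2_eq_square field_simps)
  have "continuous_on {0<..<b} ?g'"
    using B by (intro continuous_intros) auto
  note sub = set_integral_substitution[OF bij_betw_sin_half[OF b] deriv this f borel_open borel_open,
      OF open_greaterThanLessThan open_greaterThanLessThan]
  have F: "\<bar>?g' \<eta>\<bar> *\<^sub>R f (?g \<eta>) = F \<eta>" if "\<eta> \<in> {0<..<b}" for \<eta>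
    using that half_angle_values[OF b(2), of \<eta>] by (simp add: F_def)
  show "set_integrable lborel {0<..<b} F"
    by (rule set_integrable_eq_on[OF sub(1) F])
  show "(LINT \<eta>:{0<..<b}|lborel. F \<eta>) = (LINT r:{0<..<1}|lborel. f r)"
    unfolding sub(2)[symmetric] by (rule set_integral_cong) (rule F[symmetric])
qed

lemma Beta_weight_sin_half:
  assumes b: "b < pi" and \<eta>: "0 < \<eta>" "\<eta> < b"
  shows "sin (\<eta>/2) * cos (\<eta>/2) / (sin (b/2))\<^sup>2 * Beta_weight (1/2) (1/2 - m) ((sin (\<eta>/2) / sin (b/2))\<^sup>2) =
    2 powr (m + 1/2) * sin (b/2) powr (2 * m) * ((cos \<eta> - cos b) powr (- m - 1/2) * cos (\<eta>/2))"
proof -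
  define S B C where "S = sin (\<eta>/2)" "B = sin (b/2)" "C = cos (\<eta>/2)"
  note defs = S_B_C_def
  have pos: "0 < S" "S < B"
    using half_angle_values[OF b \<eta>] by (auto simp: defs)
  have "cos \<eta> = 1 - 2 * S\<^sup>2" "cos b = 1 - 2 * B\<^sup>2"
    using cos_double_sin[of "\<eta>/2"] cos_double_sin[of "b/2"] by (simp_all add: defs)
  then have "cos \<eta> - cos b = 2 * (B powr 2) * (1 - (S / B)\<^sup>2)"
    using pos by (simp add: power_divide right_diff_distrib)
  then have "(cos \<eta> - cos b) powr (- m - 1/2) = 2 powr (- m - 1/2) * B powr (- 2 * m - 1) * (1 - (S / B)\<^sup>2) powr (- m - 1/2)"
    by (simp only: powr_mult powr_powr) (simp add: algebra_simps)
  moreover have "B powr (- 2 * m - 1) = B powr (- (2 * m)) * B powr (- 1)" "2 powr (- m - 1/2) = (2::real) powr (- (m + 1/2))"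
    unfolding powr_add[symmetric] by simp_all
  ultimately have weight: "(1 - (S / B)\<^sup>2) powr (- m - 1/2) = 2 powr (m + 1/2) * B powr (2 * m) * (B * (cos \<eta> - cos b) powr (- m - 1/2))"
    using pos by (simp only: powr_minus) (simp add: field_simps)
  have "((S / B)\<^sup>2) powr (- 1/2) = inverse (((S / B)\<^sup>2) powr (1/2))"
    using powr_minus[of "(S / B)\<^sup>2" "1/2"] by simp
  also have "\<dots> = B / S"
    using pos by (simp add: powr_half_sqrt)
  finally have "Beta_weight (1/2) (1/2 - m) ((S / B)\<^sup>2) = B / S * (1 - (S / B)\<^sup>2) powr (- m - 1/2)"
    by (simp add: Beta_weight_real minus_diff_commute[of m])
  then show ?thesis
    unfolding defs(1-3)[symmetric] weight using pos by (simp add: power2_eq_square)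
qed

lemma set_integrable_cos_minus_cos_powr:
  assumes b: "0 < b" "b < pi" and m: "m < 1/2"
  shows "set_integrable lborel {- b<..<b} (\<lambda>\<eta>. (cos \<eta> - cos b) powr (- m - 1/2))"
proof -
  let ?p = "\<lambda>\<eta>. (cos \<eta> - cos b) powr (- m - 1/2)"
  let ?K = "2 powr (m + 1/2) * sin (b/2) powr (2 * m)"
  have "sin (b/2) > 0" using b by (intro sin_gt_zero) auto
  then have K: "?K > 0" by simp
  have "set_integrable lborel {0<..<b} (\<lambda>\<eta>. (sin (\<eta>/2) * cos (\<eta>/2) / (sin (b/2))\<^sup>2) *\<^sub>R
      Beta_weight (1/2) (1/2 - m) ((sin (\<eta>/2) / sin (b/2))\<^sup>2))"
    by (intro set_integral_sin_half_substitution(1)[OF b] continuous_on_Beta_weight_real set_integrable_Beta_weight_real) (use m in auto)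
  then have "set_integrable lborel {0<..<b} (\<lambda>\<eta>. ?K * (?p \<eta> * cos (\<eta>/2)))"
    by (rule set_integrable_eq_on) (use Beta_weight_sin_half[OF b(2)] in simp)
  then have "set_integrable lborel {0<..<b} (\<lambda>\<eta>. ?p \<eta> * cos (\<eta>/2))"
    using K by (subst (asm) set_integrable_mult_right_iff) auto
  then have "set_integrable lborel {0<..<b} (\<lambda>\<eta>. (?p \<eta> * cos (\<eta>/2)) * (1 / cos (\<eta>/2)))"
  proof (rule set_integrable_mult_bounded_continuous[rotated])
    show "continuous_on {0<..<b} (\<lambda>\<eta>. 1 / cos (\<eta>/2))"
      by (intro continuous_intros ballI less_imp_neq[symmetric] order_less_trans[OF half_angle_values(3,4)[OF b(2)]]) auto
    show "norm (1 / cos (\<eta>/2)) \<le> 1 / cos (b/2)" if "\<eta> \<in> {0<..<b}" for \<eta>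
      using that half_angle_values[OF b(2), of \<eta>] by (auto intro!: divide_left_mono)
  qed auto
  then have half: "set_integrable lborel {0<..<b} ?p"
    by (rule set_integrable_eq_on) (use half_angle_values[OF b(2)] in force)
  then have "set_integrable lborel {- b<..<0} ?p"
    using set_integrable_reflect[of "{0<..<b}" ?p] by simp
  moreover have "set_integrable lborel {0} ?p"
    by (rule set_borel_integrable_singleton)
  ultimately have "set_integrable lborel ({- b<..<0} \<union> {0} \<union> {0<..<b}) ?p"
    using half by (intro set_integrable_Un) auto
  moreover have "{- b<..<0} \<union> {0} \<union> {0<..<b} = {- b<..<b}" using b by auto
  ultimately show ?thesis by simp
qed

lemma mehler_kernel_horizontal_limit:
  assumes m: "- 1/2 < m" "m < 0" and \<nu>: "Re \<nu> > - 1/2" and b: "0 < b" "b < pi"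
    and d: "\<And>n. \<bar>d n\<bar> < b" "d \<longlonglongrightarrow> c" "\<bar>c\<bar> = b"
  shows "(\<lambda>n. integral {- (real n + 1)..- (1 / (real n + 2))} (\<lambda>\<theta>. mehler_kernel b m \<nu> (of_real \<theta> + \<i> * of_real (d n))))
     \<longlonglongrightarrow> (LINT \<theta>:{..<0}|lborel. mehler_kernel b m \<nu> (of_real \<theta> + \<i> * of_real c))"
proof (rule integral_Icc_tendsto_set_integral)
  let ?g = "\<lambda>\<theta>. exp (\<bar>Im \<nu>\<bar> * b) * (exp ((Re \<nu> + 1/2) * \<theta>) * (cosh \<theta> - 1) powr (- m - 1/2))"
  show Icc: "{- (real n + 1)..- (1 / (real n + 2))} \<subseteq> {..<0}" for n
    by (auto intro: le_less_trans)
  have strip: "of_real \<theta> + \<i> * of_real (d n) \<in> mehler_strip b" for \<theta> n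
    using d(1)[of n] by (simp add: mehler_strip_def)
  show "continuous_on {- (real n + 1)..- (1 / (real n + 2))} (\<lambda>\<theta>. mehler_kernel b m \<nu> (of_real \<theta> + \<i> * of_real (d n)))" for n
    by (intro continuous_on_mehler_kernel_compose[OF b] continuous_intros strip)
  show "set_integrable lborel {..<0} ?g"
    by (intro set_integrable_mult_right set_integrable_exp_mult_cosh_powr) (use m \<nu> in auto)
  show "norm (mehler_kernel b m \<nu> (of_real \<theta> + \<i> * of_real (d n))) \<le> ?g \<theta>"
    if "\<theta> \<in> {- (real n + 1)..- (1 / (real n + 2))}" for n \<theta>
  proof -
    have "cosh \<theta> > 1"
      using subsetD[OF Icc that] cosh_real_ge_1[of \<theta>] by (auto simp: order.strict_iff_order)
    then show ?thesis
      using norm_mehler_kernel_le[of "of_real \<theta> + \<i> * of_real (d n)" b m "cosh \<theta> - 1" \<nu>]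
        norm_cosh_minus_cos_ge_cosh[of "of_real \<theta> + \<i> * of_real (d n)" b] d(1)[of n] m by simp
  qed
  show "\<forall>\<^sub>F n in sequentially. \<theta> \<in> {- (real n + 1)..- (1 / (real n + 2))}" if "\<theta> \<in> {..<0}" for \<theta>
  proof -
    have "\<theta> < 0" using that by simp
    then have "\<forall>\<^sub>F n in sequentially. \<theta> \<le> - (1 / (real n + 2))" "\<forall>\<^sub>F n in sequentially. - (real n + 1) \<le> \<theta>"
      by real_asymp+
    then show ?thesis by eventually_elim simp
  qed
  show "(\<lambda>n. mehler_kernel b m \<nu> (of_real \<theta> + \<i> * of_real (d n))) \<longlonglongrightarrow> mehler_kernel b m \<nu> (of_real \<theta> + \<i> * of_real c)"
    if "\<theta> \<in> {..<0}" for \<theta>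
    by (rule mehler_kernel_tendsto[OF b _ strip]) (use that d in \<open>auto simp: mehler_strip_def intro!: tendsto_intros\<close>)
qed simp

lemma mehler_kernel_vertical_limit:
  assumes m: "- 1/2 < m" "m < 1/2" and \<nu>: "Re \<nu> > - 1/2" and b: "0 < b" "b < pi"
    and d: "\<And>n. 0 < d n" "\<And>n. d n < b" "d \<longlonglongrightarrow> b" and h: "\<And>n. h n > 0"
    and lim: "\<And>\<eta>. \<bar>\<eta>\<bar> < b \<Longrightarrow> (\<lambda>n. mehler_kernel b m \<nu> (of_real (- h n) + \<i> * of_real \<eta>)) \<longlonglongrightarrow> F \<eta>"
  shows "(\<lambda>n. integral {- d n..d n} (\<lambda>\<eta>. \<i> * mehler_kernel b m \<nu> (of_real (- h n) + \<i> * of_real \<eta>)))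
     \<longlonglongrightarrow> (LINT \<eta>:{- b<..<b}|lborel. \<i> * F \<eta>)"
proof (rule integral_Icc_tendsto_set_integral)
  let ?g = "\<lambda>\<eta>. exp (\<bar>Im \<nu>\<bar> * b) * (cos \<eta> - cos b) powr (- m - 1/2)"
  have abs_less: "\<bar>\<eta>\<bar> < b" if "\<eta> \<in> {- d n..d n}" for \<eta> n
    using that d(2)[of n] by auto
  have strip: "of_real (- h n) + \<i> * of_real \<eta> \<in> mehler_strip b" if "\<eta> \<in> {- d n..d n}" for \<eta> n
    using abs_less[OF that] by (simp add: mehler_strip_def)
  show "{- d n..d n} \<subseteq> {- b<..<b}" for n
    using d(2)[of n] by auto
  show "continuous_on {- d n..d n} (\<lambda>\<eta>. \<i> * mehler_kernel b m \<nu> (of_real (- h n) + \<i> * of_real \<eta>))" for n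
    by (intro continuous_on_mult continuous_on_const continuous_on_mehler_kernel_compose[OF b] continuous_intros strip)
  show "set_integrable lborel {- b<..<b} ?g"
    by (intro set_integrable_mult_right set_integrable_cos_minus_cos_powr b m)
  show "norm (\<i> * mehler_kernel b m \<nu> (of_real (- h n) + \<i> * of_real \<eta>)) \<le> ?g \<eta>" if "\<eta> \<in> {- d n..d n}" for n \<eta>
    using norm_mehler_kernel_le_cos(2)[OF b(2), of "of_real (- h n) + \<i> * of_real \<eta>" m \<nu>] abs_less[OF that] m \<nu> h[of n]
    by (simp add: norm_mult)
  show "\<forall>\<^sub>F n in sequentially. \<eta> \<in> {- d n..d n}" if "\<eta> \<in> {- b<..<b}" for \<eta>
  proof -
    have "\<forall>\<^sub>F n in sequentially. \<bar>\<eta>\<bar> < d n"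
      using that by (intro order_tendstoD(1)[OF d(3)]) auto
    then show ?thesis by eventually_elim auto
  qed
  show "(\<lambda>n. \<i> * mehler_kernel b m \<nu> (of_real (- h n) + \<i> * of_real \<eta>)) \<longlonglongrightarrow> \<i> * F \<eta>" if "\<eta> \<in> {- b<..<b}" for \<eta>
    by (intro tendsto_intros lim) (use that in auto)
qed simp

lemma mehler_kernel_tendsto_0:
  assumes b: "0 < b" "b < pi" and m: "m > - 1/2" and \<nu>: "Re \<nu> > - 1/2" and \<eta>: "\<bar>\<eta>\<bar> < b"
  shows "(\<lambda>n. mehler_kernel b m \<nu> (of_real (- (real n + 1)) + \<i> * of_real \<eta>)) \<longlonglongrightarrow> 0"
proof (rule Lim_null_comparison)
  let ?t = "\<lambda>n. of_real (- (real n + 1)) + \<i> * complex_of_real \<eta>"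
  let ?K = "exp (\<bar>Im \<nu>\<bar> * b)" and ?p = "(cos \<eta> - cos b) powr (- m - 1/2)"
  have "(\<lambda>n. exp ((Re \<nu> + 1/2) * (- (real n + 1)))) \<longlonglongrightarrow> 0"
    using \<nu> by real_asymp
  then show "(\<lambda>n. ?K * (exp ((Re \<nu> + 1/2) * (- (real n + 1))) * ?p)) \<longlonglongrightarrow> 0"
    by (intro tendsto_mult_right_zero tendsto_mult_left_zero)
  have "norm (mehler_kernel b m \<nu> (?t n)) \<le> ?K * (exp ((Re \<nu> + 1/2) * (- (real n + 1))) * ?p)" for n
    using norm_mehler_kernel_le_cos(1)[OF b(2), of "?t n" m \<nu>] \<eta> m \<nu> by simp
  then show "\<forall>\<^sub>F n in sequentially. norm (mehler_kernel b m \<nu> (?t n)) \<le> ?K * (exp ((Re \<nu> + 1/2) * (- (real n + 1))) * ?p)"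
    by simp
qed

lemma mehler_kernel_tendsto_imaginary:
  assumes b: "0 < b" "b < pi" and \<eta>: "\<bar>\<eta>\<bar> < b" and x: "x \<longlonglongrightarrow> 0"
  shows "(\<lambda>n. mehler_kernel b m \<nu> (of_real (x n) + \<i> * of_real \<eta>)) \<longlonglongrightarrow> mehler_kernel b m \<nu> (\<i> * of_real \<eta>)"
proof -
  have strip: "of_real y + \<i> * of_real \<eta> \<in> mehler_strip b" for y
    using \<eta> by (simp add: mehler_strip_def)
  have "(\<lambda>n. of_real (x n) + \<i> * complex_of_real \<eta>) \<longlonglongrightarrow> of_real 0 + \<i> * of_real \<eta>"
    by (intro tendsto_intros x)
  from mehler_kernel_tendsto[OF b this strip strip] show ?thesis
    by (simp only: of_real_0 add_0)
qed

lemma mehler_kernel_strip_identity: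
  assumes m: "- 1/2 < m" "m < 0" and \<nu>: "Re \<nu> > - 1/2" and b: "0 < b" "b < pi"
  shows "(LINT \<theta>:{..<0}|lborel. mehler_kernel b m \<nu> (of_real \<theta> + \<i> * of_real b)) -
         (LINT \<theta>:{..<0}|lborel. mehler_kernel b m \<nu> (of_real \<theta> + \<i> * of_real (- b))) =
         \<i> * (LINT \<eta>:{- b<..<b}|lborel. mehler_kernel b m \<nu> (\<i> * of_real \<eta>))"
proof -
  define d where "d n = b - b / (real n + 2)" for n
  have "0 < b / (real n + 2)" "b / (real n + 2) < b" for n
    using b(1) by (auto simp: field_simps add_pos_nonneg)
  then have d: "0 < d n" "d n < b" for n by (simp_all add: d_def)
  have "(\<lambda>n. b - b / (real n + 2)) \<longlonglongrightarrow> b" by real_asymp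
  then have lim: "d \<longlonglongrightarrow> b" by (simp add: d_def[abs_def])
  let ?H = "\<lambda>s n. integral {- (real n + 1)..- (1 / (real n + 2))} (\<lambda>\<theta>. mehler_kernel b m \<nu> (of_real \<theta> + \<i> * of_real (s n)))"
  let ?V = "\<lambda>h n. integral {- d n..d n} (\<lambda>\<eta>. \<i> * mehler_kernel b m \<nu> (of_real (- h n) + \<i> * of_real \<eta>))"
  have horizontal: "?H d \<longlonglongrightarrow> (LINT \<theta>:{..<0}|lborel. mehler_kernel b m \<nu> (of_real \<theta> + \<i> * of_real b))"
      "?H (\<lambda>n. - d n) \<longlonglongrightarrow> (LINT \<theta>:{..<0}|lborel. mehler_kernel b m \<nu> (of_real \<theta> + \<i> * of_real (- b)))"
    by (rule mehler_kernel_horizontal_limit[OF m \<nu> b]; use d b lim in \<open>simp add: abs_of_pos tendsto_minus\<close>)+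
  have near: "?V (\<lambda>n. 1 / (real n + 2)) \<longlonglongrightarrow> (LINT \<eta>:{- b<..<b}|lborel. \<i> * mehler_kernel b m \<nu> (\<i> * of_real \<eta>))"
  proof (rule mehler_kernel_vertical_limit[OF m(1) _ \<nu> b d lim])
    show "(\<lambda>n. mehler_kernel b m \<nu> (of_real (- (1 / (real n + 2))) + \<i> * of_real \<eta>)) \<longlonglongrightarrow> mehler_kernel b m \<nu> (\<i> * of_real \<eta>)"
      if "\<bar>\<eta>\<bar> < b" for \<eta>
      by (rule mehler_kernel_tendsto_imaginary[OF b that]) real_asymp
  qed (use m in auto)
  have far: "?V (\<lambda>n. real n + 1) \<longlonglongrightarrow> (LINT \<eta>:{- b<..<b}|lborel. \<i> * 0)"
    by (rule mehler_kernel_vertical_limit[OF m(1) _ \<nu> b d lim _ mehler_kernel_tendsto_0[OF b m(1) \<nu>]]) (use m in auto)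
  have "?H d n - ?H (\<lambda>n. - d n) n = ?V (\<lambda>n. 1 / (real n + 2)) n - ?V (\<lambda>n. real n + 1) n" for n
    by (rule mehler_kernel_rectangle[OF b d[of n]]) (auto simp: field_simps intro: add_pos_nonneg)
  then have "(\<lambda>n. ?H d n - ?H (\<lambda>n. - d n) n) = (\<lambda>n. ?V (\<lambda>n. 1 / (real n + 2)) n - ?V (\<lambda>n. real n + 1) n)"
    by blast
  with tendsto_diff[OF horizontal] have "(\<lambda>n. ?V (\<lambda>n. 1 / (real n + 2)) n - ?V (\<lambda>n. real n + 1) n) \<longlonglongrightarrow>
      (LINT \<theta>:{..<0}|lborel. mehler_kernel b m \<nu> (of_real \<theta> + \<i> * of_real b)) -
      (LINT \<theta>:{..<0}|lborel. mehler_kernel b m \<nu> (of_real \<theta> + \<i> * of_real (- b)))"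
    by (simp only:)
  from LIMSEQ_unique[OF this tendsto_diff[OF near far]] show ?thesis
    by (simp only: set_integral_mult_right) simp
qed

lemma mehler_kernel_imaginary:
  assumes "cos b < cos \<eta>"
  shows "mehler_kernel b m \<nu> (\<i> * of_real \<eta>) = exp (\<i> * ((\<nu> + 1/2) * of_real \<eta>)) * of_real ((cos \<eta> - cos b) powr (- m - 1/2))"
proof -
  have "cosh (\<i> * of_real \<eta>) - of_real (cos b) = complex_of_real (cos \<eta> - cos b)"
    by (simp add: cosh_conv_cos mult.assoc[symmetric] cos_of_real)
  moreover have "complex_of_real (cos \<eta> - cos b) powr of_real (- m - 1/2) = of_real ((cos \<eta> - cos b) powr (- m - 1/2))"
    by (rule powr_of_real) (use assms in simp)
  ultimately show ?thesis unfolding mehler_kernel_def by (simp add: mult_ac)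
qed

lemma set_integral_symmetric:
  fixes f :: "real \<Rightarrow> 'b::euclidean_space"
  assumes "b > 0" and f: "set_integrable lborel {- b<..<b} f"
  shows "(LINT x:{- b<..<b}|lborel. f x) = (LINT x:{0<..<b}|lborel. f x + f (- x))"
proof -
  have neg: "set_integrable lborel {- b<..<0} f" and pos: "set_integrable lborel {0<..<b} f"
    by (rule set_integrable_subset[OF f]; use assms(1) in auto)+
  have "{x. - x \<in> {- b<..<0}} = {0<..<b}" by auto
  then have reflect: "(LINT x:{- b<..<0}|lborel. f x) = (LINT x:{0<..<b}|lborel. f (- x))"
    using set_integral_reflect[of "{- b<..<0}" f] by simp
  have reflect_int: "set_integrable lborel {0<..<b} (\<lambda>x. f (- x))"
    using set_integrable_reflect[of "{- b<..<0}" f] neg by simp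
  have "(LINT x:{- b<..<b}|lborel. f x) = (LINT x:{- b<..<0} \<union> {0<..<b}|lborel. f x)"
    by (rule set_integral_discrete_difference[of "{0}"]) auto
  also have "\<dots> = (LINT x:{- b<..<0}|lborel. f x) + (LINT x:{0<..<b}|lborel. f x)"
    by (rule set_integral_Un[OF _ neg pos]) auto
  finally show ?thesis
    unfolding reflect set_integral_add(2)[OF pos reflect_int] by simp
qed

lemma mehler_kernel_imaginary_integral:
  assumes m: "\<bar>m\<bar> < 1/2" and \<nu>: "Re \<nu> \<ge> - 1/2" and b: "0 < b" "b < pi"
  shows "(LINT \<eta>:{- b<..<b}|lborel. mehler_kernel b m \<nu> (\<i> * of_real \<eta>)) =
    2 * (LINT \<eta>:{0<..<b}|lborel. cos ((\<nu> + 1/2) * of_real \<eta>) * of_real ((cos \<eta> - cos b) powr (- m - 1/2)))"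
proof -
  have "set_integrable lborel {- b<..<b} (\<lambda>\<eta>. mehler_kernel b m \<nu> (\<i> * of_real \<eta>))"
  proof (rule set_integrable_bound_continuous)
    show "set_integrable lborel {- b<..<b} (\<lambda>\<eta>. exp (\<bar>Im \<nu>\<bar> * b) * (cos \<eta> - cos b) powr (- m - 1/2))"
      by (intro set_integrable_mult_right set_integrable_cos_minus_cos_powr b) (use m in auto)
    show "continuous_on {- b<..<b} (\<lambda>\<eta>. mehler_kernel b m \<nu> (\<i> * of_real \<eta>))"
      by (intro continuous_on_mehler_kernel_compose[OF b] continuous_intros) (auto simp: mehler_strip_def)
    show "norm (mehler_kernel b m \<nu> (\<i> * of_real \<eta>)) \<le> exp (\<bar>Im \<nu>\<bar> * b) * (cos \<eta> - cos b) powr (- m - 1/2)"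
      if "\<eta> \<in> {- b<..<b}" for \<eta>
      using norm_mehler_kernel_le_cos(2)[OF b(2), of "\<i> * of_real \<eta>" m \<nu>] that m \<nu> by auto
  qed simp
  then have "(LINT \<eta>:{- b<..<b}|lborel. mehler_kernel b m \<nu> (\<i> * of_real \<eta>)) =
      (LINT \<eta>:{0<..<b}|lborel. mehler_kernel b m \<nu> (\<i> * of_real \<eta>) + mehler_kernel b m \<nu> (\<i> * of_real (- \<eta>)))"
    by (rule set_integral_symmetric[OF b(1)])
  also have "\<dots> = (LINT \<eta>:{0<..<b}|lborel. 2 * (cos ((\<nu> + 1/2) * of_real \<eta>) * of_real ((cos \<eta> - cos b) powr (- m - 1/2))))"
  proof (rule set_integral_cong)
    fix \<eta> assume "\<eta> \<in> {0<..<b}"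
    then have "cos b < cos \<eta>" "cos b < cos (- \<eta>)"
      using cos_less_cos_abs[OF b(2)] by auto
    then show "mehler_kernel b m \<nu> (\<i> * of_real \<eta>) + mehler_kernel b m \<nu> (\<i> * of_real (- \<eta>)) =
        2 * (cos ((\<nu> + 1/2) * of_real \<eta>) * of_real ((cos \<eta> - cos b) powr (- m - 1/2)))"
      unfolding mehler_kernel_imaginary[OF \<open>cos b < cos \<eta>\<close>] mehler_kernel_imaginary[OF \<open>cos b < cos (- \<eta>)\<close>]
      by (simp add: cos_exp_eq algebra_simps)
  qed
  finally show ?thesis
    by (simp only: set_integral_mult_right)
qed

section \<open>The regularised hypergeometric series\<close>

lemma set_integral_sums:
  fixes f :: "nat \<Rightarrow> 'a \<Rightarrow> 'b::{banach, second_countable_topology}"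
  assumes int: "\<And>n. set_integrable M A (f n)"
    and bound: "\<And>n x. x \<in> A \<Longrightarrow> norm (f n x) \<le> h n * g x" and g: "set_integrable M A g"
    and h: "summable h"
  shows "(\<lambda>n. LINT x:A|M. f n x) sums (LINT x:A|M. \<Sum>n. f n x)"
proof -
  let ?f = "\<lambda>n x. indicator A x *\<^sub>R f n x" and ?g = "\<lambda>x. indicator A x *\<^sub>R g x"
  have le: "norm (?f n x) \<le> h n * ?g x" for n x
    using bound[of x n] by (simp add: indicator_def)
  have g': "integrable M ?g" using g by (simp add: set_integrable_def)
  have "(\<lambda>n. integral\<^sup>L M (?f n)) sums (\<integral>x. (\<Sum>n. ?f n x) \<partial>M)"
  proof (rule sums_integral)
    show "integrable M (?f n)" for n using int[of n] by (simp add: set_integrable_def)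
    show "AE x in M. summable (\<lambda>n. norm (?f n x))"
      by (intro AE_I2 summable_comparison_test'[OF summable_mult2[OF h]]) (use le in simp)
    have "(\<integral>x. norm (?f n x) \<partial>M) \<le> (\<integral>x. h n * ?g x \<partial>M)" for n
      using int[of n] g' by (intro integral_mono le integrable_norm integrable_mult_right) (simp_all add: set_integrable_def)
    then show "summable (\<lambda>n. \<integral>x. norm (?f n x) \<partial>M)"
      by (intro summable_comparison_test'[OF summable_mult2[OF h, of "integral\<^sup>L M ?g"]]) simp
  qed
  moreover have "(\<Sum>n. ?f n x) = indicator A x *\<^sub>R (\<Sum>n. f n x)" for x
    by (simp add: indicator_def)
  ultimately show ?thesis
    by (simp add: set_lebesgue_integral_def)
qed

definition hyp2F1_reg_coeff :: "complex \<Rightarrow> complex \<Rightarrow> complex \<Rightarrow> nat \<Rightarrow> complex" where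
  "hyp2F1_reg_coeff a b c n = pochhammer a n * pochhammer b n / fact n * rGamma (c + of_nat n)"

lemma hyp2F1_reg_coeff_Suc:
  "of_nat (Suc n) * (c + of_nat n) * hyp2F1_reg_coeff a b c (Suc n) =
     (a + of_nat n) * (b + of_nat n) * hyp2F1_reg_coeff a b c n"
proof -
  let ?R = "\<lambda>n. pochhammer a n * pochhammer b n / fact n"
  have "of_nat (Suc n) * (c + of_nat n) * hyp2F1_reg_coeff a b c (Suc n) =
      (of_nat (Suc n) * ?R (Suc n)) * ((c + of_nat n) * rGamma (c + of_nat (Suc n)))"
    by (simp only: hyp2F1_reg_coeff_def mult_ac)
  also have "of_nat (Suc n) * ?R (Suc n) = (a + of_nat n) * (b + of_nat n) * ?R n"
    by (simp add: pochhammer_Suc mult_ac del: of_nat_Suc)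
  also have "(c + of_nat n) * rGamma (c + of_nat (Suc n)) = rGamma (c + of_nat n)"
    using rGamma_plus1[of "c + of_nat n"] by (simp add: add_ac)
  finally show ?thesis
    by (simp only: hyp2F1_reg_coeff_def mult_ac)
qed

lemma hyp2F1_reg_coeff_plus1:
  "hyp2F1_reg_coeff a b c n = (c + of_nat n) * hyp2F1_reg_coeff a b (c + 1) n"
  using rGamma_plus1[of "c + of_nat n"] by (simp add: hyp2F1_reg_coeff_def add_ac)

lemma summable_hypergeometric_majorant:
  fixes a b :: "'a :: real_normed_field"
  assumes r: "0 \<le> r" "r < 1"
  shows "summable (\<lambda>n. norm (pochhammer a n * pochhammer b n) / (fact n * fact (n - k)) * r ^ n)"
proof -
  let ?f = "\<lambda>n. norm (pochhammer a n * pochhammer b n) / (fact n * fact (n - k)) * r ^ n"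
  define q where "q n = (norm a + real n) * (norm b + real n) * r / ((real n + 1) * (real n + 1 - real k))" for n
  have "(\<lambda>n. (norm a + real n) * (norm b + real n) * r / ((real n + 1) * (real n + 1 - real k))) \<longlonglongrightarrow> r"
    by real_asymp
  then have "\<forall>\<^sub>F n in sequentially. q n < (1 + r) / 2"
    unfolding q_def using r by (intro order_tendstoD(2)) auto
  then obtain N where N: "\<And>n. n \<ge> N \<Longrightarrow> q n < (1 + r) / 2"
    by (auto simp: eventually_sequentially)
  show ?thesis
  proof (rule summable_ratio_test[of "(1 + r) / 2" "max N k"])
    fix n assume n: "max N k \<le> n"
    have "fact (Suc n - k) = (real n + 1 - real k) * fact (n - k)"
      using n by (simp add: Suc_diff_le of_nat_diff)
    then have step: "?f (Suc n) = norm (a + of_nat n) * norm (b + of_nat n) * r / ((real n + 1) * (real n + 1 - real k)) * ?f n"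
      by (simp add: pochhammer_Suc norm_mult mult_ac add_ac)
    have "norm (a + of_nat n) * norm (b + of_nat n) \<le> (norm a + real n) * (norm b + real n)"
      using norm_triangle_ineq[of a "of_nat n"] norm_triangle_ineq[of b "of_nat n"] by (intro mult_mono) auto
    then have "?f (Suc n) \<le> q n * ?f n"
      unfolding step q_def using n r by (intro mult_right_mono divide_right_mono) auto
    also have "\<dots> \<le> (1 + r) / 2 * ?f n"
      using N[of n] n r by (intro mult_right_mono) auto
    finally show "norm (?f (Suc n)) \<le> (1 + r) / 2 * norm (?f n)"
      using r by simp
  qed (use r in auto)
qed

lemma norm_pochhammer_ge_fact:
  fixes z :: complex
  assumes "Re z \<ge> 1"
  shows "norm (pochhammer z n) \<ge> fact n"
proof (induction n)
  case (Suc n)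
  have "real (Suc n) \<le> Re (z + of_nat n)" using assms by simp
  also have "\<dots> \<le> norm (z + of_nat n)" by (rule complex_Re_le_cmod)
  finally have "fact n * real (Suc n) \<le> norm (pochhammer z n) * norm (z + of_nat n)"
    using Suc by (intro mult_mono) auto
  then show ?case unfolding pochhammer_Suc norm_mult fact_Suc by (simp only: mult.commute)
qed simp

lemma rGamma_shift_locally_bounded:
  fixes c :: complex
  obtains C k where "C \<ge> 0" "\<And>z n. z \<in> cball c 1 \<Longrightarrow> n \<ge> k \<Longrightarrow> norm (rGamma (z + of_nat n)) \<le> C / fact (n - k)"
proof -
  obtain k :: nat where k: "real k \<ge> norm c + 2" using real_arch_simple by blast
  have "continuous_on (cball c 1) (\<lambda>z. rGamma (z + of_nat k))"
    by (intro holomorphic_on_imp_continuous_on holomorphic_intros)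
  then have "compact ((\<lambda>z. rGamma (z + of_nat k)) ` cball c 1)"
    by (rule compact_continuous_image) (rule compact_cball)
  then obtain C where C: "\<And>z. z \<in> cball c 1 \<Longrightarrow> norm (rGamma (z + of_nat k)) \<le> C"
    by (metis compact_imp_bounded bounded_iff imageI)
  show ?thesis
  proof (rule that)
    show "C \<ge> 0" using order_trans[OF norm_ge_zero C[of c]] by simp
    fix z n assume z: "z \<in> cball c 1" and n: "n \<ge> k"
    have "\<bar>Re z\<bar> \<le> norm c + 1"
      using abs_Re_le_cmod[of z] norm_triangle_sub[of z c] z by (simp add: dist_norm norm_minus_commute)
    then have "fact (n - k) \<le> norm (pochhammer (z + of_nat k) (n - k))"
      using k by (intro norm_pochhammer_ge_fact) auto
    then have "fact (n - k) * norm (rGamma (z + of_nat n)) \<le> norm (pochhammer (z + of_nat k) (n - k) * rGamma (z + of_nat n))"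
      unfolding norm_mult by (rule mult_right_mono) simp
    also have "pochhammer (z + of_nat k) (n - k) * rGamma (z + of_nat n) = rGamma (z + of_nat k)"
      using pochhammer_rGamma[of "z + of_nat k" "n - k"] n by (simp add: add.assoc)
    also have "norm (rGamma (z + of_nat k)) \<le> C" by (rule C[OF z])
    finally show "norm (rGamma (z + of_nat n)) \<le> C / fact (n - k)"
      by (simp add: pos_le_divide_eq mult.commute)
  qed
qed

lemma hyp2F1_reg_coeff_locally_bounded:
  assumes r: "0 \<le> r" "r < 1"
  obtains h k where "summable h" "\<And>z n. z \<in> cball c 1 \<Longrightarrow> n \<ge> k \<Longrightarrow> norm (hyp2F1_reg_coeff a b z n) * r ^ n \<le> h n"
proof -
  let ?P = "\<lambda>n. norm (pochhammer a n * pochhammer b n)"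
  obtain C k where C: "C \<ge> 0" "\<And>z n. z \<in> cball c 1 \<Longrightarrow> n \<ge> k \<Longrightarrow> norm (rGamma (z + of_nat n)) \<le> C / fact (n - k)"
    by (rule rGamma_shift_locally_bounded[of c]) blast
  show ?thesis
  proof (rule that)
    show "summable (\<lambda>n. C * (?P n / (fact n * fact (n - k)) * r ^ n))"
      by (intro summable_mult summable_hypergeometric_majorant r)
    fix z n assume "z \<in> cball c 1" "n \<ge> k"
    then have "?P n / fact n * r ^ n * norm (rGamma (z + of_nat n)) \<le> ?P n / fact n * r ^ n * (C / fact (n - k))"
      using r by (intro mult_left_mono C(2)) auto
    then show "norm (hyp2F1_reg_coeff a b z n) * r ^ n \<le> C * (?P n / (fact n * fact (n - k)) * r ^ n)"
      by (simp add: hyp2F1_reg_coeff_def norm_mult norm_divide mult_ac)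
  qed
qed

lemma summable_norm_hyp2F1_reg_coeff:
  assumes r: "0 \<le> r" "r < 1"
  shows "summable (\<lambda>n. norm (hyp2F1_reg_coeff a b c n) * r ^ n)"
proof -
  obtain h k where h: "summable h"
      "\<And>z n. z \<in> cball c 1 \<Longrightarrow> n \<ge> k \<Longrightarrow> norm (hyp2F1_reg_coeff a b z n) * r ^ n \<le> h n"
    by (rule hyp2F1_reg_coeff_locally_bounded[OF r]) blast
  show ?thesis
    by (rule summable_comparison_test'[OF h(1), of k]) (use h(2)[of c] r in simp)
qed

lemma hyp2F1_reg_series_sums:
  assumes "norm w < 1"
  shows "(\<lambda>n. hyp2F1_reg_coeff a b c n * w ^ n) sums hyp2F1_reg_series a b c w"
proof -
  have "summable (\<lambda>n. norm (hyp2F1_reg_coeff a b c n * w ^ n))"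
    using summable_norm_hyp2F1_reg_coeff[of "norm w" a b c] assms by (simp add: norm_mult norm_power)
  then show ?thesis
    unfolding hyp2F1_reg_series_def hyp2F1_reg_coeff_def[symmetric] by (rule summable_sums[OF summable_norm_cancel])
qed

lemma hyp2F1_reg_series_holomorphic_param:
  assumes w: "norm w < 1"
  shows "(\<lambda>c. hyp2F1_reg_series a b c w) holomorphic_on UNIV"
proof (rule holomorphic_uniform_sequence[OF open_UNIV])
  show "(\<lambda>c. \<Sum>i<n. hyp2F1_reg_coeff a b c i * w ^ i) holomorphic_on UNIV" for n
    unfolding hyp2F1_reg_coeff_def by (intro holomorphic_intros) auto
  fix c :: complex
  obtain h k where h: "summable h"
      "\<And>z n. z \<in> cball c 1 \<Longrightarrow> n \<ge> k \<Longrightarrow> norm (hyp2F1_reg_coeff a b z n) * norm w ^ n \<le> h n"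
    using hyp2F1_reg_coeff_locally_bounded[OF norm_ge_zero w] by metis
  have "\<forall>\<^sub>F n in sequentially. \<forall>z\<in>cball c 1. norm (hyp2F1_reg_coeff a b z n * w ^ n) \<le> h n"
    unfolding eventually_sequentially norm_mult norm_power using h(2) by blast
  then have "uniform_limit (cball c 1) (\<lambda>n c. \<Sum>i<n. hyp2F1_reg_coeff a b c i * w ^ i)
      (\<lambda>c. hyp2F1_reg_series a b c w) sequentially"
    unfolding hyp2F1_reg_series_def hyp2F1_reg_coeff_def[symmetric] by (rule Weierstrass_m_test_ev[OF _ h(1)])
  then show "\<exists>d>0. cball c d \<subseteq> UNIV \<and>
      uniform_limit (cball c d) (\<lambda>n c. \<Sum>i<n. hyp2F1_reg_coeff a b c i * w ^ i) (\<lambda>c. hyp2F1_reg_series a b c w) sequentially"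
    by (intro exI[of _ 1]) auto
qed

lemma fps_conv_radius_ge_1_intros:
  fixes f g :: "'a :: {banach, real_normed_field} fps"
  assumes "1 \<le> fps_conv_radius f" "1 \<le> fps_conv_radius g"
  shows "1 \<le> fps_conv_radius (f + g)" "1 \<le> fps_conv_radius (f - g)" "1 \<le> fps_conv_radius (f * g)"
  using assms by (simp_all add: order_trans[OF _ fps_conv_radius_add] order_trans[OF _ fps_conv_radius_diff]
      order_trans[OF _ fps_conv_radius_mult])

lemma eval_fps_unit_disc:
  fixes f g :: "'a :: {banach, real_normed_field} fps"
  assumes "1 \<le> fps_conv_radius f" "1 \<le> fps_conv_radius g" "norm w < 1"
  shows "eval_fps (f + g) w = eval_fps f w + eval_fps g w" "eval_fps (f - g) w = eval_fps f w - eval_fps g w"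
    "eval_fps (f * g) w = eval_fps f w * eval_fps g w"
proof -
  have "ereal (norm w) < 1" using assms(3) by (simp add: one_ereal_def)
  from less_le_trans[OF this assms(1)] less_le_trans[OF this assms(2)]
  show "eval_fps (f + g) w = eval_fps f w + eval_fps g w" "eval_fps (f - g) w = eval_fps f w - eval_fps g w"
      "eval_fps (f * g) w = eval_fps f w * eval_fps g w"
    by (simp_all add: eval_fps_add eval_fps_diff eval_fps_mult)
qed

definition hyp2F1_reg_fps :: "complex \<Rightarrow> complex \<Rightarrow> complex \<Rightarrow> complex fps" where
  "hyp2F1_reg_fps a b c = Abs_fps (hyp2F1_reg_coeff a b c)"

lemma eval_hyp2F1_reg_fps: "eval_fps (hyp2F1_reg_fps a b c) = hyp2F1_reg_series a b c"
  by (simp add: fun_eq_iff eval_fps_def hyp2F1_reg_fps_def hyp2F1_reg_series_def hyp2F1_reg_coeff_def)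

lemma fps_conv_radius_hyp2F1_reg: "1 \<le> fps_conv_radius (hyp2F1_reg_fps a b c)"
  unfolding fps_conv_radius_def
proof (rule conv_radius_geI_ex')
  fix r :: real assume "0 < r" "ereal r < 1"
  then have "norm (complex_of_real r) < 1" by (simp add: one_ereal_def)
  from hyp2F1_reg_series_sums[OF this]
  show "summable (\<lambda>n. fps_nth (hyp2F1_reg_fps a b c) n * of_real r ^ n)"
    by (auto simp: hyp2F1_reg_fps_def intro: sums_summable)
qed

lemma hyp2F1_reg_series_has_field_derivative:
  fixes a b c :: complex
  defines "F \<equiv> hyp2F1_reg_series a b c"
  assumes w: "norm w < 1"
  shows "(F has_field_derivative deriv F w) (at w)" and "(deriv F has_field_derivative deriv (deriv F) w) (at w)"
proof -
  have "F holomorphic_on ball 0 1"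
    unfolding F_def eval_hyp2F1_reg_fps[symmetric]
    by (rule holomorphic_on_eval_fps) (metis ball_eball_mono fps_conv_radius_hyp2F1_reg one_ereal_def)
  then show "(F has_field_derivative deriv F w) (at w)" "(deriv F has_field_derivative deriv (deriv F) w) (at w)"
    using w holomorphic_deriv[of F "ball 0 1"] by (auto intro!: holomorphic_derivI[of _ "ball 0 1"])
qed

lemma hyp2F1_reg_series_holomorphic: "hyp2F1_reg_series a b c holomorphic_on ball 0 1"
  unfolding holomorphic_on_open[OF open_ball]
  using hyp2F1_reg_series_has_field_derivative(1) by fastforce

lemma hyp2F1_reg_series_0: "hyp2F1_reg_series a b c 0 = rGamma c"
  unfolding eval_hyp2F1_reg_fps[symmetric] by (simp add: eval_fps_at_0 hyp2F1_reg_fps_def hyp2F1_reg_coeff_def)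

lemma eval_fps_deriv_hyp2F1_reg:
  assumes w: "norm w < 1"
  shows "eval_fps (fps_deriv (hyp2F1_reg_fps a b c)) w = deriv (hyp2F1_reg_series a b c) w"
    and "eval_fps (fps_deriv (fps_deriv (hyp2F1_reg_fps a b c))) w = deriv (deriv (hyp2F1_reg_series a b c)) w"
proof -
  have radius: "ereal (norm v) < fps_conv_radius f" if "1 \<le> fps_conv_radius f" "norm v < 1" for f v
    using that less_le_trans[of "ereal (norm v)" 1] by (simp add: one_ereal_def)
  have first: "eval_fps (fps_deriv (hyp2F1_reg_fps a b c)) v = deriv (hyp2F1_reg_series a b c) v" if "norm v < 1" for v
    using that by (simp add: eval_fps_deriv radius fps_conv_radius_hyp2F1_reg eval_hyp2F1_reg_fps)
  then show "eval_fps (fps_deriv (hyp2F1_reg_fps a b c)) w = deriv (hyp2F1_reg_series a b c) w"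
    using w by blast
  have "eval_fps (fps_deriv (fps_deriv (hyp2F1_reg_fps a b c))) w = deriv (eval_fps (fps_deriv (hyp2F1_reg_fps a b c))) w"
    by (intro eval_fps_deriv radius fps_conv_radius_ge_1_intros order_trans[OF _ fps_conv_radius_deriv] fps_conv_radius_hyp2F1_reg w)
  also have "\<dots> = deriv (deriv (hyp2F1_reg_series a b c)) w"
    by (rule complex_derivative_transform_within_open[of _ "ball 0 1"])
       (use w first in \<open>auto intro!: holomorphic_deriv hyp2F1_reg_series_holomorphic holomorphic_on_eval_fps
         simp: subset_iff radius fps_conv_radius_ge_1_intros order_trans[OF _ fps_conv_radius_deriv] fps_conv_radius_hyp2F1_reg\<close>)
  finally show "eval_fps (fps_deriv (fps_deriv (hyp2F1_reg_fps a b c))) w = deriv (deriv (hyp2F1_reg_series a b c)) w" .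
qed

lemma hyp2F1_reg_fps_contiguous:
  "hyp2F1_reg_fps a b c = fps_const c * hyp2F1_reg_fps a b (c + 1) + fps_X * fps_deriv (hyp2F1_reg_fps a b (c + 1))"
proof (rule fps_ext)
  show "fps_nth (hyp2F1_reg_fps a b c) n =
      fps_nth (fps_const c * hyp2F1_reg_fps a b (c + 1) + fps_X * fps_deriv (hyp2F1_reg_fps a b (c + 1))) n" for n
    by (cases n) (simp_all add: hyp2F1_reg_fps_def hyp2F1_reg_coeff_plus1[of a b c] distrib_right)
qed

lemma hyp2F1_reg_fps_ODE:
  fixes a b c :: complex
  defines "F \<equiv> hyp2F1_reg_fps a b c"
  shows "fps_X * (1 - fps_X) * fps_deriv (fps_deriv F) + (fps_const c - fps_const (a + b + 1) * fps_X) * fps_deriv F - fps_const (a * b) * F = 0"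
proof -
  let ?f = "hyp2F1_reg_coeff a b c"
  have "fps_X * fps_deriv (fps_deriv F) + fps_const c * fps_deriv F =
      fps_X * (fps_X * fps_deriv (fps_deriv F)) + fps_const (a + b + 1) * (fps_X * fps_deriv F) + fps_const (a * b) * F"
  proof (rule fps_ext)
    fix n
    have "fps_nth (fps_X * fps_deriv (fps_deriv F) + fps_const c * fps_deriv F) n = of_nat (Suc n) * (c + of_nat n) * ?f (Suc n)"
      by (cases n) (simp_all add: F_def hyp2F1_reg_fps_def algebra_simps)
    also have "\<dots> = (a + of_nat n) * (b + of_nat n) * ?f n" by (rule hyp2F1_reg_coeff_Suc)
    also have "\<dots> = fps_nth (fps_X * (fps_X * fps_deriv (fps_deriv F)) + fps_const (a + b + 1) * (fps_X * fps_deriv F) + fps_const (a * b) * F) n"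
    proof (cases n)
      case (Suc k)
      then show ?thesis by (cases k) (simp_all add: F_def hyp2F1_reg_fps_def algebra_simps)
    qed (simp add: F_def hyp2F1_reg_fps_def)
    finally show "fps_nth (fps_X * fps_deriv (fps_deriv F) + fps_const c * fps_deriv F) n = \<dots>" .
  qed
  then show ?thesis by (simp add: algebra_simps)
qed

lemma hyp2F1_reg_series_contiguous:
  assumes w: "norm w < 1"
  shows "hyp2F1_reg_series a b c w = c * hyp2F1_reg_series a b (c + 1) w + w * deriv (hyp2F1_reg_series a b (c + 1)) w"
proof -
  have "eval_fps (hyp2F1_reg_fps a b c) w =
      eval_fps (fps_const c * hyp2F1_reg_fps a b (c + 1) + fps_X * fps_deriv (hyp2F1_reg_fps a b (c + 1))) w"
    by (simp flip: hyp2F1_reg_fps_contiguous)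
  then show ?thesis
    using w by (simp add: eval_fps_unit_disc fps_conv_radius_ge_1_intros order_trans[OF _ fps_conv_radius_deriv] fps_conv_radius_hyp2F1_reg
        eval_hyp2F1_reg_fps eval_fps_deriv_hyp2F1_reg)
qed

lemma hyp2F1_reg_series_ODE:
  fixes a b c :: complex
  defines "F \<equiv> hyp2F1_reg_series a b c"
  assumes w: "norm w < 1"
  shows "w * (1 - w) * deriv (deriv F) w + (c - (a + b + 1) * w) * deriv F w = a * b * F w"
proof -
  let ?F = "hyp2F1_reg_fps a b c"
  have "eval_fps (fps_X * (1 - fps_X) * fps_deriv (fps_deriv ?F) + (fps_const c - fps_const (a + b + 1) * fps_X) * fps_deriv ?F - fps_const (a * b) * ?F) w = 0"
    by (simp only: hyp2F1_reg_fps_ODE eval_fps_0)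
  then show ?thesis
    using w by (simp add: F_def eval_fps_unit_disc fps_conv_radius_ge_1_intros order_trans[OF _ fps_conv_radius_deriv] fps_conv_radius_hyp2F1_reg
        eval_hyp2F1_reg_fps eval_fps_deriv_hyp2F1_reg)
qed

section \<open>Continuation of the hypergeometric series\<close>

lemma Beta_weight_mult_power:
  assumes "r \<in> {0<..<1}"
  shows "Beta_weight (c + of_nat n) d r = of_real (r ^ n) * (Beta_weight c d r :: complex)"
proof -
  have "complex_of_real r powr (c + of_nat n - 1) = of_real r ^ n * of_real r powr (c - 1)"
    using assms powr_add[of "complex_of_real r" "of_nat n" "c - 1"] by (simp add: powr_nat add_diff_eq add.commute)
  then show ?thesis
    by (simp add: Beta_weight_def)
qed

lemma hyp2F1_reg_coeff_mult_Beta: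
  assumes c: "Re c > 0" and d: "Re d > 0"
  shows "hyp2F1_reg_coeff a b c n * Beta (c + of_nat n) d = Gamma d * hyp2F1_reg_coeff a b (c + d) n"
proof -
  have "rGamma (c + of_nat n) * Gamma (c + of_nat n) = 1"
    using not_nonpos_Ints_Re[of "c + of_nat n"] c by (simp add: Gamma_def rGamma_eq_zero_iff)
  then have "rGamma (c + of_nat n) * Beta (c + of_nat n) d = Gamma d * rGamma (c + d + of_nat n)"
    by (simp add: Beta_altdef mult.assoc[symmetric] add_ac)
  then show ?thesis
    by (simp add: hyp2F1_reg_coeff_def mult_ac)
qed

lemma sums_set_integral_hyp2F1_reg_coeff_Beta_weight:
  fixes a b c d w :: complex
  assumes w: "norm w < 1" and c: "Re c > 0" and d: "Re d > 0"
  defines "f \<equiv> \<lambda>n r. hyp2F1_reg_coeff a b c n * w ^ n * Beta_weight (c + of_nat n) d r"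
  shows "(\<lambda>n. LINT r:{0<..<1}|lborel. f n r) sums (LINT r:{0<..<1}|lborel. \<Sum>n. f n r)"
proof (rule set_integral_sums)
  show "set_integrable lborel {0<..<1} (f n)" for n
    unfolding f_def by (intro set_integrable_mult_right set_integrable_Beta_weight) (use c d in auto)
  show "norm (f n r) \<le> norm (hyp2F1_reg_coeff a b c n) * norm w ^ n * norm (Beta_weight c d r)" if "r \<in> {0<..<1}" for n r
  proof -
    have "r ^ n * norm (Beta_weight c d r) \<le> 1 * norm (Beta_weight c d r)"
      using that by (intro mult_right_mono power_le_one) auto
    then show ?thesis
      using that by (simp add: f_def Beta_weight_mult_power norm_mult norm_power mult_left_mono)
  qed
  show "set_integrable lborel {0<..<1} (\<lambda>r. norm (Beta_weight c d r :: complex))"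
    by (rule set_integrable_norm[OF set_integrable_Beta_weight[OF c d]])
  show "summable (\<lambda>n. norm (hyp2F1_reg_coeff a b c n) * norm w ^ n)"
    by (rule summable_norm_hyp2F1_reg_coeff) (use w in auto)
qed

lemma set_integral_Beta_weight_hyp2F1_reg_series:
  assumes w: "norm w < 1" and c: "Re c > 0" and d: "Re d > 0"
  shows "(LINT r:{0<..<1}|lborel. Beta_weight c d r * hyp2F1_reg_series a b c (w * of_real r)) =
    Gamma d * hyp2F1_reg_series a b (c + d) w"
proof -
  let ?f = "\<lambda>n r. hyp2F1_reg_coeff a b c n * w ^ n * Beta_weight (c + of_nat n) d r"
  have "(\<lambda>n. LINT r:{0<..<1}|lborel. ?f n r) sums (LINT r:{0<..<1}|lborel. \<Sum>n. ?f n r)"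
    by (rule sums_set_integral_hyp2F1_reg_coeff_Beta_weight[OF assms])
  also have "(\<lambda>n. LINT r:{0<..<1}|lborel. ?f n r) = (\<lambda>n. Gamma d * (hyp2F1_reg_coeff a b (c + d) n * w ^ n))"
  proof
    fix n
    have "(LINT r:{0<..<1}|lborel. ?f n r) = hyp2F1_reg_coeff a b c n * w ^ n * Beta (c + of_nat n) d"
      by (subst set_integral_mult_right, subst set_integral_Beta_weight) (use c d in auto)
    then show "(LINT r:{0<..<1}|lborel. ?f n r) = Gamma d * (hyp2F1_reg_coeff a b (c + d) n * w ^ n)"
      using hyp2F1_reg_coeff_mult_Beta[OF c d, of a b n] by (simp add: mult_ac)
  qed
  also have "(LINT r:{0<..<1}|lborel. \<Sum>n. ?f n r) =
      (LINT r:{0<..<1}|lborel. Beta_weight c d r * hyp2F1_reg_series a b c (w * of_real r))"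
  proof (rule set_integral_cong)
    fix r :: real assume r: "r \<in> {0<..<1}"
    then have "norm (w * of_real r) < 1"
      using mult_left_le[of r "norm w"] w by (simp add: norm_mult)
    from sums_mult[OF hyp2F1_reg_series_sums[OF this, of a b c], of "Beta_weight c d r"]
    show "(\<Sum>n. ?f n r) = Beta_weight c d r * hyp2F1_reg_series a b c (w * of_real r)"
      using r by (simp add: sums_iff Beta_weight_mult_power power_mult_distrib mult_ac)
  qed
  finally show ?thesis
    by (rule sums_unique2[OF _ sums_mult[OF hyp2F1_reg_series_sums[OF w]]])
qed

lemma slit_plane_scale:
  assumes w: "w \<in> slit_plane" and r: "0 \<le> r" "r \<le> 1"
  shows "w * of_real r \<in> slit_plane"
proof (rule ccontr)
  assume "w * of_real r \<notin> slit_plane"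
  then obtain t where t: "t \<ge> 1" "w * of_real r = of_real t" by (auto simp: slit_plane_def)
  then have "r > 0" using r by (cases "r = 0") auto
  then have "w = of_real (t / r)" "t / r \<ge> 1" using t r by (auto simp: field_simps)
  then have "w \<in> complex_of_real ` {1..}" by (intro image_eqI[of _ _ "t / r"]) auto
  then show False using w by (simp add: slit_plane_def)
qed

lemma holomorphic_slit_plane_scaled_locally_bounded:
  assumes F: "F holomorphic_on slit_plane" and w: "w \<in> slit_plane"
  obtains e C where "e > 0" "\<And>v r. v \<in> ball w e \<Longrightarrow> r \<in> {0<..<1} \<Longrightarrow> norm (F (v * of_real r)) \<le> C"
proof -
  obtain e where e: "e > 0" "cball w e \<subseteq> slit_plane"
    using open_slit_plane w open_contains_cball by blast
  let ?K = "(\<lambda>p. fst p * complex_of_real (snd p)) ` (cball w e \<times> {0..1})"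
  have "compact ?K"
    by (intro compact_continuous_image compact_Times continuous_intros) auto
  moreover have "?K \<subseteq> slit_plane" using e(2) slit_plane_scale by force
  ultimately have "compact (F ` ?K)"
    using F by (meson compact_continuous_image continuous_on_subset holomorphic_on_imp_continuous_on)
  then obtain C where C: "\<And>y. y \<in> F ` ?K \<Longrightarrow> norm y \<le> C"
    using compact_imp_bounded bounded_iff by metis
  show ?thesis
  proof (rule that[OF e(1)])
    fix v r assume "v \<in> ball w e" "r \<in> {0<..<(1::real)}"
    then have "v * of_real r \<in> ?K" by (intro image_eqI[of _ _ "(v, r)"]) auto
    then show "norm (F (v * of_real r)) \<le> C" by (intro C imageI)
  qed
qed

lemma Beta_integral_holomorphic_slit_plane:
  assumes F: "F holomorphic_on slit_plane" and c: "Re c > 0" and d: "Re d > 0"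
  shows "(\<lambda>w. LINT r:{0<..<1}|lborel. Beta_weight c d r * F (w * of_real r)) holomorphic_on slit_plane"
proof (rule holomorphic_on_set_integral_mult_bounded[OF open_slit_plane _ set_integrable_Beta_weight[OF c d]])
  show "(\<lambda>w. F (w * of_real r)) holomorphic_on slit_plane" if "r \<in> {0<..<1}" for r
    by (rule holomorphic_on_compose_gen[OF _ F, unfolded o_def])
       (use that slit_plane_scale in \<open>auto intro!: holomorphic_intros\<close>)
  fix w assume w: "w \<in> slit_plane"
  show "continuous_on {0<..<1} (\<lambda>r. F (w * of_real r))"
    by (rule continuous_on_compose2[OF holomorphic_on_imp_continuous_on[OF F]])
       (use slit_plane_scale[OF w] in \<open>auto intro!: continuous_intros\<close>)
  show "\<exists>e>0. \<exists>C. \<forall>v\<in>ball w e \<inter> slit_plane. \<forall>r\<in>{0<..<1}. norm (F (v * of_real r)) \<le> C"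
    by (rule holomorphic_slit_plane_scaled_locally_bounded[OF F w]) blast
qed auto

definition hyp2F1_reg_continuable :: "complex \<Rightarrow> complex \<Rightarrow> complex \<Rightarrow> bool" where
  "hyp2F1_reg_continuable a b c \<longleftrightarrow>
     (\<exists>F. F holomorphic_on slit_plane \<and> (\<forall>w. norm w < 1 \<longrightarrow> F w = hyp2F1_reg_series a b c w))"

lemma hyp2F1_reg_continuation:
  assumes "hyp2F1_reg_continuable a b c"
  shows "hyp2F1_reg a b c holomorphic_on slit_plane"
    and "norm w < 1 \<Longrightarrow> hyp2F1_reg a b c w = hyp2F1_reg_series a b c w"
  using someI_ex[OF assms[unfolded hyp2F1_reg_continuable_def]] unfolding hyp2F1_reg_def by blast+

lemma hyp2F1_reg_continuable_add:
  assumes "hyp2F1_reg_continuable a b c" and c: "Re c > 0" and d: "Re d > 0"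
  shows "hyp2F1_reg_continuable a b (c + d)"
proof -
  obtain F where F: "F holomorphic_on slit_plane" "\<And>w. norm w < 1 \<Longrightarrow> F w = hyp2F1_reg_series a b c w"
    using assms(1) by (auto simp: hyp2F1_reg_continuable_def)
  let ?G = "\<lambda>w. rGamma d * (LINT r:{0<..<1}|lborel. Beta_weight c d r * F (w * of_real r))"
  have "?G holomorphic_on slit_plane"
    by (intro holomorphic_intros Beta_integral_holomorphic_slit_plane F c d)
  moreover have "?G w = hyp2F1_reg_series a b (c + d) w" if w: "norm w < 1" for w
  proof -
    have "norm (w * of_real r) < 1" if "r \<in> {0<..<1}" for r
      using mult_left_le[of r "norm w"] w that by (simp add: norm_mult)
    then have "(LINT r:{0<..<1}|lborel. Beta_weight c d r * F (w * of_real r)) =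
        (LINT r:{0<..<1}|lborel. Beta_weight c d r * hyp2F1_reg_series a b c (w * of_real r))"
      by (intro set_integral_cong) (simp only: F(2))
    also have "\<dots> = Gamma d * hyp2F1_reg_series a b (c + d) w"
      by (rule set_integral_Beta_weight_hyp2F1_reg_series[OF w c d])
    moreover have "rGamma d * Gamma d = 1"
      using not_nonpos_Ints_Re[OF d] by (simp add: Gamma_def rGamma_eq_zero_iff)
    ultimately show ?thesis
      by (simp add: mult.assoc[symmetric])
  qed
  ultimately show ?thesis
    unfolding hyp2F1_reg_continuable_def by blast
qed

lemma hyp2F1_reg_continuable_lower:
  assumes "hyp2F1_reg_continuable a b (c + 1)"
  shows "hyp2F1_reg_continuable a b c"
proof -
  obtain F where F: "F holomorphic_on slit_plane" "\<And>w. norm w < 1 \<Longrightarrow> F w = hyp2F1_reg_series a b (c + 1) w"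
    using assms by (auto simp: hyp2F1_reg_continuable_def)
  have "(\<lambda>w. c * F w + w * deriv F w) holomorphic_on slit_plane"
    by (intro holomorphic_intros holomorphic_deriv F(1) open_slit_plane)
  moreover have "c * F w + w * deriv F w = hyp2F1_reg_series a b c w" if w: "norm w < 1" for w
  proof -
    have "deriv F w = deriv (hyp2F1_reg_series a b (c + 1)) w"
      by (rule complex_derivative_transform_within_open[of _ "ball 0 1"])
         (use w F(2) holomorphic_on_subset[OF F(1) ball_subset_slit_plane] hyp2F1_reg_series_holomorphic in auto)
    then show ?thesis
      using hyp2F1_reg_series_contiguous[OF w, of a b c] by (simp only: F(2)[OF w])
  qed
  ultimately show ?thesis
    unfolding hyp2F1_reg_continuable_def by blast
qed

text \<open>For \<open>c = 1/2\<close> the series is elementary: with \<open>w = sin\<^sup>2 z\<close> it is, up to the factor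
  \<open>\<surd>\<pi>\<close>, the Chebyshev function of the third kind \<open>cos ((2 \<nu> + 1) z) / cos z\<close>.\<close>

definition sin_disc :: "complex set" where
  "sin_disc = {z. \<bar>Re z\<bar> < pi / 2 \<and> norm (sin z) < 1}"

lemma norm_sin_sq: "(norm (sin z))\<^sup>2 = (sin (Re z))\<^sup>2 + (sinh (Im z))\<^sup>2"
proof -
  have "(exp (2 * Im z) + inverse (exp (2 * Im z)) - 2) / 4 = (sinh (Im z))\<^sup>2"
    by (simp add: sinh_field_def power2_eq_square exp_minus field_simps flip: exp_add)
  then show ?thesis
    using cos_double_sin[of "Re z"] by (simp add: norm_sin_squared add_divide_distrib diff_divide_distrib)
qed

lemma open_sin_disc: "open sin_disc"
proof -
  have eq: "sin_disc = {z. \<bar>Re z\<bar> < pi / 2} \<inter> {z. norm (sin z) < 1}"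
    by (auto simp: sin_disc_def)
  show ?thesis
    unfolding eq by (intro open_Int open_Collect_less continuous_intros)
qed

lemma connected_sin_disc: "connected sin_disc"
proof (rule starlike_imp_connected)
  have "of_real u * z \<in> sin_disc" if z: "z \<in> sin_disc" and u: "0 \<le> u" "u \<le> 1" for u z
  proof -
    have le: "u * x \<le> x" if "0 \<le> x" for x :: real
      using mult_left_le_one_le[OF that u] by simp
    have "\<bar>u * Re z\<bar> \<le> \<bar>Re z\<bar>"
      using le[of "\<bar>Re z\<bar>"] u by (simp add: abs_mult)
    moreover have "\<bar>sin (u * Re z)\<bar> \<le> \<bar>sin (Re z)\<bar>"
    proof -
      have abs_sin: "\<bar>sin x\<bar> = sin \<bar>x\<bar>" if "\<bar>x\<bar> < pi / 2" for x :: real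
        using sin_ge_zero[of "\<bar>x\<bar>"] that by (auto simp: abs_if split: if_splits)
      have "sin \<bar>u * Re z\<bar> \<le> sin \<bar>Re z\<bar>"
        using \<open>\<bar>u * Re z\<bar> \<le> \<bar>Re z\<bar>\<close> z by (intro sin_monotone_2pi_le) (auto simp: sin_disc_def)
      then show ?thesis
        using \<open>\<bar>u * Re z\<bar> \<le> \<bar>Re z\<bar>\<close> z by (simp add: abs_sin sin_disc_def)
    qed
    moreover have "\<bar>sinh (u * Im z)\<bar> \<le> \<bar>sinh (Im z)\<bar>"
      using le[of "\<bar>Im z\<bar>"] u by (simp add: abs_mult flip: sinh_real_abs)
    ultimately have "(norm (sin (of_real u * z)))\<^sup>2 \<le> (norm (sin z))\<^sup>2"
      unfolding norm_sin_sq by (intro add_mono) (simp_all add: abs_le_square_iff)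
    then show ?thesis
      using z \<open>\<bar>u * Re z\<bar> \<le> \<bar>Re z\<bar>\<close> by (auto simp: sin_disc_def)
  qed
  then show "starlike sin_disc"
    unfolding starlike_def by (intro bexI[of _ 0]) (auto simp: sin_disc_def in_segment scaleR_conv_of_real)
qed

lemma holomorphic_ODE_unique:
  fixes f :: "complex \<Rightarrow> complex"
  assumes f: "f holomorphic_on S" and S: "open S" "connected S" and z0: "z0 \<in> S" "f z0 = 0" "deriv f z0 = 0"
    and ODE: "\<And>z. z \<in> S \<Longrightarrow> deriv (deriv f) z = k * f z" and z: "z \<in> S"
  shows "f z = 0"
proof (rule holomorphic_fun_eq_0_on_connected[OF f S(1,2) _ z0(1) z])
  have shift: "(deriv ^^ (n + 2)) f z = k * (deriv ^^ n) f z" if "z \<in> S" for n z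
    using that
  proof (induction n arbitrary: z)
    case (Suc n)
    have "deriv ((deriv ^^ (n + 2)) f) z = deriv (\<lambda>z. k * (deriv ^^ n) f z) z"
      by (rule complex_derivative_transform_within_open[OF _ _ S(1) Suc.prems Suc.IH])
         (intro holomorphic_intros holomorphic_higher_deriv f S(1))+
    also have "\<dots> = k * deriv ((deriv ^^ n) f) z"
      by (rule deriv_cmult)
         (use holomorphic_on_imp_differentiable_at[OF holomorphic_higher_deriv[OF f S(1)] S(1) Suc.prems] in auto)
    finally show ?case by simp
  qed (use ODE in \<open>simp add: numeral_2_eq_2\<close>)
  show "(deriv ^^ n) f z0 = 0" for n
  proof (induction n rule: less_induct)
    case (less n)
    consider "n = 0" | "n = 1" | k where "n = k + 2"
      by (metis One_nat_def add_2_eq_Suc' not0_implies_Suc)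
    then show ?case
      by cases (use z0 shift[OF z0(1)] less in auto)
  qed
qed

lemma cos_mult_comp_sin_squared_derivs:
  assumes F: "(F has_field_derivative F' ((sin z)\<^sup>2)) (at ((sin z)\<^sup>2))"
    and F': "(F' has_field_derivative F'') (at ((sin z)\<^sup>2))"
    and ODE: "(sin z)\<^sup>2 * (1 - (sin z)\<^sup>2) * F'' + (1/2 - 2 * (sin z)\<^sup>2) * F' ((sin z)\<^sup>2) = - \<nu> * (\<nu> + 1) * F ((sin z)\<^sup>2)"
  shows "((\<lambda>z. cos z * F ((sin z)\<^sup>2)) has_field_derivative
      2 * sin z * (cos z)\<^sup>2 * F' ((sin z)\<^sup>2) - sin z * F ((sin z)\<^sup>2)) (at (z :: complex))"
    and "((\<lambda>z. 2 * sin z * (cos z)\<^sup>2 * F' ((sin z)\<^sup>2) - sin z * F ((sin z)\<^sup>2)) has_field_derivative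
      - ((2 * \<nu> + 1)\<^sup>2) * (cos z * F ((sin z)\<^sup>2))) (at z)"
proof -
  have "((\<lambda>z. (sin z)\<^sup>2) has_field_derivative 2 * sin z * cos z) (at z)"
    by (auto intro!: derivative_eq_intros)
  note chain = DERIV_chain2[OF F this] DERIV_chain2[OF F' this]
  show "((\<lambda>z. cos z * F ((sin z)\<^sup>2)) has_field_derivative
      2 * sin z * (cos z)\<^sup>2 * F' ((sin z)\<^sup>2) - sin z * F ((sin z)\<^sup>2)) (at z)"
    by (rule derivative_eq_intros chain(1) refl)+ (simp add: power2_eq_square algebra_simps)
  define s c where "s = sin z" and "c = cos z"
  have "((\<lambda>z. 2 * sin z * (cos z)\<^sup>2 * F' ((sin z)\<^sup>2) - sin z * F ((sin z)\<^sup>2)) has_field_derivative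
      c * (4 * (s\<^sup>2 * c\<^sup>2 * F'' + (1/2 * c\<^sup>2 - 3/2 * s\<^sup>2) * F' (s\<^sup>2)) - F (s\<^sup>2))) (at z)"
    unfolding s_def c_def
    by (rule derivative_eq_intros chain refl)+ (simp add: power2_eq_square algebra_simps)
  also have "s\<^sup>2 * c\<^sup>2 * F'' + (1/2 * c\<^sup>2 - 3/2 * s\<^sup>2) * F' (s\<^sup>2) = - \<nu> * (\<nu> + 1) * F (s\<^sup>2)"
    using ODE unfolding c_def cos_squared_eq s_def[symmetric] by (simp add: algebra_simps)
  finally show "((\<lambda>z. 2 * sin z * (cos z)\<^sup>2 * F' ((sin z)\<^sup>2) - sin z * F ((sin z)\<^sup>2)) has_field_derivative
      - ((2 * \<nu> + 1)\<^sup>2) * (cos z * F ((sin z)\<^sup>2))) (at z)"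
    by (rule DERIV_cong) (simp add: s_def c_def power2_eq_square algebra_simps)
qed

lemma cos_mult_hyp2F1_reg_series_half:
  assumes z: "z \<in> sin_disc"
  shows "cos z * hyp2F1_reg_series (\<nu> + 1) (- \<nu>) (1/2) ((sin z)\<^sup>2) = cos ((2 * \<nu> + 1) * z) / of_real (sqrt pi)"
proof -
  define F where "F = hyp2F1_reg_series (\<nu> + 1) (- \<nu>) (1/2)"
  define K where "K = 1 / complex_of_real (sqrt pi)"
  define h where "h z = 2 * sin z * (cos z)\<^sup>2 * deriv F ((sin z)\<^sup>2) - sin z * F ((sin z)\<^sup>2)" for z
  define g where "g z = cos z * F ((sin z)\<^sup>2) - K * cos ((2 * \<nu> + 1) * z)" for z
  have derivs: "((\<lambda>z. cos z * F ((sin z)\<^sup>2)) has_field_derivative h z) (at z)"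
      "(h has_field_derivative - ((2 * \<nu> + 1)\<^sup>2) * (cos z * F ((sin z)\<^sup>2))) (at z)" if "z \<in> sin_disc" for z
  proof -
    have "norm ((sin z)\<^sup>2) < 1"
      using that by (simp add: sin_disc_def norm_power abs_square_less_1)
    note F_derivs = hyp2F1_reg_series_has_field_derivative[OF this, of "\<nu> + 1" "- \<nu>" "1/2", folded F_def]
      and ODE = hyp2F1_reg_series_ODE[OF this, of "\<nu> + 1" "- \<nu>" "1/2", folded F_def]
    have "(sin z)\<^sup>2 * (1 - (sin z)\<^sup>2) * deriv (deriv F) ((sin z)\<^sup>2) + (1/2 - 2 * (sin z)\<^sup>2) * deriv F ((sin z)\<^sup>2) =
        - \<nu> * (\<nu> + 1) * F ((sin z)\<^sup>2)"
      using ODE by (simp add: algebra_simps)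
    from cos_mult_comp_sin_squared_derivs[OF F_derivs this]
    show "((\<lambda>z. cos z * F ((sin z)\<^sup>2)) has_field_derivative h z) (at z)"
      "(h has_field_derivative - ((2 * \<nu> + 1)\<^sup>2) * (cos z * F ((sin z)\<^sup>2))) (at z)"
      unfolding h_def[abs_def] by simp_all
  qed
  have g_deriv: "(g has_field_derivative h z + K * (2 * \<nu> + 1) * sin ((2 * \<nu> + 1) * z)) (at z)"
    if "z \<in> sin_disc" for z
    unfolding g_def by (rule derivative_eq_intros derivs(1)[OF that] refl)+ simp
  have deriv_g: "deriv g z = h z + K * (2 * \<nu> + 1) * sin ((2 * \<nu> + 1) * z)" if "z \<in> sin_disc" for z
    by (rule DERIV_imp_deriv[OF g_deriv[OF that]])
  have "g z = 0"
  proof (rule holomorphic_ODE_unique[OF _ open_sin_disc connected_sin_disc _ _ _ _ z])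
    show "g holomorphic_on sin_disc"
      using g_deriv by (auto simp: holomorphic_on_open[OF open_sin_disc])
    show zero: "0 \<in> sin_disc" by (simp add: sin_disc_def)
    show "deriv g 0 = 0" by (simp add: deriv_g[OF zero] h_def)
    show "g 0 = 0"
      by (simp add: g_def K_def F_def hyp2F1_reg_series_0 rGamma_inverse_Gamma Gamma_one_half_complex inverse_eq_divide)
    show "deriv (deriv g) z = - ((2 * \<nu> + 1)\<^sup>2) * g z" if z: "z \<in> sin_disc" for z
    proof (rule DERIV_imp_deriv[OF has_field_derivative_transform_within_open[OF _ open_sin_disc z deriv_g[symmetric]]])
      show "((\<lambda>z. h z + K * (2 * \<nu> + 1) * sin ((2 * \<nu> + 1) * z)) has_field_derivative - ((2 * \<nu> + 1)\<^sup>2) * g z) (at z)"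
        by (rule derivative_eq_intros derivs(2)[OF z] refl)+ (simp add: g_def power2_eq_square algebra_simps)
    qed
  qed
  then show ?thesis by (simp add: g_def F_def K_def)
qed

lemma sin_sq_less_1:
  fixes x :: real
  assumes "\<bar>x\<bar> < pi / 2"
  shows "(sin x)\<^sup>2 < 1"
proof -
  have "cos x > 0" using assms by (intro cos_gt_zero_pi) auto
  then show ?thesis by (simp add: sin_squared_eq)
qed

lemma of_real_mem_sin_disc:
  assumes "\<bar>x\<bar> < pi / 2"
  shows "complex_of_real x \<in> sin_disc"
  using sin_sq_less_1[OF assms] assms by (simp add: sin_disc_def sin_of_real abs_square_less_1)

lemma sin_cos_imaginary:
  "sin (\<i> * complex_of_real t) = \<i> * of_real (sinh t)" "cos (\<i> * complex_of_real t) = of_real (cosh t)"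
  by (simp_all add: sin_exp_eq cos_exp_eq sinh_field_def cosh_field_def exp_of_real mult.assoc[symmetric] field_simps flip: of_real_minus)

lemma imaginary_mem_sin_disc: "\<bar>sinh t\<bar> < 1 \<Longrightarrow> \<i> * complex_of_real t \<in> sin_disc"
  by (simp add: sin_disc_def sin_cos_imaginary norm_mult)

definition chebyshev_closed_form :: "complex \<Rightarrow> complex \<Rightarrow> complex" where
  "chebyshev_closed_form \<nu> w =
     cosh ((2 * \<nu> + 1) * Ln (csqrt (1 - w) + csqrt (- w))) / (csqrt (1 - w) * of_real (sqrt pi))"

lemma Re_csqrt_pos:
  assumes "w \<notin> \<real>\<^sub>\<le>\<^sub>0"
  shows "Re (csqrt w) > 0"
proof (rule ccontr)
  assume "\<not> Re (csqrt w) > 0"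
  then have "csqrt w = \<i> * of_real (Im (csqrt w))"
    using Re_csqrt[of w] by (intro complex_eqI) (simp_all del: csqrt.simps)
  then obtain y where "csqrt w = \<i> * of_real y" by blast
  then have "w = of_real (- (y\<^sup>2))"
    using power2_csqrt[of w] by (simp add: power_mult_distrib del: csqrt.simps)
  then have "w \<in> \<real>\<^sub>\<le>\<^sub>0"
    by (simp only: nonpos_Reals_of_real_iff) simp
  with assms show False by contradiction
qed

lemma chebyshev_closed_form_holomorphic: "chebyshev_closed_form \<nu> holomorphic_on - (of_real ` {0..})"
proof -
  let ?S = "- (complex_of_real ` {0..})"
  have slit: "- w \<notin> \<real>\<^sub>\<le>\<^sub>0" "1 - w \<notin> \<real>\<^sub>\<le>\<^sub>0" if "w \<in> ?S" for w
    using that by (auto simp: complex_nonpos_Reals_iff complex_slot_right_eq)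
  note Re_pos = Re_csqrt_pos[OF slit(1)] Re_csqrt_pos[OF slit(2)]
  have csqrt: "(\<lambda>w. csqrt (1 - w)) holomorphic_on ?S" "(\<lambda>w. csqrt (- w)) holomorphic_on ?S"
    using slit by (auto intro!: holomorphic_on_csqrt' holomorphic_intros)
  have "csqrt (1 - w) + csqrt (- w) \<notin> \<real>\<^sub>\<le>\<^sub>0" if "w \<in> ?S" for w
    using Re_pos[OF that] by (intro not_nonpos_Reals_Re) (simp del: csqrt.simps)
  moreover have "csqrt (1 - w) \<noteq> 0" if "w \<in> ?S" for w
    using Re_pos(2)[OF that] by auto
  ultimately have "(\<lambda>w. (exp ((2 * \<nu> + 1) * Ln (csqrt (1 - w) + csqrt (- w))) +
      exp (- ((2 * \<nu> + 1) * Ln (csqrt (1 - w) + csqrt (- w))))) / 2 / (csqrt (1 - w) * of_real (sqrt pi))) holomorphic_on ?S"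
    by (intro holomorphic_on_divide holomorphic_on_add holomorphic_on_exp' holomorphic_on_minus holomorphic_on_mult
        holomorphic_on_const holomorphic_on_Ln' csqrt) auto
  then show ?thesis
    by (simp add: chebyshev_closed_form_def[abs_def] cosh_field_def)
qed

lemma chebyshev_closed_form_sinh:
  assumes "t > 0"
  shows "chebyshev_closed_form \<nu> (of_real (- (sinh t)\<^sup>2)) = cosh ((2 * \<nu> + 1) * of_real t) / of_real (cosh t * sqrt pi)"
proof -
  have "1 - complex_of_real (- (sinh t)\<^sup>2) = of_real ((cosh t)\<^sup>2)"
    by (simp add: cosh_square_eq)
  then have "csqrt (1 - of_real (- (sinh t)\<^sup>2)) = of_real (cosh t)"
    by (simp only: csqrt_of_real zero_le_power2 real_sqrt_abs) simp
  moreover have "csqrt (- of_real (- (sinh t)\<^sup>2)) = of_real (sinh t)"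
    using assms csqrt_of_real[of "(sinh t)\<^sup>2"] by simp
  moreover have "Ln (of_real (cosh t) + of_real (sinh t)) = of_real t"
    using Ln_of_real[of "exp t"] cosh_plus_sinh[of t] by (simp flip: of_real_add)
  ultimately show ?thesis
    by (simp add: chebyshev_closed_form_def)
qed

lemma chebyshev_closed_form_eq_series:
  assumes w: "norm w < 1" "w \<notin> of_real ` {0..}"
  shows "hyp2F1_reg_series (\<nu> + 1) (- \<nu>) (1/2) w = chebyshev_closed_form \<nu> w"
proof -
  let ?S = "ball 0 1 \<inter> - (complex_of_real ` {0..})"
  have "closed_segment (of_real (- 1/2)) z \<subseteq> ?S" if "z \<in> ?S" for z
    using that starlike_slotted_complex_plane_right_aux[of z 0 "- 1/2"]
      closed_segment_subset[OF _ _ convex_ball, of "of_real (- 1/2)" 0 1 z] by auto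
  then have "starlike ?S"
    unfolding starlike_def by (intro bexI[of _ "of_real (- 1/2)"]) (auto simp: complex_slot_right_eq)
  then have "connected ?S" by (rule starlike_imp_connected)
  moreover have "open ?S"
    by (intro open_Int open_ball open_Compl closed_slot_right)
  ultimately show ?thesis
  proof (intro holomorphic_eq_if_eq_on_real_interval[where S = ?S and a = "- 1" and b = 0 and z = w
        and f = "hyp2F1_reg_series (\<nu> + 1) (- \<nu>) (1/2)" and g = "chebyshev_closed_form \<nu>"])
    show "hyp2F1_reg_series (\<nu> + 1) (- \<nu>) (1/2) holomorphic_on ?S" "chebyshev_closed_form \<nu> holomorphic_on ?S"
      by (auto intro: holomorphic_on_subset[OF hyp2F1_reg_series_holomorphic] holomorphic_on_subset[OF chebyshev_closed_form_holomorphic])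
    fix x :: real assume x: "- 1 < x" "x < 0"
    define t where "t = arsinh (sqrt (- x))"
    have sinh: "sinh t = sqrt (- x)" by (simp add: t_def sinh_arsinh_real)
    then have "sinh t > 0" "sinh t < 1" using x by (auto simp: real_sqrt_lt_1_iff)
    then have t: "t > 0" and disc: "\<i> * complex_of_real t \<in> sin_disc"
      by (auto intro!: imaginary_mem_sin_disc)
    have x_eq: "x = - (sinh t)\<^sup>2" using sinh x by simp
    have "cos ((2 * \<nu> + 1) * (\<i> * of_real t)) = cosh ((2 * \<nu> + 1) * of_real t)"
      by (simp add: cosh_conv_cos mult_ac)
    then have "of_real (cosh t) * hyp2F1_reg_series (\<nu> + 1) (- \<nu>) (1/2) (of_real x) =
        cosh ((2 * \<nu> + 1) * of_real t) / of_real (sqrt pi)"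
      using cos_mult_hyp2F1_reg_series_half[OF disc, of \<nu>] by (simp add: x_eq sin_cos_imaginary power_mult_distrib)
    moreover have "complex_of_real (cosh t) \<noteq> 0" by simp
    ultimately show "hyp2F1_reg_series (\<nu> + 1) (- \<nu>) (1/2) (of_real x) = chebyshev_closed_form \<nu> (of_real x)"
      unfolding x_eq chebyshev_closed_form_sinh[OF t] by (simp add: field_simps)
  qed (use w in \<open>auto simp: complex_slot_right_eq\<close>)
qed

lemma slit_plane_eq: "slit_plane = ball 0 1 \<union> - (complex_of_real ` {0..})"
proof -
  have "w \<in> ball 0 1 \<union> - (complex_of_real ` {0..})" if w: "w \<in> slit_plane" for w
  proof (cases "w \<in> complex_of_real ` {0..}")
    case True
    then obtain x where "x \<ge> 0" "w = of_real x" by auto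
    then have "x < 1" using w by (auto simp: slit_plane_def not_le[symmetric])
    then show ?thesis using \<open>x \<ge> 0\<close> \<open>w = of_real x\<close> by simp
  qed simp
  then show ?thesis
    using ball_subset_slit_plane by (auto simp: slit_plane_def)
qed

lemma hyp2F1_reg_continuable_half: "hyp2F1_reg_continuable (\<nu> + 1) (- \<nu>) (1/2)"
proof -
  let ?F = "\<lambda>w. if w \<in> ball 0 1 then hyp2F1_reg_series (\<nu> + 1) (- \<nu>) (1/2) w else chebyshev_closed_form \<nu> w"
  have "?F holomorphic_on ball 0 1 \<union> - (complex_of_real ` {0..})"
    by (intro holomorphic_on_If_Un hyp2F1_reg_series_holomorphic chebyshev_closed_form_holomorphic
        open_ball open_Compl closed_slot_right)
       (auto intro: chebyshev_closed_form_eq_series)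
  then show ?thesis
    unfolding hyp2F1_reg_continuable_def slit_plane_eq by (intro exI[of _ ?F]) simp
qed

lemma hyp2F1_reg_continuable_legendre: "hyp2F1_reg_continuable (\<nu> + 1) (- \<nu>) c"
proof -
  obtain k :: nat where k: "real k > 1/2 - Re c"
    using reals_Archimedean2 by blast
  have "hyp2F1_reg_continuable (\<nu> + 1) (- \<nu>) (1/2 + (c + of_nat k - 1/2))"
    by (rule hyp2F1_reg_continuable_add[OF hyp2F1_reg_continuable_half]) (use k in auto)
  then have "hyp2F1_reg_continuable (\<nu> + 1) (- \<nu>) (c + of_nat k)" by simp
  then show ?thesis
  proof (induction k)
    case (Suc k)
    then have "hyp2F1_reg_continuable (\<nu> + 1) (- \<nu>) (c + of_nat k + 1)" by (simp add: add_ac)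
    then show ?case by (rule Suc.IH[OF hyp2F1_reg_continuable_lower])
  qed simp
qed

section \<open>The Mehler--Dirichlet formula\<close>

lemma norm_hyp2F1_reg_series_le:
  assumes "norm w \<le> r" "r < 1"
  shows "norm (hyp2F1_reg_series a b c w) \<le> (\<Sum>n. norm (hyp2F1_reg_coeff a b c n) * r ^ n)"
proof -
  have r: "0 \<le> r" using assms(1) norm_ge_zero[of w] by linarith
  have "norm (\<Sum>n. hyp2F1_reg_coeff a b c n * w ^ n) \<le> (\<Sum>n. norm (hyp2F1_reg_coeff a b c n) * r ^ n)"
    by (rule norm_suminf_le[OF _ summable_norm_hyp2F1_reg_coeff[OF r assms(2)]])
       (auto simp: norm_mult norm_power intro!: mult_left_mono power_mono assms(1))
  then show ?thesis
    by (simp add: hyp2F1_reg_series_def hyp2F1_reg_coeff_def)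
qed

lemma Beta_weight_mult_hyp2F1_reg_series_sin_half:
  fixes m b \<eta> :: real
  assumes b: "0 < b" "b < pi" and \<eta>: "0 < \<eta>" "\<eta> < b"
  defines "r \<equiv> (sin (\<eta>/2) / sin (b/2))\<^sup>2"
  shows "(sin (\<eta>/2) * cos (\<eta>/2) / (sin (b/2))\<^sup>2) *\<^sub>R (Beta_weight (1/2) (1/2 - of_real m) r *
      hyp2F1_reg_series (\<nu> + 1) (- \<nu>) (1/2) (of_real ((sin (b/2))\<^sup>2) * of_real r)) =
    of_real (2 powr (m + 1/2) * sin (b/2) powr (2 * m) / sqrt pi) *
      (cos ((\<nu> + 1/2) * of_real \<eta>) * of_real ((cos \<eta> - cos b) powr (- m - 1/2)))"
proof -
  let ?F = "hyp2F1_reg_series (\<nu> + 1) (- \<nu>) (1/2)" and ?w = "complex_of_real ((sin (b/2))\<^sup>2)"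
  let ?K = "2 powr (m + 1/2) * sin (b/2) powr (2 * m)" and ?p = "(cos \<eta> - cos b) powr (- m - 1/2)"
  have r: "r \<in> {0<..<1}"
    unfolding r_def using bij_betwE[OF bij_betw_sin_half[OF b]] \<eta> by simp
  have "complex_of_real (\<eta>/2) \<in> sin_disc"
    using \<eta> b by (intro of_real_mem_sin_disc) auto
  moreover have "?w * of_real r = (sin (of_real (\<eta>/2)))\<^sup>2"
  proof -
    have "sin (b/2) > 0" using b by (intro sin_gt_zero) auto
    then have "(sin (b/2))\<^sup>2 * r = (sin (\<eta>/2))\<^sup>2" by (simp add: r_def power_divide)
    then show ?thesis by (simp only: sin_of_real of_real_mult[symmetric] of_real_power[symmetric])
  qed
  moreover have "(2 * \<nu> + 1) * of_real (\<eta>/2) = (\<nu> + 1/2) * of_real \<eta>"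
    by (simp add: algebra_simps)
  ultimately have cos_F: "cos (of_real (\<eta>/2)) * ?F (?w * of_real r) = cos ((\<nu> + 1/2) * of_real \<eta>) / of_real (sqrt pi)"
    by (simp only: cos_mult_hyp2F1_reg_series_half)
  have "(sin (\<eta>/2) * cos (\<eta>/2) / (sin (b/2))\<^sup>2) *\<^sub>R (Beta_weight (1/2) (1/2 - of_real m) r * ?F (?w * of_real r)) =
      complex_of_real (sin (\<eta>/2) * cos (\<eta>/2) / (sin (b/2))\<^sup>2 * Beta_weight (1/2) (1/2 - m) r) * ?F (?w * of_real r)"
    using Beta_weight_of_real[OF r, of "1/2" "1/2 - m"] by (simp add: scaleR_conv_of_real)
  also have "\<dots> = of_real (?K * ?p) * (cos (of_real (\<eta>/2)) * ?F (?w * of_real r))"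
    unfolding r_def Beta_weight_sin_half[OF b(2) \<eta>] by (simp only: of_real_mult cos_of_real mult_ac)
  finally show ?thesis
    unfolding cos_F by simp
qed

lemma mehler_dirichlet_formula:
  assumes m: "m < 1/2" and b: "0 < b" "b < pi"
  shows "hyp2F1_reg_series (\<nu> + 1) (- \<nu>) (1 - of_real m) (of_real ((sin (b/2))\<^sup>2)) =
    rGamma (1/2 - of_real m) * of_real (2 powr (m + 1/2) * sin (b/2) powr (2 * m) / sqrt pi) *
    (LINT \<eta>:{0<..<b}|lborel. cos ((\<nu> + 1/2) * of_real \<eta>) * of_real ((cos \<eta> - cos b) powr (- m - 1/2)))"
proof -
  let ?F = "hyp2F1_reg_series (\<nu> + 1) (- \<nu>) (1/2)"
  let ?w = "complex_of_real ((sin (b/2))\<^sup>2)"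
  let ?K = "2 powr (m + 1/2) * sin (b/2) powr (2 * m)"
  let ?f = "\<lambda>r. Beta_weight (1/2) (1/2 - of_real m) r * ?F (?w * of_real r)"
  have w: "norm ?w < 1"
    using sin_sq_less_1[of "b/2"] b by (simp only: norm_of_real) simp
  have scaled: "norm (?w * of_real r) \<le> norm ?w" if "r \<in> {0<..<1}" for r
    using that mult_left_le[of r "norm ?w"] by (simp add: norm_mult)
  have F: "continuous_on {0<..<1} (\<lambda>r. ?F (?w * of_real r))"
    by (rule continuous_on_compose2[OF holomorphic_on_imp_continuous_on[OF hyp2F1_reg_series_holomorphic]])
       (use scaled w in \<open>force intro!: continuous_intros\<close>)+
  have int: "set_integrable lborel {0<..<1} ?f"
    by (rule set_integrable_mult_bounded_continuous[OF _ set_integrable_Beta_weight F norm_hyp2F1_reg_series_le[OF scaled w]])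
       (use m in auto)
  have "Gamma (1/2 - of_real m) * hyp2F1_reg_series (\<nu> + 1) (- \<nu>) (1 - of_real m) ?w = (LINT r:{0<..<1}|lborel. ?f r)"
    using set_integral_Beta_weight_hyp2F1_reg_series[OF w, of "1/2" "1/2 - of_real m"] m by simp
  also have "\<dots> = (LINT \<eta>:{0<..<b}|lborel. (sin (\<eta>/2) * cos (\<eta>/2) / (sin (b/2))\<^sup>2) *\<^sub>R ?f ((sin (\<eta>/2) / sin (b/2))\<^sup>2))"
    by (rule set_integral_sin_half_substitution(2)[OF b _ int, symmetric]) (intro continuous_on_mult continuous_on_Beta_weight F)
  also have "\<dots> = (LINT \<eta>:{0<..<b}|lborel. of_real (?K / sqrt pi) *
      (cos ((\<nu> + 1/2) * of_real \<eta>) * of_real ((cos \<eta> - cos b) powr (- m - 1/2))))"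
    by (rule set_integral_cong) (simp only: greaterThanLessThan_iff Beta_weight_mult_hyp2F1_reg_series_sin_half[OF b])
  finally have "rGamma (1/2 - of_real m) * (Gamma (1/2 - of_real m) * hyp2F1_reg_series (\<nu> + 1) (- \<nu>) (1 - of_real m) ?w) =
      rGamma (1/2 - of_real m) * (of_real (?K / sqrt pi) *
      (LINT \<eta>:{0<..<b}|lborel. cos ((\<nu> + 1/2) * of_real \<eta>) * of_real ((cos \<eta> - cos b) powr (- m - 1/2))))"
    by (simp only: set_integral_mult_right)
  moreover have "rGamma (1/2 - complex_of_real m) * Gamma (1/2 - of_real m) = 1"
    using not_nonpos_Ints_Re[of "1/2 - complex_of_real m"] m by (simp add: Gamma_def rGamma_eq_zero_iff)
  ultimately show ?thesis
    by (simp only: mult.assoc[symmetric] mult_1)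
qed

section \<open>The expansion off the real axis\<close>

definition coth_half :: "complex \<Rightarrow> complex" where
  "coth_half \<xi> = cosh (\<xi>/2) / sinh (\<xi>/2)"

lemma Re_sinh_complex: "Re (sinh t) = sinh (Re t) * cos (Im t)"
  and Im_sinh_complex: "Im (sinh t) = cosh (Re t) * sin (Im t)"
  by (simp_all add: sinh_def cosh_def Re_exp Im_exp algebra_simps)

lemma sin_nonzero_of_abs_less_pi: "y \<noteq> 0 \<Longrightarrow> \<bar>y\<bar> < pi \<Longrightarrow> sin y \<noteq> (0::real)"
  using sin_gt_zero[of "\<bar>y\<bar>"] by (auto simp: abs_if split: if_splits)

lemma sinh_nonzero:
  assumes "sin (Im \<xi>) \<noteq> 0"
  shows "Im (sinh \<xi>) \<noteq> 0" "sinh \<xi> \<noteq> 0" "sinh (\<xi>/2) \<noteq> 0"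
proof -
  show Im: "Im (sinh \<xi>) \<noteq> 0"
    using assms by (simp add: Im_sinh_complex)
  then show "sinh \<xi> \<noteq> 0" by auto
  then show "sinh (\<xi>/2) \<noteq> 0" using sinh_double[of "\<xi>/2"] by auto
qed

lemma sinh_nonzero_Re:
  assumes "Re \<xi> \<noteq> 0"
  shows "sinh \<xi> \<noteq> (0 :: complex)"
proof
  assume "sinh \<xi> = 0"
  then have "sinh (Re \<xi>) * cos (Im \<xi>) = 0" "cosh (Re \<xi>) * sin (Im \<xi>) = 0"
    by (simp_all flip: Re_sinh_complex Im_sinh_complex)
  then have "cos (Im \<xi>) = 0" "sin (Im \<xi>) = 0" using assms by auto
  then show False using sin_cos_squared_add[of "Im \<xi>"] by simp
qed

lemma exp_div_sinh: "exp \<xi> / sinh \<xi> = 2 / (1 - exp (- 2 * \<xi>) :: complex)"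
proof -
  have "sinh \<xi> = exp \<xi> * ((1 - exp (- 2 * \<xi>)) / 2)"
    by (simp add: sinh_field_def algebra_simps flip: exp_add)
  then have "exp \<xi> / sinh \<xi> = exp \<xi> / (exp \<xi> * ((1 - exp (- 2 * \<xi>)) / 2))"
    by (simp only:)
  also have "\<dots> = 2 / (1 - exp (- 2 * \<xi>))"
    by simp
  finally show ?thesis .
qed

lemma minus_exp_div_sinh: "- exp (- \<xi>) / sinh \<xi> = 2 / (1 - exp (2 * \<xi>) :: complex)"
  using exp_div_sinh[of "- \<xi>"] by simp

lemma exp_div_sinh_notin_nonpos_Reals:
  assumes "sin (Im \<xi>) \<noteq> 0"
  shows "exp \<xi> / sinh \<xi> \<notin> \<real>\<^sub>\<le>\<^sub>0" and "- exp (- \<xi>) / sinh \<xi> \<notin> \<real>\<^sub>\<le>\<^sub>0"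
proof -
  have notin: "exp \<xi> / sinh \<xi> \<notin> \<real>\<^sub>\<le>\<^sub>0" if "sin (Im \<xi>) \<noteq> 0" for \<xi>
  proof
    assume "exp \<xi> / sinh \<xi> \<in> \<real>\<^sub>\<le>\<^sub>0"
    then have "inverse (2 / (1 - exp (- 2 * \<xi>))) \<in> \<real>\<^sub>\<le>\<^sub>0"
      unfolding exp_div_sinh by (simp only: nonpos_Reals_inverse_iff)
    then have Re: "Re (exp (- 2 * \<xi>)) \<ge> 1" and "Im (exp (- 2 * \<xi>)) = 0"
      by (simp_all add: complex_nonpos_Reals_iff)
    then have "cos (Im \<xi>) = 0"
      using that by (simp add: Im_exp sin_double)
    then have "Re (exp (- 2 * \<xi>)) \<le> 0"
      by (simp add: Re_exp cos_double mult_nonneg_nonpos)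
    then show False using Re by linarith
  qed
  from notin[OF assms] notin[of "- \<xi>"] assms
  show "exp \<xi> / sinh \<xi> \<notin> \<real>\<^sub>\<le>\<^sub>0" "- exp (- \<xi>) / sinh \<xi> \<notin> \<real>\<^sub>\<le>\<^sub>0" by simp_all
qed

lemma coth_half_Moebius:
  assumes "sinh (\<xi>/2) \<noteq> 0"
  shows "coth_half \<xi> + 1 = exp \<xi> * (coth_half \<xi> - 1)" and "coth_half \<xi> \<noteq> 1"
proof -
  have plus: "coth_half \<xi> + 1 = exp (\<xi>/2) / sinh (\<xi>/2)" and minus: "coth_half \<xi> - 1 = exp (- (\<xi>/2)) / sinh (\<xi>/2)"
    using assms cosh_plus_sinh[of "\<xi>/2"] cosh_minus_sinh[of "\<xi>/2"] by (simp_all add: coth_half_def field_simps)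
  show "coth_half \<xi> + 1 = exp \<xi> * (coth_half \<xi> - 1)"
    unfolding plus minus by (simp flip: exp_add)
  show "coth_half \<xi> \<noteq> 1" using minus assms by auto
qed

lemma coth_half_notin_nonpos_Reals:
  assumes "sin (Im \<xi>) \<noteq> 0"
  shows "coth_half \<xi> \<notin> \<real>\<^sub>\<le>\<^sub>0"
proof
  assume "coth_half \<xi> \<in> \<real>\<^sub>\<le>\<^sub>0"
  then obtain r where r: "coth_half \<xi> = of_real r" by (auto elim: nonpos_Reals_cases)
  note Moebius = coth_half_Moebius[OF sinh_nonzero(3)[OF assms], unfolded r]
  have "exp \<xi> = (of_real r + 1) / (of_real r - 1)"
    using Moebius by (simp add: field_simps)
  then have "exp \<xi> = of_real ((r + 1) / (r - 1))" by simp
  then have "Im (exp \<xi>) = 0" by (simp only: Im_complex_of_real)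
  then show False using assms by (simp add: Im_exp)
qed

lemma Re_coth_half_pos:
  assumes "Re \<xi> > 0"
  shows "Re (coth_half \<xi>) > 0"
proof -
  have "sinh (\<xi>/2) \<noteq> 0" by (rule sinh_nonzero_Re) (use assms in simp)
  note Moebius = coth_half_Moebius[OF this]
  have "1 * norm (coth_half \<xi> - 1) < norm (exp \<xi>) * norm (coth_half \<xi> - 1)"
    using assms Moebius(2) by (intro mult_strict_right_mono) auto
  also have "\<dots> = norm (coth_half \<xi> + 1)"
    unfolding Moebius(1) by (simp only: norm_mult)
  finally have "(norm (coth_half \<xi> - 1))\<^sup>2 < (norm (coth_half \<xi> + 1))\<^sup>2"
    by (intro power_strict_mono) auto
  then show ?thesis
    unfolding cmod_power2 by (simp add: power2_eq_square algebra_simps)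
qed

lemma cosh_arg_slit_plane:
  assumes "\<xi> \<in> D1 \<or> sin (Im \<xi>) \<noteq> 0"
  shows "(1 - cosh \<xi>) / 2 \<in> slit_plane"
proof (rule ccontr)
  assume "(1 - cosh \<xi>) / 2 \<notin> slit_plane"
  then obtain r where r: "r \<ge> 1" "(1 - cosh \<xi>) / 2 = of_real r" by (auto simp: slit_plane_def)
  then have "cosh \<xi> = of_real (1 - 2 * r)" by (simp add: field_simps)
  then have Re: "cosh (Re \<xi>) * cos (Im \<xi>) \<le> - 1" and Im: "sinh (Re \<xi>) * sin (Im \<xi>) = 0"
    using r by (simp_all flip: Re_cosh_complex Im_cosh_complex)
  show False
  proof (cases "sin (Im \<xi>) = 0")
    case True
    then have "\<xi> \<in> D1" "Im \<xi> = 0" using assms sin_nonzero_of_abs_less_pi[of "Im \<xi>"] by (auto simp: D1_def)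
    then show False using Re cosh_real_pos[of "Re \<xi>"] by simp
  next
    case False
    then have "cos (Im \<xi>) \<le> - 1" using Re Im by simp
    then have "cos (Im \<xi>) = - 1" using cos_ge_minus_one[of "Im \<xi>"] by linarith
    then show False using False sin_squared_eq[of "Im \<xi>"] by simp
  qed
qed

lemma imaginary_powr:
  assumes s: "s > 0" and \<sigma>: "\<sigma> = 1 \<or> \<sigma> = (- 1 :: real)"
  shows "(\<i> * complex_of_real (\<sigma> * s)) powr a = of_real s powr a * exp (\<i> * of_real (\<sigma> * (pi / 2)) * a)"
proof -
  have "Ln (of_real s * (\<i> * of_real \<sigma>)) = of_real (ln s) + Ln (\<i> * complex_of_real \<sigma>)"
    using s \<sigma> by (subst Ln_times_of_real) (auto simp: Ln_of_real)
  also have "Ln (\<i> * complex_of_real \<sigma>) = \<i> * of_real (\<sigma> * (pi / 2))"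
    using \<sigma> by auto
  finally have "Ln (\<i> * of_real (\<sigma> * s)) = of_real (ln s) + \<i> * of_real (\<sigma> * (pi / 2))"
    by (simp add: mult_ac)
  moreover have "\<i> * complex_of_real (\<sigma> * s) \<noteq> 0" "complex_of_real s \<noteq> 0" "Ln (of_real s) = of_real (ln s)"
    using s \<sigma> by (auto simp: Ln_of_real)
  ultimately show ?thesis
    by (simp add: powr_def distrib_left exp_add mult_ac)
qed

lemma sinh_cosh_imaginary:
  "sinh (\<i> * complex_of_real c) = \<i> * of_real (sin c)"
  "cosh (\<i> * complex_of_real c) = of_real (cos c)"
  by (simp_all add: sinh_conv_sin cosh_conv_cos mult.assoc[symmetric] sin_of_real cos_of_real)

lemma exp_div_sinh_imaginary:
  assumes "sin c \<noteq> 0"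
  shows "- exp (- (\<i> * complex_of_real c)) / sinh (\<i> * of_real c) = 1 + \<i> * of_real (cot c)"
    and "exp (\<i> * complex_of_real c) / sinh (\<i> * of_real c) = 1 + \<i> * of_real (cot (- c))"
proof -
  have sin: "complex_of_real (sin c) \<noteq> 0" using assms by simp
  have exp: "exp (\<i> * complex_of_real c) = of_real (cos c) + \<i> * of_real (sin c)"
    "exp (- (\<i> * complex_of_real c)) = of_real (cos c) - \<i> * of_real (sin c)"
    using cis_conv_exp[of c] cis_conv_exp[of "- c"] by (simp_all add: complex_eq_iff)
  show "- exp (- (\<i> * complex_of_real c)) / sinh (\<i> * of_real c) = 1 + \<i> * of_real (cot c)"
    "exp (\<i> * complex_of_real c) / sinh (\<i> * of_real c) = 1 + \<i> * of_real (cot (- c))"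
    unfolding exp sinh_cosh_imaginary using sin by (simp_all add: cot_def field_simps)
qed

definition connection_coeff :: "real \<Rightarrow> complex \<Rightarrow> complex" where
  "connection_coeff \<sigma> \<mu> = of_real \<sigma> * \<i> * exp (- (of_real (\<sigma> * pi) * \<i> * \<mu>))"

definition legendre_expansion :: "real \<Rightarrow> nat \<Rightarrow> complex \<Rightarrow> complex \<Rightarrow> complex \<Rightarrow> complex" where
  "legendre_expansion \<sigma> N \<xi> \<mu> \<nu> =
    exp ((\<nu> + 1/2) * \<xi>) * legendre_sum N (- exp (- \<xi>) / sinh \<xi>) \<mu> \<nu> +
    connection_coeff \<sigma> \<mu> * exp (- (\<nu> + 1/2) * \<xi>) * legendre_sum N (exp \<xi> / sinh \<xi>) \<mu> \<nu>"

definition legendre_prefactor :: "complex \<Rightarrow> complex \<Rightarrow> complex \<Rightarrow> complex" where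
  "legendre_prefactor \<xi> \<mu> \<nu> = Gamma (\<nu> - \<mu> + 1) * csqrt (2 * of_real pi * sinh \<xi>) * coth_half \<xi> powr \<mu>"

lemma mehler_kernel_ray_integral_eq_legendre_rem:
  assumes m: "\<bar>m\<bar> < 1/2" and \<nu>: "Re \<nu> > - 1/2" and b: "0 < b" "b < pi" and c: "\<bar>c\<bar> = b"
  shows "rGamma (1/2 - of_real m) * Gamma (\<nu> + 1 - of_real m) *
      (LINT \<theta>:{..<0}|lborel. mehler_kernel b m \<nu> (of_real \<theta> + \<i> * of_real c)) =
    (- \<i> * of_real (sin c)) powr of_real (- m - 1/2) *
      (exp (\<i> * (\<nu> + 1/2) * of_real c) * legendre_rem 0 (1 + \<i> * of_real (cot c)) (of_real m) \<nu>)"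
proof -
  have "1 + \<i> * complex_of_real (cot c) \<notin> \<real>\<^sub>\<le>\<^sub>0"
    by (rule not_nonpos_Reals_Re) simp
  from legendre_rem_0_eq_euler_integral[OF m \<nu> this] show ?thesis
    unfolding mehler_kernel_ray_integral[OF m \<nu> b c] by (simp only: mult_ac)
qed

lemma exp_mult_connection_coeff:
  fixes m \<sigma> :: real
  assumes \<sigma>: "\<sigma> = 1 \<or> \<sigma> = - 1"
  shows "exp (\<i> * of_real (\<sigma> * pi * (m + 1/2) / 2)) * connection_coeff \<sigma> (of_real m) =
    - exp (\<i> * of_real (- \<sigma> * pi * (m + 1/2) / 2))"
proof -
  have i: "of_real \<sigma> * \<i> = exp (\<i> * of_real (\<sigma> * pi / 2))"
    using \<sigma> cis_conv_exp[of "pi / 2"] cis_conv_exp[of "- (pi / 2)"] by auto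
  have "exp (\<i> * of_real (\<sigma> * pi * (m + 1/2) / 2)) * connection_coeff \<sigma> (of_real m) =
      exp (\<i> * of_real (- \<sigma> * pi * (m + 1/2) / 2)) * exp (\<i> * of_real (\<sigma> * pi))"
    unfolding connection_coeff_def i exp_add[symmetric] by (rule arg_cong[of _ _ exp]) (simp add: field_simps)
  also have "exp (\<i> * of_real (\<sigma> * pi)) = - 1"
    using \<sigma> by (auto simp: exp_minus)
  finally show ?thesis by simp
qed

lemma legendre_rem_0_strip_identity:
  fixes m b \<sigma> :: real
  assumes m: "- 1/2 < m" "m < 0" and \<nu>: "Re \<nu> > - 1/2" and b: "0 < b" "b < pi" and \<sigma>: "\<sigma> = 1 \<or> \<sigma> = - 1"
  defines "R \<equiv> \<lambda>c. exp (\<i> * (\<nu> + 1/2) * of_real c) * legendre_rem 0 (1 + \<i> * of_real (cot c)) (of_real m) \<nu>"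
  shows "of_real (sin b powr (- m - 1/2)) * exp (\<i> * of_real (\<sigma> * pi * (m + 1/2) / 2)) *
      (R (\<sigma> * b) + connection_coeff \<sigma> (of_real m) * R (- (\<sigma> * b))) =
    of_real \<sigma> * \<i> * rGamma (1/2 - of_real m) * Gamma (\<nu> + 1 - of_real m) *
      (2 * (LINT \<eta>:{0<..<b}|lborel. cos ((\<nu> + 1/2) * of_real \<eta>) * of_real ((cos \<eta> - cos b) powr (- m - 1/2))))"
proof -
  define ray where "ray c = (LINT \<theta>:{..<0}|lborel. mehler_kernel b m \<nu> (of_real \<theta> + \<i> * of_real c))" for c
  define E where "E \<rho> = exp (\<i> * of_real (\<rho> * pi * (m + 1/2) / 2))" for \<rho> :: real
  let ?s = "complex_of_real (sin b powr (- m - 1/2))"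
  let ?G = "rGamma (1/2 - of_real m) * Gamma (\<nu> + 1 - of_real m)"
  let ?J = "LINT \<eta>:{0<..<b}|lborel. cos ((\<nu> + 1/2) * of_real \<eta>) * of_real ((cos \<eta> - cos b) powr (- m - 1/2))"
  have ray: "?G * ray (\<rho> * b) = ?s * E \<rho> * R (\<rho> * b)" if \<rho>: "\<rho> = 1 \<or> \<rho> = - 1" for \<rho>
  proof -
    have "sin b > 0" using b by (intro sin_gt_zero)
    moreover have "- \<i> * complex_of_real (sin (\<rho> * b)) = \<i> * of_real (- \<rho> * sin b)"
      using \<rho> by auto
    moreover have "- \<rho> = 1 \<or> - \<rho> = - 1" using \<rho> by auto
    ultimately have "(- \<i> * complex_of_real (sin (\<rho> * b))) powr of_real (- m - 1/2) =
        of_real (sin b) powr of_real (- m - 1/2) * exp (\<i> * of_real (- \<rho> * (pi / 2)) * of_real (- m - 1/2))"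
      by (simp only: imaginary_powr)
    also have "complex_of_real (sin b) powr of_real (- m - 1/2) = ?s"
      using \<open>sin b > 0\<close> by (intro powr_of_real) simp
    also have "\<i> * of_real (- \<rho> * (pi / 2)) * complex_of_real (- m - 1/2) = \<i> * of_real (\<rho> * pi * (m + 1/2) / 2)"
      by (simp add: field_simps)
    finally show ?thesis
      using mehler_kernel_ray_integral_eq_legendre_rem[of m \<nu> b "\<rho> * b"] m \<nu> b \<rho>
      by (auto simp: ray_def E_def R_def abs_mult)
  qed
  have "ray b - ray (- b) = \<i> * (2 * ?J)"
    using mehler_kernel_strip_identity[OF m \<nu> b] mehler_kernel_imaginary_integral[of m \<nu> b] m \<nu> b by (simp add: ray_def)
  then have "?G * ray (\<sigma> * b) - ?G * ray (- \<sigma> * b) = of_real \<sigma> * \<i> * ?G * (2 * ?J)"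
    using \<sigma> by (auto simp: algebra_simps)
  then have "?s * E \<sigma> * R (\<sigma> * b) - ?s * E (- \<sigma>) * R (- \<sigma> * b) = of_real \<sigma> * \<i> * ?G * (2 * ?J)"
    using \<sigma> ray[of \<sigma>] ray[of "- \<sigma>"] by auto
  moreover have "E (- \<sigma>) = - (E \<sigma> * connection_coeff \<sigma> (of_real m))"
    unfolding E_def exp_mult_connection_coeff[OF \<sigma>] by simp
  ultimately show ?thesis
    by (simp add: E_def algebra_simps)
qed

lemma legendre_prefactor_imaginary:
  fixes m b \<sigma> :: real
  assumes b: "0 < b" "b < pi" and \<sigma>: "\<sigma> = 1 \<or> \<sigma> = - 1"
  shows "legendre_prefactor (\<i> * of_real (\<sigma> * b)) (of_real m) \<nu> =
    Gamma (\<nu> - of_real m + 1) * of_real (sqrt (2 * pi * sin b) * (cos (b/2) / sin (b/2)) powr m) *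
      exp (\<i> * of_real (\<sigma> * pi * (1/2 - m) / 2))"
proof -
  let ?\<xi> = "\<i> * complex_of_real (\<sigma> * b)"
  have pos: "2 * pi * sin b > 0" "cos (b/2) / sin (b/2) > 0" "sin (b/2) > 0"
    using b by (auto intro!: mult_pos_pos divide_pos_pos sin_gt_zero cos_gt_zero)
  have "2 * of_real pi * sinh ?\<xi> = \<i> * of_real (\<sigma> * (2 * pi * sin b))"
    using \<sigma> by (auto simp: sinh_cosh_imaginary)
  then have "csqrt (2 * of_real pi * sinh ?\<xi>) = of_real (2 * pi * sin b) powr (1/2) * exp (\<i> * of_real (\<sigma> * (pi / 2)) * (1/2))"
    unfolding csqrt_conv_powr by (simp only: imaginary_powr[OF pos(1) \<sigma>])
  also have "complex_of_real (2 * pi * sin b) powr (1/2) = of_real (sqrt (2 * pi * sin b))"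
    using pos(1) powr_of_real[of "2 * pi * sin b" "1/2"] by (simp add: powr_half_sqrt)
  finally have csqrt: "csqrt (2 * of_real pi * sinh ?\<xi>) = of_real (sqrt (2 * pi * sin b)) * exp (\<i> * of_real (\<sigma> * (pi / 2)) * (1/2))" .
  have half: "?\<xi> / 2 = \<i> * of_real (\<sigma> * b / 2)" by simp
  have "coth_half ?\<xi> = \<i> * of_real (- \<sigma> * (cos (b/2) / sin (b/2)))"
    unfolding coth_half_def half sinh_cosh_imaginary using \<sigma> pos by (auto simp: field_simps)
  moreover have "- \<sigma> = 1 \<or> - \<sigma> = - 1" using \<sigma> by auto
  ultimately have "coth_half ?\<xi> powr of_real m =
      of_real (cos (b/2) / sin (b/2)) powr of_real m * exp (\<i> * of_real (- \<sigma> * (pi / 2)) * of_real m)"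
    by (simp only: imaginary_powr[OF pos(2)])
  also have "complex_of_real (cos (b/2) / sin (b/2)) powr of_real m = of_real ((cos (b/2) / sin (b/2)) powr m)"
    using pos(2) by (intro powr_of_real) simp
  finally have coth: "coth_half ?\<xi> powr of_real m =
      of_real ((cos (b/2) / sin (b/2)) powr m) * exp (\<i> * of_real (- \<sigma> * (pi / 2)) * of_real m)" .
  have "exp (\<i> * of_real (\<sigma> * pi * (1/2 - m) / 2)) =
      exp (\<i> * of_real (\<sigma> * (pi / 2)) * (1/2)) * exp (\<i> * of_real (- \<sigma> * (pi / 2)) * of_real m)"
    by (simp add: exp_add[symmetric] field_simps)
  then show ?thesis
    unfolding legendre_prefactor_def csqrt coth by (simp only: of_real_mult mult_ac)
qed

lemma sqrt_sin_mult_cot_half_powr: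
  fixes b m :: real
  assumes b: "0 < b" "b < pi"
  shows "sqrt (2 * pi * sin b) * (cos (b/2) / sin (b/2)) powr m * (2 powr (m + 1/2) * sin (b/2) powr (2 * m) / sqrt pi) *
    sin b powr (- m - 1/2) = 2"
proof -
  define B C where "B = sin (b/2)" and "C = cos (b/2)"
  have pos: "B > 0" "C > 0"
    unfolding B_def C_def using b by (auto intro!: sin_gt_zero cos_gt_zero)
  have sin: "sin b = 2 * B * C"
    using sin_double[of "b/2"] by (simp add: B_def C_def)
  have "sqrt (2 * pi * sin b) = sqrt pi * (2 * sin b) powr (1/2)"
    using pos sin by (simp add: powr_half_sqrt real_sqrt_mult)
  then have "sqrt (2 * pi * sin b) * (C / B) powr m * (2 powr (m + 1/2) * B powr (2 * m) / sqrt pi) * sin b powr (- m - 1/2) =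
      (2 * sin b) powr (1/2) * (C / B) powr m * (2 powr (m + 1/2) * B powr (2 * m)) * sin b powr (- m - 1/2)"
    by simp
  also have "\<dots> = exp (1/2 * ln (2 * sin b) + m * ln (C / B) + ((m + 1/2) * ln 2 + 2 * m * ln B) + (- m - 1/2) * ln (sin b))"
    using pos sin by (simp only: exp_add powr_def) simp
  also have "1/2 * ln (2 * sin b) + m * ln (C / B) + ((m + 1/2) * ln 2 + 2 * m * ln B) + (- m - 1/2) * ln (sin b) = ln 2"
  proof -
    have "ln (sin b) = ln 2 + ln B + ln C" "ln (2 * sin b) = ln 2 + ln (sin b)" "ln (C / B) = ln C - ln B"
      using pos sin by (simp_all only: ln_mult ln_div zero_less_mult_iff) simp_all
    then show ?thesis by (simp only:) (simp add: field_simps)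
  qed
  finally show ?thesis by (simp add: B_def C_def)
qed

lemma legendre_expansion_0_imaginary:
  fixes m b \<sigma> :: real
  assumes m: "- 1/2 < m" "m < 0" and \<nu>: "Re \<nu> > - 1/2" and b: "0 < b" "b < pi" and \<sigma>: "\<sigma> = 1 \<or> \<sigma> = - 1"
    and \<xi>: "\<xi> = \<i> * of_real (\<sigma> * b)"
  shows "legendre_prefactor \<xi> (of_real m) \<nu> * hyp2F1_reg_series (\<nu> + 1) (- \<nu>) (1 - of_real m) ((1 - cosh \<xi>) / 2) =
    legendre_expansion \<sigma> 0 \<xi> (of_real m) \<nu>"
proof -
  let ?G = "rGamma (1/2 - of_real m) * Gamma (\<nu> + 1 - of_real m)"
  let ?J = "LINT \<eta>:{0<..<b}|lborel. cos ((\<nu> + 1/2) * of_real \<eta>) * of_real ((cos \<eta> - cos b) powr (- m - 1/2))"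
  let ?s = "complex_of_real (sin b powr (- m - 1/2))"
  let ?E = "exp (\<i> * of_real (\<sigma> * pi * (m + 1/2) / 2))"
  have sin: "sin b > 0" "sin (\<sigma> * b) \<noteq> 0"
    using \<sigma> b sin_gt_zero[of b] by auto
  let ?A = "complex_of_real (sqrt (2 * pi * sin b) * (cos (b/2) / sin (b/2)) powr m)"
  let ?K = "complex_of_real (2 powr (m + 1/2) * sin (b/2) powr (2 * m) / sqrt pi)"
  have w: "(1 - cosh \<xi>) / 2 = of_real ((sin (b/2))\<^sup>2)"
    using \<sigma> cos_double_sin[of "b/2"] unfolding \<xi> sinh_cosh_imaginary by auto
  have \<Gamma>: "Gamma (\<nu> - of_real m + 1) = Gamma (\<nu> + 1 - complex_of_real m)"
    by (rule arg_cong[of _ _ Gamma]) simp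
  have "m < 1/2" using m by simp
  from mehler_dirichlet_formula[OF this b, of \<nu>]
  have "?s * ?E * (legendre_prefactor \<xi> (of_real m) \<nu> * hyp2F1_reg_series (\<nu> + 1) (- \<nu>) (1 - of_real m) ((1 - cosh \<xi>) / 2)) =
      (?E * exp (\<i> * of_real (\<sigma> * pi * (1/2 - m) / 2))) * (?A * ?K * ?s) * ?G * ?J"
    unfolding w unfolding \<xi> legendre_prefactor_imaginary[OF b \<sigma>] \<Gamma> by (simp only: mult_ac)
  also have "?E * exp (\<i> * of_real (\<sigma> * pi * (1/2 - m) / 2)) = of_real \<sigma> * \<i>"
  proof -
    have "?E * exp (\<i> * of_real (\<sigma> * pi * (1/2 - m) / 2)) = exp (\<i> * of_real (\<sigma> * (pi / 2)))"
      by (simp add: exp_add[symmetric] field_simps)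
    then show ?thesis
      using \<sigma> cis_conv_exp[of "pi / 2"] cis_conv_exp[of "- (pi / 2)"] by auto
  qed
  also have "of_real \<sigma> * \<i> * (?A * ?K * ?s) * ?G * ?J = of_real \<sigma> * \<i> * ?G * (2 * ?J)"
    unfolding of_real_mult[symmetric] sqrt_sin_mult_cot_half_powr[OF b] by simp
  also have "\<dots> = ?s * ?E * legendre_expansion \<sigma> 0 \<xi> (of_real m) \<nu>"
  proof -
    have "(\<nu> + 1/2) * \<xi> = \<i> * (\<nu> + 1/2) * of_real (\<sigma> * b)" "- (\<nu> + 1/2) * \<xi> = \<i> * (\<nu> + 1/2) * of_real (- (\<sigma> * b))"
      by (simp_all add: \<xi> algebra_simps)
    then show ?thesis
      unfolding legendre_expansion_def legendre_sum_def unfolding \<xi> exp_div_sinh_imaginary[OF sin(2)]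
      using legendre_rem_0_strip_identity[OF m \<nu> b \<sigma>] by (simp only: lessThan_0 sum.empty add_0 mult.assoc)
  qed
  finally show ?thesis
    using sin(1) by simp
qed

lemma legendre_expansion_imaginary:
  fixes b \<sigma> :: real
  assumes \<mu>: "\<bar>Re \<mu>\<bar> < real N + 1/2" and \<nu>: "Re \<nu> > real N - 1/2" and b: "0 < b" "b < pi" and \<sigma>: "\<sigma> = 1 \<or> \<sigma> = - 1"
    and \<xi>: "\<xi> = \<i> * of_real (\<sigma> * b)"
  shows "legendre_prefactor \<xi> \<mu> \<nu> * hyp2F1_reg (\<nu> + 1) (- \<nu>) (1 - \<mu>) ((1 - cosh \<xi>) / 2) = legendre_expansion \<sigma> N \<xi> \<mu> \<nu>"
proof -
  let ?S = "{\<mu>. \<bar>Re \<mu>\<bar> < real N + 1/2}"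
  let ?f = "\<lambda>\<mu>. legendre_prefactor \<xi> \<mu> \<nu> * hyp2F1_reg_series (\<nu> + 1) (- \<nu>) (1 - \<mu>) ((1 - cosh \<xi>) / 2)"
  have w: "norm ((1 - cosh \<xi>) / 2) < 1"
  proof -
    have "(1 - cosh \<xi>) / 2 = of_real ((sin (b/2))\<^sup>2)"
      using \<sigma> cos_double_sin[of "b/2"] unfolding \<xi> sinh_cosh_imaginary by auto
    then show ?thesis
      using sin_sq_less_1[of "b/2"] b by (simp only: norm_of_real) simp
  qed
  have "sin (Im \<xi>) \<noteq> 0"
    using \<sigma> b sin_gt_zero[of b] by (auto simp: \<xi>)
  note args = exp_div_sinh_notin_nonpos_Reals[OF this]
  have "?f \<mu> = legendre_expansion \<sigma> N \<xi> \<mu> \<nu>"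
  proof (rule holomorphic_eq_if_eq_on_real_interval[where S = ?S and a = "- 1/2" and b = 0 and z = \<mu> and f = ?f
        and g = "\<lambda>\<mu>. legendre_expansion \<sigma> N \<xi> \<mu> \<nu>"])
    have "(\<lambda>\<mu>. hyp2F1_reg_series (\<nu> + 1) (- \<nu>) (1 - \<mu>) ((1 - cosh \<xi>) / 2)) holomorphic_on ?S"
      by (rule holomorphic_on_compose_gen[OF _ hyp2F1_reg_series_holomorphic_param[OF w], unfolded o_def])
         (auto intro!: holomorphic_intros)
    then show "?f holomorphic_on ?S"
      unfolding legendre_prefactor_def using \<nu> by (intro holomorphic_intros not_nonpos_Ints_Re) auto
    show "(\<lambda>\<mu>. legendre_expansion \<sigma> N \<xi> \<mu> \<nu>) holomorphic_on ?S"
      unfolding legendre_expansion_def connection_coeff_def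
      by (intro holomorphic_intros legendre_sum_holomorphic_order args \<nu>)
    fix m :: real assume m: "- 1/2 < m" "m < 0"
    have "legendre_sum 0 x (of_real m) \<nu> = legendre_sum N x (of_real m) \<nu>" if "x \<notin> \<real>\<^sub>\<le>\<^sub>0" for x
      by (rule legendre_sum_eq) (use m \<nu> that in auto)
    then show "?f (of_real m) = legendre_expansion \<sigma> N \<xi> (of_real m) \<nu>"
      using legendre_expansion_0_imaginary[OF m _ b \<sigma> \<xi>, of \<nu>] \<nu> args by (simp add: legendre_expansion_def)
  qed (use \<mu> open_Re_strip connected_Re_strip in auto)
  then show ?thesis
    by (simp only: hyp2F1_reg_continuation(2)[OF hyp2F1_reg_continuable_legendre w])
qed

lemma legendre_prefactor_holomorphic: "(\<lambda>\<xi>. legendre_prefactor \<xi> \<mu> \<nu>) holomorphic_on {\<xi>. sin (Im \<xi>) \<noteq> 0}"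
proof -
  have "coth_half holomorphic_on {\<xi>. sin (Im \<xi>) \<noteq> 0}"
    unfolding coth_half_def[abs_def] sinh_field_def cosh_field_def
    using sinh_nonzero(3) by (intro holomorphic_intros) (auto simp: sinh_field_def)
  moreover have "2 * of_real pi * sinh \<xi> \<notin> \<real>\<^sub>\<le>\<^sub>0" if "sin (Im \<xi>) \<noteq> 0" for \<xi>
    using sinh_nonzero(1)[OF that] by (auto simp: complex_nonpos_Reals_iff)
  then have "(\<lambda>\<xi>. csqrt (2 * of_real pi * sinh \<xi>)) holomorphic_on {\<xi>. sin (Im \<xi>) \<noteq> 0}"
    by (intro holomorphic_on_csqrt') (auto simp: sinh_field_def intro!: holomorphic_intros)
  ultimately show ?thesis
    unfolding legendre_prefactor_def
    using coth_half_notin_nonpos_Reals by (intro holomorphic_on_mult holomorphic_on_const holomorphic_on_powr) auto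
qed

lemma legendre_expansion_holomorphic:
  assumes "\<bar>Re \<mu>\<bar> < real N + 1/2" "Re \<nu> > real N - 1/2"
  shows "(\<lambda>\<xi>. legendre_expansion \<sigma> N \<xi> \<mu> \<nu>) holomorphic_on {\<xi>. sin (Im \<xi>) \<noteq> 0}"
proof -
  have sinh: "sinh holomorphic_on {\<xi> :: complex. sin (Im \<xi>) \<noteq> 0}"
    unfolding sinh_field_def[abs_def] by (intro holomorphic_intros) auto
  have args: "(\<lambda>\<xi>. - exp (- \<xi>) / sinh \<xi>) holomorphic_on {\<xi>. sin (Im \<xi>) \<noteq> 0}"
    "(\<lambda>\<xi>. exp \<xi> / sinh \<xi>) holomorphic_on {\<xi>. sin (Im \<xi>) \<noteq> 0}"
    using sinh_nonzero(2) by (intro holomorphic_intros sinh; auto)+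
  have "(\<lambda>\<xi>. - exp (- \<xi>) / sinh \<xi>) ` {\<xi>. sin (Im \<xi>) \<noteq> 0} \<subseteq> - \<real>\<^sub>\<le>\<^sub>0"
    "(\<lambda>\<xi>. exp \<xi> / sinh \<xi>) ` {\<xi>. sin (Im \<xi>) \<noteq> 0} \<subseteq> - \<real>\<^sub>\<le>\<^sub>0"
    using exp_div_sinh_notin_nonpos_Reals by blast+
  note holomorphic_on_compose_gen[OF args(1) legendre_sum_holomorphic[OF assms] this(1), unfolded o_def]
    holomorphic_on_compose_gen[OF args(2) legendre_sum_holomorphic[OF assms] this(2), unfolded o_def]
  then show ?thesis
    unfolding legendre_expansion_def
    by (intro holomorphic_on_add holomorphic_on_mult holomorphic_on_const holomorphic_on_exp' holomorphic_on_ident)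
qed

lemma legendre_expansion_strip:
  assumes \<mu>: "\<bar>Re \<mu>\<bar> < real N + 1/2" and \<nu>: "Re \<nu> > real N - 1/2"
    and \<sigma>: "\<sigma> = 1 \<or> \<sigma> = (- 1 :: real)" and strip: "0 < \<sigma> * Im \<xi>" "\<sigma> * Im \<xi> < pi"
  shows "legendre_prefactor \<xi> \<mu> \<nu> * hyp2F1_reg (\<nu> + 1) (- \<nu>) (1 - \<mu>) ((1 - cosh \<xi>) / 2) = legendre_expansion \<sigma> N \<xi> \<mu> \<nu>"
proof -
  let ?V = "{\<xi>. sin (Im \<xi>) \<noteq> 0}" and ?T = "{t. 0 < Re t \<and> Re t < pi}"
  let ?k = "\<lambda>t. \<i> * complex_of_real \<sigma> * t"
  let ?f = "\<lambda>\<xi>. legendre_prefactor \<xi> \<mu> \<nu> * hyp2F1_reg (\<nu> + 1) (- \<nu>) (1 - \<mu>) ((1 - cosh \<xi>) / 2)"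
  let ?g = "\<lambda>\<xi>. legendre_expansion \<sigma> N \<xi> \<mu> \<nu>"
  have "(\<lambda>\<xi>. (1 - cosh \<xi>) / 2) holomorphic_on ?V"
    unfolding cosh_field_def by (intro holomorphic_intros) auto
  then have "(\<lambda>\<xi>. hyp2F1_reg (\<nu> + 1) (- \<nu>) (1 - \<mu>) ((1 - cosh \<xi>) / 2)) holomorphic_on ?V"
    by (rule holomorphic_on_compose_gen[OF _ hyp2F1_reg_continuation(1)[OF hyp2F1_reg_continuable_legendre], unfolded o_def])
       (use cosh_arg_slit_plane in auto)
  then have f: "?f holomorphic_on ?V"
    by (intro holomorphic_on_mult legendre_prefactor_holomorphic)
  have k: "?k holomorphic_on ?T" "?k ` ?T \<subseteq> ?V"
    using \<sigma> by (auto intro!: holomorphic_intros simp: sin_gt_zero less_imp_neq[symmetric])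
  have T: "?T = {t. 0 < Re t} \<inter> {t. Re t < pi}" by auto
  have k_inverse: "?k (- (?k \<xi>)) = \<xi>" using \<sigma> by auto
  have "?f (?k (- (?k \<xi>))) = ?g (?k (- (?k \<xi>)))"
  proof (rule holomorphic_eq_if_eq_on_real_interval[where S = ?T and a = 0 and b = pi and z = "- (?k \<xi>)"
        and f = "\<lambda>t. ?f (?k t)" and g = "\<lambda>t. ?g (?k t)"])
    show "(\<lambda>t. ?f (?k t)) holomorphic_on ?T"
      by (rule holomorphic_on_compose_gen[OF k(1) f k(2), unfolded o_def])
    show "(\<lambda>t. ?g (?k t)) holomorphic_on ?T"
      by (rule holomorphic_on_compose_gen[OF k(1) legendre_expansion_holomorphic[OF \<mu> \<nu>] k(2), unfolded o_def])
    show "open ?T" unfolding T by (intro open_Int open_halfspace_Re_gt open_halfspace_Re_lt)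
    show "connected ?T"
      unfolding T by (intro convex_connected convex_Int convex_halfspace_Re_gt convex_halfspace_Re_lt)
    show "?f (?k (of_real b)) = ?g (?k (of_real b))" if "0 < b" "b < pi" for b
      by (rule legendre_expansion_imaginary[OF \<mu> \<nu> that \<sigma>]) simp
  qed (use strip in auto)
  then show ?thesis unfolding k_inverse .
qed

lemma legendre_P_cosh:
  assumes "\<xi> \<in> D1"
  shows "legendre_P \<nu> \<mu> (cosh \<xi>) = coth_half \<xi> powr \<mu> * hyp2F1_reg (\<nu> + 1) (- \<nu>) (1 - \<mu>) ((1 - cosh \<xi>) / 2)"
proof -
  have Re: "Re (coth_half \<xi>) > 0" using assms by (intro Re_coth_half_pos) (simp add: D1_def)
  have "cosh \<xi> + 1 = 2 * (cosh (\<xi>/2))\<^sup>2" "cosh \<xi> - 1 = 2 * (sinh (\<xi>/2))\<^sup>2"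
    using cosh_double_cosh[of "\<xi>/2"] cosh_square_eq[of "\<xi>/2"] by simp_all
  then have "(cosh \<xi> + 1) / (cosh \<xi> - 1) = coth_half \<xi> * coth_half \<xi>"
    by (simp add: coth_half_def power2_eq_square)
  moreover have "(coth_half \<xi> * coth_half \<xi>) powr (\<mu>/2) = coth_half \<xi> powr (\<mu>/2) * coth_half \<xi> powr (\<mu>/2)"
    using Re by (intro mult_powr_Re_nonneg) auto
  ultimately show ?thesis
    by (simp add: legendre_P_def flip: powr_add)
qed

lemma legendre_P_expansion:
  assumes \<mu>: "\<bar>Re \<mu>\<bar> < real N + 1/2" and \<nu>: "Re \<nu> > real N - 1/2" and \<xi>: "\<xi> \<in> D1"
    and \<sigma>: "\<sigma> = 1 \<or> \<sigma> = (- 1 :: real)" "\<sigma> * Im \<xi> > 0"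
  shows "Gamma (\<nu> - \<mu> + 1) * csqrt (2 * of_real pi * sinh \<xi>) * legendre_P \<nu> \<mu> (cosh \<xi>) = legendre_expansion \<sigma> N \<xi> \<mu> \<nu>"
proof -
  have "\<sigma> * Im \<xi> < pi" using \<xi> \<sigma> by (auto simp: D1_def)
  from legendre_expansion_strip[OF \<mu> \<nu> \<sigma> this] show ?thesis
    unfolding legendre_prefactor_def legendre_P_cosh[OF \<xi>] by (simp only: mult.assoc)
qed

section \<open>Error bounds and boundary values\<close>

lemma norm_legendre_rem_le_Re:
  assumes "\<bar>Re \<mu>\<bar> < real N + 1/2" "Re \<nu> > real N - 1/2" "Re x \<ge> 0"
  shows "norm (legendre_rem N x \<mu> \<nu>) \<le> norm (cos (of_real pi * \<mu>)) * a_cos_ratio N (Re \<mu>) *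
    Gamma (Re \<nu> - real N + 1/2) * norm x ^ N"
  using norm_legendre_rem_le[OF assms(1,2), of x 1] norm_terminant_le_Re[of "real N + 1/2"] assms(3) by simp

lemma norm_legendre_rem_le_chi:
  assumes "\<bar>Re \<mu>\<bar> < real N + 1/2" "Re \<nu> > real N - 1/2" "x \<notin> \<real>\<^sub>\<le>\<^sub>0"
  shows "norm (legendre_rem N x \<mu> \<nu>) \<le> norm (cos (of_real pi * \<mu>)) * a_cos_ratio N (Re \<mu>) *
    Gamma (Re \<nu> - real N + 1/2) * norm x ^ N * (1 + chi (real N + 1/2))"
  by (intro norm_legendre_rem_le norm_terminant_ray_le_chi assms) simp

lemma norm_legendre_rem_le_Im:
  assumes "\<bar>Re \<mu>\<bar> < real N + 1/2" "Re \<nu> > real N - 1/2" "Im x \<noteq> 0"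
  shows "norm (legendre_rem N x \<mu> \<nu>) \<le> norm (cos (of_real pi * \<mu>)) * a_cos_ratio N (Re \<mu>) *
    Gamma (Re \<nu> - real N + 1/2) * norm x ^ N * (norm x / \<bar>Im x\<bar>)"
proof (rule norm_legendre_rem_le[OF assms(1,2)])
  show "norm (terminant (real N + 1/2) (of_real c * x)) \<le> Gamma (real N + 1/2) * (norm x / \<bar>Im x\<bar>)" if "c > 0" for c
    using norm_terminant_le_Im[of "real N + 1/2" "of_real c * x"] that assms(3) by (simp add: norm_mult abs_mult)
qed

lemma Re_divide_numeral: "Re (numeral k / z) = numeral k * Re z / (norm z)\<^sup>2"
  and Im_divide_numeral: "Im (numeral k / z) = - (numeral k * Im z) / (norm z)\<^sup>2"
  by (simp_all add: Re_divide Im_divide cmod_power2)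

lemma Re_exp_div_sinh_pos:
  assumes "Re \<xi> > 0"
  shows "Re (exp \<xi> / sinh \<xi>) > 0"
proof -
  have "Re (exp (- 2 * \<xi>)) \<le> norm (exp (- 2 * \<xi>))"
    by (rule complex_Re_le_cmod)
  also have "\<dots> < 1"
    using assms by (simp add: norm_exp_eq_Re)
  finally have "Re (1 - exp (- 2 * \<xi>)) > 0"
    by simp
  moreover from this have "1 - exp (- 2 * \<xi>) \<noteq> 0"
    by auto
  ultimately show ?thesis
    unfolding exp_div_sinh Re_divide_numeral by simp
qed

lemma Re_minus_exp_div_sinh_nonneg:
  assumes "Re (exp (2 * \<xi>)) \<le> 1"
  shows "Re (- exp (- \<xi>) / sinh \<xi>) \<ge> 0"
  unfolding minus_exp_div_sinh Re_divide_numeral using assms by simp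

lemma Im_minus_exp_div_sinh:
  "Im (- exp (- \<xi>) / sinh \<xi>) = 2 * exp (2 * Re \<xi>) * sin (2 * Im \<xi>) / (norm (1 - exp (2 * \<xi>)))\<^sup>2"
  unfolding minus_exp_div_sinh Im_divide_numeral by (simp add: Im_exp)

lemma norm_div_Im_minus_exp_div_sinh:
  assumes "sin (2 * Im \<xi>) \<noteq> 0"
  shows "norm (- exp (- \<xi>) / sinh \<xi>) / \<bar>Im (- exp (- \<xi>) / sinh \<xi>)\<bar> =
    norm (1 - exp (- 2 * \<xi>)) * \<bar>1 / sin (2 * Im \<xi>)\<bar>"
proof -
  have "Im (exp (2 * \<xi>)) \<noteq> 0"
    using assms by (simp add: Im_exp)
  then have q: "norm (1 - exp (2 * \<xi>)) > 0"
    by auto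
  have "1 - exp (2 * \<xi>) = - (exp (2 * \<xi>) * (1 - exp (- 2 * \<xi>)))"
    by (simp add: algebra_simps exp_minus)
  then have norm_q: "norm (1 - exp (2 * \<xi>)) = exp (2 * Re \<xi>) * norm (1 - exp (- 2 * \<xi>))"
    by (simp only: norm_minus_cancel norm_mult norm_exp_eq_Re) simp
  have "norm (- exp (- \<xi>) / sinh \<xi>) / \<bar>Im (- exp (- \<xi>) / sinh \<xi>)\<bar> =
      norm (1 - exp (2 * \<xi>)) / (exp (2 * Re \<xi>) * \<bar>sin (2 * Im \<xi>)\<bar>)"
    unfolding Im_minus_exp_div_sinh unfolding minus_exp_div_sinh
    using q by (simp add: norm_divide abs_mult power2_eq_square field_simps)
  then show ?thesis
    unfolding norm_q by simp
qed

lemma norm_legendre_rem_le_P1_factor: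
  assumes \<mu>: "\<bar>Re \<mu>\<bar> < real N + 1/2" and \<nu>: "Re \<nu> > real N - 1/2" and \<xi>: "sin (Im \<xi>) \<noteq> 0"
  shows "norm (legendre_rem N (- exp (- \<xi>) / sinh \<xi>) \<mu> \<nu>) \<le> norm (cos (of_real pi * \<mu>)) * a_cos_ratio N (Re \<mu>) *
    Gamma (Re \<nu> - real N + 1/2) * norm (exp (- \<xi>) / sinh \<xi>) ^ N * P1_factor N \<xi>"
proof -
  have norm_arg: "norm (exp (- \<xi>) / sinh \<xi>) = norm (- exp (- \<xi>) / sinh \<xi>)"
    by (simp add: norm_divide)
  note chi_bound = norm_legendre_rem_le_chi[OF \<mu> \<nu> exp_div_sinh_notin_nonpos_Reals(2)[OF \<xi>]]
  consider "Re (exp (2 * \<xi>)) \<le> 1"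
    | "Re (exp (2 * \<xi>)) > 1" "sin (2 * Im \<xi>) = 0"
    | "Re (exp (2 * \<xi>)) > 1" "sin (2 * Im \<xi>) \<noteq> 0"
    by linarith
  then show ?thesis
  proof cases
    case 1
    then show ?thesis
      unfolding norm_arg P1_factor_def
      using norm_legendre_rem_le_Re[OF \<mu> \<nu> Re_minus_exp_div_sinh_nonneg[OF 1]] by simp
  next
    case 2
    then show ?thesis
      unfolding norm_arg P1_factor_def using chi_bound by simp
  next
    case 3
    then have "Im (- exp (- \<xi>) / sinh \<xi>) \<noteq> 0"
      using sinh_nonzero(2)[OF \<xi>] unfolding Im_minus_exp_div_sinh by auto
    note Im_bound = norm_legendre_rem_le_Im[OF \<mu> \<nu> this, unfolded norm_div_Im_minus_exp_div_sinh[OF 3(2)]]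
    have "P1_factor N \<xi> = min (norm (1 - exp (- 2 * \<xi>)) * \<bar>1 / sin (2 * Im \<xi>)\<bar>) (1 + chi (real N + 1/2))"
      using 3 by (simp add: P1_factor_def)
    then show ?thesis
      unfolding norm_arg min_def using Im_bound chi_bound by simp
  qed
qed

text \<open>The connection formula with coefficient \<open>c\<close>, solved for the first remainder; unlike
  \<open>legendre_rem\<close> this makes sense on the positive axis.\<close>

definition legendre_P_remainder :: "complex \<Rightarrow> nat \<Rightarrow> complex \<Rightarrow> complex \<Rightarrow> complex \<Rightarrow> complex" where
  "legendre_P_remainder c N \<xi> \<mu> \<nu> =
    exp (- (\<nu> + 1/2) * \<xi>) * (Gamma (\<nu> - \<mu> + 1) * csqrt (2 * of_real pi * sinh \<xi>) * legendre_P \<nu> \<mu> (cosh \<xi>) -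
      c * exp (- (\<nu> + 1/2) * \<xi>) * legendre_sum N (exp \<xi> / sinh \<xi>) \<mu> \<nu>) - (\<Sum>n<N. P1_term n \<xi> \<mu> \<nu>)"

lemma legendre_P_remainder_eq_legendre_rem:
  assumes "\<bar>Re \<mu>\<bar> < real N + 1/2" "Re \<nu> > real N - 1/2" "\<xi> \<in> D1" "\<sigma> = 1 \<or> \<sigma> = - 1" "\<sigma> * Im \<xi> > 0"
  shows "legendre_P_remainder (connection_coeff \<sigma> \<mu>) N \<xi> \<mu> \<nu> = legendre_rem N (- exp (- \<xi>) / sinh \<xi>) \<mu> \<nu>"
proof -
  have "exp (- (\<nu> + 1/2) * \<xi>) * exp ((\<nu> + 1/2) * \<xi>) = 1"
    by (simp add: algebra_simps flip: exp_add)
  then show ?thesis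
    unfolding legendre_P_remainder_def legendre_P_expansion[OF assms] legendre_expansion_def legendre_sum_def P1_term_def
    by (simp flip: mult.assoc)
qed

lemma legendre_P_remainder_average:
  "legendre_P_remainder ((c + d) / 2) N \<xi> \<mu> \<nu> =
    (legendre_P_remainder c N \<xi> \<mu> \<nu> + legendre_P_remainder d N \<xi> \<mu> \<nu>) / 2"
  unfolding legendre_P_remainder_def by (simp add: field_simps)

lemma coth_half_holomorphic: "coth_half holomorphic_on {\<xi>. Re \<xi> > 0}"
proof -
  have "sinh (\<xi>/2) \<noteq> 0" if "Re \<xi> > 0" for \<xi>
    using that by (intro sinh_nonzero_Re) simp
  then show ?thesis
    unfolding coth_half_def[abs_def] sinh_field_def cosh_field_def by (intro holomorphic_intros) auto
qed

lemma legendre_P_cosh_holomorphic: "(\<lambda>\<xi>. legendre_P \<nu> \<mu> (cosh \<xi>)) holomorphic_on D1"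
proof -
  have "coth_half holomorphic_on D1"
    by (rule holomorphic_on_subset[OF coth_half_holomorphic]) (auto simp: D1_def)
  moreover have "coth_half \<xi> \<notin> \<real>\<^sub>\<le>\<^sub>0" if "\<xi> \<in> D1" for \<xi>
    using that by (intro not_nonpos_Reals_Re Re_coth_half_pos) (simp add: D1_def)
  ultimately have power: "(\<lambda>\<xi>. coth_half \<xi> powr \<mu>) holomorphic_on D1"
    by (intro holomorphic_on_powr holomorphic_on_const) auto
  have "(\<lambda>\<xi>. (1 - cosh \<xi>) / 2) holomorphic_on D1"
    unfolding cosh_field_def by (intro holomorphic_intros) auto
  then have "(\<lambda>\<xi>. hyp2F1_reg (\<nu> + 1) (- \<nu>) (1 - \<mu>) ((1 - cosh \<xi>) / 2)) holomorphic_on D1"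
    by (rule holomorphic_on_compose_gen[OF _ hyp2F1_reg_continuation(1)[OF hyp2F1_reg_continuable_legendre], unfolded o_def])
       (use cosh_arg_slit_plane in auto)
  with power have "(\<lambda>\<xi>. coth_half \<xi> powr \<mu> * hyp2F1_reg (\<nu> + 1) (- \<nu>) (1 - \<mu>) ((1 - cosh \<xi>) / 2)) holomorphic_on D1"
    by (rule holomorphic_on_mult)
  then show ?thesis
    by (rule holomorphic_transform) (simp add: legendre_P_cosh)
qed

lemma exp_div_sinh_continuous_on_D1:
  shows "continuous_on D1 (\<lambda>\<xi>. exp \<xi> / sinh \<xi>)" "continuous_on D1 (\<lambda>\<xi>. exp (- \<xi>) / sinh \<xi>)"
  unfolding sinh_field_def using sinh_nonzero_Re
  by (intro continuous_intros; force simp: D1_def sinh_field_def)+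

lemma continuous_on_legendre_P_remainder:
  assumes \<mu>: "\<bar>Re \<mu>\<bar> < real N + 1/2" and \<nu>: "Re \<nu> > real N - 1/2"
  shows "continuous_on D1 (\<lambda>\<xi>. legendre_P_remainder c N \<xi> \<mu> \<nu>)"
proof -
  have "continuous_on (- \<real>\<^sub>\<le>\<^sub>0) (\<lambda>x. legendre_sum N x \<mu> \<nu>)"
    by (intro holomorphic_on_imp_continuous_on legendre_sum_holomorphic \<mu> \<nu>)
  moreover have "exp \<xi> / sinh \<xi> \<notin> \<real>\<^sub>\<le>\<^sub>0" if "\<xi> \<in> D1" for \<xi>
    using that by (intro not_nonpos_Reals_Re Re_exp_div_sinh_pos) (simp add: D1_def)
  ultimately have "continuous_on D1 (\<lambda>\<xi>. legendre_sum N (exp \<xi> / sinh \<xi>) \<mu> \<nu>)"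
    by (intro continuous_on_compose2[OF _ exp_div_sinh_continuous_on_D1(1)]) auto
  moreover have "continuous_on D1 (\<lambda>\<xi>. legendre_P \<nu> \<mu> (cosh \<xi>))"
    by (intro holomorphic_on_imp_continuous_on legendre_P_cosh_holomorphic)
  moreover have "continuous_on D1 (\<lambda>\<xi>. P1_term n \<xi> \<mu> \<nu>)" for n
    unfolding P1_term_def minus_divide_left[symmetric]
    by (intro continuous_intros exp_div_sinh_continuous_on_D1(2))
  ultimately show ?thesis
    unfolding legendre_P_remainder_def by (intro continuous_intros continuous_on_sqrt_sinh)
qed

lemma le_on_real_axis_of_le_beside:
  fixes f g :: "complex \<Rightarrow> real"
  assumes f: "continuous_on D1 f" and g: "continuous_on D1 g" and \<sigma>: "\<sigma> = 1 \<or> \<sigma> = (- 1 :: real)"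
    and le: "\<And>w. w \<in> D1 \<Longrightarrow> \<sigma> * Im w > 0 \<Longrightarrow> f w \<le> g w" and \<xi>: "\<xi> \<in> D1" "Im \<xi> = 0"
  shows "f \<xi> \<le> g \<xi>"
proof -
  define r where "r n = inverse (real (Suc n))" for n
  define w where "w n = \<xi> + \<i> * of_real (\<sigma> * r n)" for n
  have "r \<longlonglongrightarrow> 0"
    unfolding r_def by (rule LIMSEQ_inverse_real_of_nat)
  then have lim: "w \<longlonglongrightarrow> \<xi>"
    unfolding w_def by (auto intro!: tendsto_eq_intros)
  have r: "0 < r n" "r n < pi" for n
  proof -
    have "r n \<le> 1"
      by (simp add: r_def field_simps)
    then show "r n < pi"
      using pi_gt3 by linarith
  qed (simp add: r_def)
  have w: "w n \<in> D1" "\<sigma> * Im (w n) > 0" for n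
    using \<xi> \<sigma> r[of n] by (auto simp: w_def D1_def)
  have along: "(\<lambda>n. h (w n)) \<longlonglongrightarrow> h \<xi>" if "continuous_on D1 h" for h :: "complex \<Rightarrow> real"
    using continuous_on_tendsto_compose[OF that lim \<xi>(1)] w(1) by simp
  show ?thesis
    by (rule LIMSEQ_le[OF along[OF f] along[OF g]]) (use le w in blast)
qed

lemma norm_legendre_P_remainder_real_axis_le:
  assumes \<mu>: "\<bar>Re \<mu>\<bar> < real N + 1/2" and \<nu>: "Re \<nu> > real N - 1/2" and \<sigma>: "\<sigma> = 1 \<or> \<sigma> = - 1"
    and \<xi>: "\<xi> \<in> D1" "Im \<xi> = 0"
  shows "norm (legendre_P_remainder (connection_coeff \<sigma> \<mu>) N \<xi> \<mu> \<nu>) \<le> norm (cos (of_real pi * \<mu>)) * a_cos_ratio N (Re \<mu>) *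
    Gamma (Re \<nu> - real N + 1/2) * norm (exp (- \<xi>) / sinh \<xi>) ^ N * (1 + chi (real N + 1/2))"
proof (rule le_on_real_axis_of_le_beside[OF _ _ \<sigma> _ \<xi>])
  fix w assume w: "w \<in> D1" "\<sigma> * Im w > 0"
  then have "sin (Im w) \<noteq> 0"
    by (intro sin_nonzero_of_abs_less_pi) (auto simp: D1_def)
  from norm_legendre_rem_le_chi[OF \<mu> \<nu> exp_div_sinh_notin_nonpos_Reals(2)[OF this]]
  show "norm (legendre_P_remainder (connection_coeff \<sigma> \<mu>) N w \<mu> \<nu>) \<le> norm (cos (of_real pi * \<mu>)) * a_cos_ratio N (Re \<mu>) *
      Gamma (Re \<nu> - real N + 1/2) * norm (exp (- w) / sinh w) ^ N * (1 + chi (real N + 1/2))"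
    unfolding legendre_P_remainder_eq_legendre_rem[OF \<mu> \<nu> w(1) \<sigma> w(2)] by (simp add: norm_divide)
qed (intro continuous_intros continuous_on_legendre_P_remainder \<mu> \<nu> exp_div_sinh_continuous_on_D1)+

lemma C_coeff_off_axis: "Im \<xi> \<noteq> 0 \<Longrightarrow> C_coeff \<xi> \<mu> = connection_coeff (sgn (Im \<xi>)) \<mu>"
  by (auto simp: C_coeff_def connection_coeff_def sgn_if)

lemma C_coeff_real_axis:
  assumes "Im \<xi> = 0"
  shows "C_coeff \<xi> \<mu> = (connection_coeff 1 \<mu> + connection_coeff (- 1) \<mu>) / 2"
  using assms by (simp add: C_coeff_def connection_coeff_def sin_exp_eq field_simps)

definition legendre_R1 :: "nat \<Rightarrow> complex \<Rightarrow> complex \<Rightarrow> complex \<Rightarrow> complex" where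
  "legendre_R1 N \<xi> \<mu> \<nu> = legendre_P_remainder (C_coeff \<xi> \<mu>) N \<xi> \<mu> \<nu>"

definition legendre_R2 :: "nat \<Rightarrow> complex \<Rightarrow> complex \<Rightarrow> complex \<Rightarrow> complex" where
  "legendre_R2 M \<xi> \<mu> \<nu> = legendre_rem M (exp \<xi> / sinh \<xi>) \<mu> \<nu>"

lemma norm_legendre_R1_le:
  assumes \<mu>: "\<bar>Re \<mu>\<bar> < real N + 1/2" and \<nu>: "Re \<nu> > real N - 1/2" and \<xi>: "\<xi> \<in> D1"
  shows "norm (legendre_R1 N \<xi> \<mu> \<nu>) \<le> norm (cos (of_real pi * \<mu>)) * a_cos_ratio N (Re \<mu>) *
    Gamma (Re \<nu> - real N + 1/2) * norm (exp (- \<xi>) / sinh \<xi>) ^ N * P1_factor N \<xi>"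
proof (cases "Im \<xi> = 0")
  case False
  then have \<sigma>: "sgn (Im \<xi>) = 1 \<or> sgn (Im \<xi>) = - 1" "sgn (Im \<xi>) * Im \<xi> > 0"
    by (auto simp: sgn_if)
  have "sin (Im \<xi>) \<noteq> 0"
    using False \<xi> by (intro sin_nonzero_of_abs_less_pi) (auto simp: D1_def)
  from norm_legendre_rem_le_P1_factor[OF \<mu> \<nu> this] show ?thesis
    unfolding legendre_R1_def C_coeff_off_axis[OF False] legendre_P_remainder_eq_legendre_rem[OF \<mu> \<nu> \<xi> \<sigma>] .
next
  case True
  let ?side = "\<lambda>\<sigma>. legendre_P_remainder (connection_coeff \<sigma> \<mu>) N \<xi> \<mu> \<nu>"
  have "Re (exp (2 * \<xi>)) > 1"
    using True \<xi> by (simp add: Re_exp D1_def)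
  then have factor: "P1_factor N \<xi> = 1 + chi (real N + 1/2)"
    using True by (simp add: P1_factor_def)
  have "norm (legendre_R1 N \<xi> \<mu> \<nu>) = norm (?side 1 + ?side (- 1)) / 2"
    unfolding legendre_R1_def C_coeff_real_axis[OF True] legendre_P_remainder_average by (simp add: norm_divide)
  also have "\<dots> \<le> (norm (?side 1) + norm (?side (- 1))) / 2"
    by (intro divide_right_mono norm_triangle_ineq) simp
  finally show ?thesis
    unfolding factor
    using norm_legendre_P_remainder_real_axis_le[OF \<mu> \<nu> _ \<xi> True, of 1]
      norm_legendre_P_remainder_real_axis_le[OF \<mu> \<nu> _ \<xi> True, of "- 1"] by simp
qed

lemma norm_legendre_R2_le:
  assumes "\<bar>Re \<mu>\<bar> < real M + 1/2" "Re \<nu> > real M - 1/2" "Re \<xi> > 0"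
  shows "norm (legendre_R2 M \<xi> \<mu> \<nu>) \<le> norm (cos (of_real pi * \<mu>)) * a_cos_ratio M (Re \<mu>) *
    Gamma (Re \<nu> - real M + 1/2) * norm (exp \<xi> / sinh \<xi>) ^ M"
  unfolding legendre_R2_def
  by (rule norm_legendre_rem_le_Re[OF assms(1,2) less_imp_le[OF Re_exp_div_sinh_pos[OF assms(3)]]])

lemma legendre_P_eq_R1_R2:
  assumes \<xi>: "\<xi> \<in> D1" and \<mu>: "\<bar>Re \<mu>\<bar> < real N + 1/2" "\<bar>Re \<mu>\<bar> < real M + 1/2"
    and \<nu>: "Re \<nu> > real N - 1/2" "Re \<nu> > real M - 1/2"
  shows "legendre_P \<nu> \<mu> (cosh \<xi>) =
    exp ((\<nu> + 1/2) * \<xi>) / (Gamma (\<nu> - \<mu> + 1) * csqrt (2 * of_real pi * sinh \<xi>)) *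
      ((\<Sum>n<N. P1_term n \<xi> \<mu> \<nu>) + legendre_R1 N \<xi> \<mu> \<nu>) +
    C_coeff \<xi> \<mu> * exp (- (\<nu> + 1/2) * \<xi>) / (Gamma (\<nu> - \<mu> + 1) * csqrt (2 * of_real pi * sinh \<xi>)) *
      ((\<Sum>m<M. P2_term m \<xi> \<mu> \<nu>) + legendre_R2 M \<xi> \<mu> \<nu>)"
proof -
  define L where "L = Gamma (\<nu> - \<mu> + 1) * csqrt (2 * of_real pi * sinh \<xi>)"
  define E where "E = exp ((\<nu> + 1/2) * \<xi>)"
  have "\<nu> - \<mu> + 1 \<notin> \<int>\<^sub>\<le>\<^sub>0"
    using \<mu> \<nu> by (intro not_nonpos_Ints_Re) auto
  moreover have "sinh \<xi> \<noteq> 0" and "exp \<xi> / sinh \<xi> \<notin> \<real>\<^sub>\<le>\<^sub>0"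
    using \<xi> by (auto simp: D1_def intro!: sinh_nonzero_Re not_nonpos_Reals_Re Re_exp_div_sinh_pos)
  ultimately have L: "L \<noteq> 0" and sum: "legendre_sum N (exp \<xi> / sinh \<xi>) \<mu> \<nu> = (\<Sum>m<M. P2_term m \<xi> \<mu> \<nu>) + legendre_R2 M \<xi> \<mu> \<nu>"
    using legendre_sum_eq[OF \<mu> \<nu>] by (auto simp: L_def Gamma_eq_zero_iff legendre_sum_def P2_term_def legendre_R2_def)
  have E: "E \<noteq> 0" "exp (- (\<nu> + 1/2) * \<xi>) = inverse E"
    by (simp_all add: E_def algebra_simps flip: exp_minus)
  have "L * legendre_P \<nu> \<mu> (cosh \<xi>) = E * ((\<Sum>n<N. P1_term n \<xi> \<mu> \<nu>) + legendre_R1 N \<xi> \<mu> \<nu>) +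
      C_coeff \<xi> \<mu> * inverse E * ((\<Sum>m<M. P2_term m \<xi> \<mu> \<nu>) + legendre_R2 M \<xi> \<mu> \<nu>)"
    unfolding legendre_R1_def legendre_P_remainder_def sum L_def[symmetric] E(2) using E(1) by (simp flip: mult.assoc)
  moreover have "legendre_P \<nu> \<mu> (cosh \<xi>) = L * legendre_P \<nu> \<mu> (cosh \<xi>) / L"
    using L by simp
  ultimately show ?thesis
    unfolding L_def[symmetric] E_def[symmetric] E(2) by (simp add: add_divide_distrib)
qed

section \<open>Positivity for real parameters\<close>

definition pos_Reals :: "complex set" where
  "pos_Reals = complex_of_real ` {0<..}"

lemma of_real_in_pos_Reals_iff: "complex_of_real r \<in> pos_Reals \<longleftrightarrow> r > 0"
  by (auto simp: pos_Reals_def)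

lemma pos_Reals_iff: "z \<in> pos_Reals \<longleftrightarrow> z = of_real (Re z) \<and> Re z > 0"
  by (auto simp: pos_Reals_def)

lemma pos_Reals_mult: "z \<in> pos_Reals \<Longrightarrow> w \<in> pos_Reals \<Longrightarrow> z * w \<in> pos_Reals"
  by (auto simp: pos_Reals_def simp flip: of_real_mult)

lemma set_integral_in_pos_Reals:
  fixes f :: "real \<Rightarrow> complex"
  assumes int: "set_integrable lborel A f" and A: "open A" "A \<noteq> {}" and f: "\<And>x. x \<in> A \<Longrightarrow> f x \<in> pos_Reals"
  shows "(LINT x:A|lborel. f x) \<in> pos_Reals"
proof -
  have pos: "Re (f x) > 0" and real: "f x = of_real (Re (f x))" if "x \<in> A" for x
    using f[OF that] by (simp_all only: pos_Reals_iff)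
  let ?g = "\<lambda>x. indicator A x * Re (f x)"
  have "integrable lborel (\<lambda>x. Re (indicator A x *\<^sub>R f x))"
    using int unfolding set_integrable_def by (rule integrable_Re)
  then have g: "integrable lborel ?g"
    by simp
  have nonneg: "?g x \<ge> 0" for x
    using pos[of x] by (auto simp: indicator_def)
  have "(\<integral>x. ?g x \<partial>lborel) \<noteq> 0"
  proof
    assume "(\<integral>x. ?g x \<partial>lborel) = 0"
    then have "AE x in lborel. ?g x = 0"
      using integral_nonneg_eq_0_iff_AE[OF g] nonneg by simp
    then have "AE x in lborel. x \<notin> A"
      by eventually_elim (use pos in \<open>force simp: indicator_def\<close>)
    then have "A \<in> null_sets lborel"
      using A AE_iff_null_sets[of A lborel] by simp
    then have "negligible A"
      unfolding negligible_iff_null_sets by (rule null_sets_completionI)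
    then show False
      using open_not_negligible[OF A] by simp
  qed
  moreover have "(\<integral>x. ?g x \<partial>lborel) \<ge> 0"
    by (intro integral_nonneg_AE AE_I2 nonneg)
  ultimately have "(LINT x:A|lborel. Re (f x)) > 0"
    by (simp add: set_lebesgue_integral_def)
  moreover have "(LINT x:A|lborel. f x) = of_real (LINT x:A|lborel. Re (f x))"
    unfolding set_integral_complex_of_real[symmetric] by (rule set_integral_cong) (rule real)
  ultimately show ?thesis
    by (simp only: of_real_in_pos_Reals_iff)
qed

lemma terminant_in_pos_Reals:
  assumes "p > 0" "q > 0"
  shows "terminant p (of_real q) \<in> pos_Reals"
  unfolding terminant_def
proof (rule set_integral_in_pos_Reals)
  show "set_integrable lborel {0<..} (\<lambda>u. complex_of_real (Gamma_weight p u) * inverse (1 + of_real u * of_real q))"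
    using assms by (intro set_integrable_terminant) auto
  show "complex_of_real (Gamma_weight p u) * inverse (1 + of_real u * of_real q) \<in> pos_Reals" if "u \<in> {0<..}" for u
  proof -
    have "Gamma_weight p u * inverse (1 + u * q) > 0"
      using that assms by (simp add: Gamma_weight_pos add_pos_pos)
    then show ?thesis
      by (simp flip: of_real_in_pos_Reals_iff)
  qed
qed auto

lemma terminant_beta_in_pos_Reals:
  fixes m y :: real
  assumes m: "\<bar>m\<bar> < p" and y: "y > 0"
  shows "terminant_beta p (of_real m) (of_real y) \<in> pos_Reals"
  unfolding terminant_beta_def
proof (rule set_integral_in_pos_Reals)
  let ?W = "Beta_weight (of_real p + of_real m) (of_real p - complex_of_real m)"
  show "set_integrable lborel {0<..<1} (\<lambda>r. ?W r * terminant p (of_real (2 * r * (1 - r)) * of_real y))"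
    using m y by (intro set_integrable_terminant_beta) auto
  fix r :: real assume r: "r \<in> {0<..<1}"
  have "?W r = of_real (Beta_weight (p + m) (p - m) r)"
    using Beta_weight_of_real[OF r, of "p + m" "p - m"] by simp
  moreover have "terminant p (of_real (2 * r * (1 - r) * y)) \<in> pos_Reals"
    using m y r by (intro terminant_in_pos_Reals) auto
  ultimately show "?W r * terminant p (of_real (2 * r * (1 - r)) * of_real y) \<in> pos_Reals"
    using Beta_weight_pos[OF r] by (simp add: pos_Reals_mult of_real_in_pos_Reals_iff)
qed auto

lemma legendre_terminant_in_pos_Reals:
  fixes m s x :: real
  assumes m: "\<bar>m\<bar> < p" and s: "s > 0" and x: "x > 0"
  shows "legendre_terminant p (of_real s) (of_real m) (of_real x) \<in> pos_Reals"
  unfolding legendre_terminant_def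
proof (rule set_integral_in_pos_Reals)
  let ?f = "\<lambda>t. Gamma_weight (of_real s) t * terminant_beta p (of_real m) (of_real x / of_real t)"
  show "set_integrable lborel {0<..} ?f"
    using m s x by (intro set_integrable_legendre_terminant) auto
  show "?f t \<in> pos_Reals" if "t \<in> {0<..}" for t
    using terminant_beta_in_pos_Reals[OF m, of "x / t"] that x
    by (simp add: Gamma_weight_of_real Gamma_weight_pos pos_Reals_mult of_real_in_pos_Reals_iff)
qed auto

lemma a_cos_ratio_pos:
  assumes "\<bar>m\<bar> < real N + 1/2"
  shows "a_cos_ratio N m > 0"
  unfolding a_cos_ratio_eq_Beta[OF assms] Beta_def using assms
  by (auto intro!: mult_pos_pos divide_pos_pos Gamma_real_pos)

lemma a_coeff_eq_a_cos_ratio: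
  assumes "\<bar>m\<bar> < real N + 1/2"
  shows "a_coeff N m = (- 1) ^ N * cos (pi * m) * a_cos_ratio N m"
  unfolding a_coeff_eq_Beta_real[OF assms] a_cos_ratio_eq_Beta[OF assms]
  using power_mult_distrib[of "- 1" "2 :: real" N] by simp

lemma legendre_rem_real:
  fixes m n x :: real
  assumes m: "\<bar>m\<bar> < real N + 1/2" and n: "n > real N - 1/2" and x: "x > 0"
  obtains r where "r > 0" "legendre_rem N (of_real x) (of_real m) (of_real n) = of_real ((- 1) ^ N * cos (pi * m) * r)"
proof -
  have "n - real N + 1/2 > 0"
    using n by simp
  from legendre_terminant_in_pos_Reals[OF m this x] obtain r
    where r: "r > 0" "legendre_terminant (real N + 1/2) (of_real (n - real N + 1/2)) (of_real m) (of_real x) = of_real r"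
    by (auto simp: pos_Reals_def)
  have "legendre_rem N (of_real x) (of_real m) (of_real n) =
      of_real ((- 2 * x) ^ N * (cos (pi * m) / pi powr (3/2)) * r)"
    unfolding legendre_rem_def of_real_cos_pi using r(2) by simp
  also have "(- 2 * x) ^ N = (- 1) ^ N * (2 * x) ^ N"
    by (simp only: power_mult_distrib[symmetric]) simp
  finally show ?thesis
    using that[of "(2 * x) ^ N / pi powr (3/2) * r"] r(1) x by simp
qed

lemma P2_term_real:
  fixes m n x :: real
  assumes "\<bar>m\<bar> < real M + 1/2"
  shows "P2_term M (of_real x) (of_real m) (of_real n) = of_real ((- 1) ^ M * cos (pi * m) *
    (a_cos_ratio M m * Gamma (n - real M + 1/2) * (exp x / sinh x) ^ M))"
proof -
  have "Gamma (complex_of_real n - of_nat M + 1/2) = of_real (Gamma (n - real M + 1/2))"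
    by (simp flip: Gamma_complex_of_real)
  moreover have "sinh (complex_of_real x) = of_real (sinh x)"
    by (simp add: sinh_def scaleR_conv_of_real flip: exp_of_real)
  ultimately show ?thesis
    unfolding P2_term_def of_real_a_coeff[symmetric] a_coeff_eq_a_cos_ratio[OF assms] by (simp flip: exp_of_real)
qed

lemma legendre_R2_real:
  fixes x m n :: real
  assumes x: "x > 0" and m: "\<bar>m\<bar> < real M + 1/2" and n: "n > real M - 1/2"
  shows "legendre_R2 M (of_real x) (of_real m) (of_real n) \<in> \<real>"
    and "norm (legendre_R2 M (of_real x) (of_real m) (of_real n)) \<le> norm (P2_term M (of_real x) (of_real m) (of_real n))"
    and "sgn (Re (legendre_R2 M (of_real x) (of_real m) (of_real n))) = sgn (Re (P2_term M (of_real x) (of_real m) (of_real n)))"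
proof -
  define T where "T = a_cos_ratio M m * Gamma (n - real M + 1/2) * (exp x / sinh x) ^ M"
  have pos: "Gamma (n - real M + 1/2) > 0" "a_cos_ratio M m > 0" "exp x / sinh x > 0"
    using n x by (auto intro: Gamma_real_pos a_cos_ratio_pos[OF m])
  then have T: "T > 0"
    by (simp only: T_def mult_pos_pos zero_less_power)
  note P2 = P2_term_real[OF m, of x n, folded T_def]
  have arg: "exp (complex_of_real x) / sinh (of_real x) = of_real (exp x / sinh x)"
    by (simp add: sinh_def scaleR_conv_of_real flip: exp_of_real)
  obtain r where r: "r > 0" and
    R2: "legendre_R2 M (of_real x) (of_real m) (of_real n) = of_real ((- 1) ^ M * cos (pi * m) * r)"
    unfolding legendre_R2_def arg by (rule legendre_rem_real[OF m n pos(3)])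
  show "legendre_R2 M (of_real x) (of_real m) (of_real n) \<in> \<real>"
    unfolding R2 by (rule Reals_of_real)
  show "sgn (Re (legendre_R2 M (of_real x) (of_real m) (of_real n))) = sgn (Re (P2_term M (of_real x) (of_real m) (of_real n)))"
    unfolding R2 P2 Re_complex_of_real using r T by (simp add: sgn_mult)
  have "norm (legendre_R2 M (of_real x) (of_real m) (of_real n)) \<le>
      norm (cos (of_real pi * complex_of_real m)) * a_cos_ratio M (Re (of_real m)) *
      Gamma (Re (of_real n) - real M + 1/2) * norm (exp (complex_of_real x) / sinh (of_real x)) ^ M"
    using m n x by (intro norm_legendre_R2_le) auto
  also have "\<dots> = norm (P2_term M (of_real x) (of_real m) (of_real n))"
    unfolding P2 arg of_real_cos_pi norm_of_real T_def using pos by (simp add: abs_mult power_abs)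
  finally show "norm (legendre_R2 M (of_real x) (of_real m) (of_real n)) \<le> norm (P2_term M (of_real x) (of_real m) (of_real n))" .
qed

theorem theorem3p1:
  shows "\<exists>R1 R2 :: nat \<Rightarrow> complex \<Rightarrow> complex \<Rightarrow> complex \<Rightarrow> complex.
    (\<forall>\<xi>\<in>D1. \<forall>N M. \<forall>\<mu> \<nu>.
       \<bar>Re \<mu>\<bar> < min (real N + 1/2) (real M + 1/2) \<longrightarrow>
       Re \<nu> > max (real N - 1/2) (real M - 1/2) \<longrightarrow>
         legendre_P \<nu> \<mu> (cosh \<xi>) =
           exp ((\<nu> + 1/2) * \<xi>) / (Gamma (\<nu> - \<mu> + 1) * csqrt (2 * of_real pi * sinh \<xi>)) *
             ((\<Sum>n<N. P1_term n \<xi> \<mu> \<nu>) + R1 N \<xi> \<mu> \<nu>) +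
           C_coeff \<xi> \<mu> * exp (- (\<nu> + 1/2) * \<xi>) /
               (Gamma (\<nu> - \<mu> + 1) * csqrt (2 * of_real pi * sinh \<xi>)) *
             ((\<Sum>m<M. P2_term m \<xi> \<mu> \<nu>) + R2 M \<xi> \<mu> \<nu>) \<and>
         norm (R1 N \<xi> \<mu> \<nu>) \<le>
           norm (cos (of_real pi * \<mu>)) * a_cos_ratio N (Re \<mu>) * Gamma (Re \<nu> - real N + 1/2) *
             norm (exp (- \<xi>) / sinh \<xi>) ^ N * P1_factor N \<xi> \<and>
         norm (R2 M \<xi> \<mu> \<nu>) \<le>
           norm (cos (of_real pi * \<mu>)) * a_cos_ratio M (Re \<mu>) * Gamma (Re \<nu> - real M + 1/2) *
             norm (exp \<xi> / sinh \<xi>) ^ M) \<and>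
    (\<forall>M. \<forall>x \<mu> \<nu> :: real.
       x > 0 \<longrightarrow> \<bar>\<mu>\<bar> < real M + 1/2 \<longrightarrow> \<nu> > real M - 1/2 \<longrightarrow>
         R2 M (of_real x) (of_real \<mu>) (of_real \<nu>) \<in> \<real> \<and>
         norm (R2 M (of_real x) (of_real \<mu>) (of_real \<nu>)) \<le>
           norm (P2_term M (of_real x) (of_real \<mu>) (of_real \<nu>)) \<and>
         sgn (Re (R2 M (of_real x) (of_real \<mu>) (of_real \<nu>))) =
           sgn (Re (P2_term M (of_real x) (of_real \<mu>) (of_real \<nu>))))"
proof (rule exI[of _ legendre_R1], rule exI[of _ legendre_R2], intro conjI ballI allI impI)
  fix \<xi> N M \<mu> \<nu>
  assume "\<xi> \<in> D1" "\<bar>Re \<mu>\<bar> < min (real N + 1/2) (real M + 1/2)" "Re \<nu> > max (real N - 1/2) (real M - 1/2)"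
  then have \<xi>: "\<xi> \<in> D1" "Re \<xi> > 0" and \<mu>: "\<bar>Re \<mu>\<bar> < real N + 1/2" "\<bar>Re \<mu>\<bar> < real M + 1/2"
    and \<nu>: "Re \<nu> > real N - 1/2" "Re \<nu> > real M - 1/2"
    by (simp_all add: D1_def)
  show "legendre_P \<nu> \<mu> (cosh \<xi>) =
      exp ((\<nu> + 1/2) * \<xi>) / (Gamma (\<nu> - \<mu> + 1) * csqrt (2 * of_real pi * sinh \<xi>)) *
        ((\<Sum>n<N. P1_term n \<xi> \<mu> \<nu>) + legendre_R1 N \<xi> \<mu> \<nu>) +
      C_coeff \<xi> \<mu> * exp (- (\<nu> + 1/2) * \<xi>) / (Gamma (\<nu> - \<mu> + 1) * csqrt (2 * of_real pi * sinh \<xi>)) *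
        ((\<Sum>m<M. P2_term m \<xi> \<mu> \<nu>) + legendre_R2 M \<xi> \<mu> \<nu>)"
    by (rule legendre_P_eq_R1_R2[OF \<xi>(1) \<mu> \<nu>])
  show "norm (legendre_R1 N \<xi> \<mu> \<nu>) \<le> norm (cos (of_real pi * \<mu>)) * a_cos_ratio N (Re \<mu>) *
      Gamma (Re \<nu> - real N + 1/2) * norm (exp (- \<xi>) / sinh \<xi>) ^ N * P1_factor N \<xi>"
    by (rule norm_legendre_R1_le[OF \<mu>(1) \<nu>(1) \<xi>(1)])
  show "norm (legendre_R2 M \<xi> \<mu> \<nu>) \<le> norm (cos (of_real pi * \<mu>)) * a_cos_ratio M (Re \<mu>) *
      Gamma (Re \<nu> - real M + 1/2) * norm (exp \<xi> / sinh \<xi>) ^ M"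
    by (rule norm_legendre_R2_le[OF \<mu>(2) \<nu>(2) \<xi>(2)])
qed (rule legendre_R2_real; assumption)+

end
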